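(* Let $S$ be a finite alphabet with a complementation, and let $V,W\subset S^d$ be nonempty equivalent polybox codes which do not contain twin pairs and such that $V\cap W=\emptyset$. Then $|V|\geq 12$.
   Context: An alphabet with a complementation is a set $S$ with a permutation $s\mapsto s'$ of $S$ such that $(s')'=s$ and $s'\ne s$ for all $s\in S$. Let $[d]=\{1,\dots,d\}$. Elements of $S^d$ are words $u=u_1\ldots u_d$. Words $u,v\in S^d$ are dichotomous if $u_j'=v_j$ for some $j\in[d]$. A polybox code is a set of pairwise dichotomous words. Words $u,v$ form a twin pair if there is $j\in[d]$ with $u_j'=v_j$ and $u_i=v_i$ for all $i\in[d]\setminus\{j\}$. A map $f$ preserves dichotomies if there are sets $X_1,\dots,X_d$ with $|X_i|\ge2$ and maps $f_i$ from $S$ to nonempty subsets of $X_i$ with $f_i(s)\neq X_i$ and $f_i(s')=X_i\setminus f_i(s)$ for all $s\in S$, and $f(s_1\ldots s_d)=f_1(s_1)\times\cdots\times f_d(s_d)$. Polybox codes $V,W\subset S^d$ are equivalent if $\bigcup_{v\in V}f(v)=\bigcup_{w\in W}f(w)$ for every map $f$ that preserves dichotomies. *)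

theory Defs
  imports "HOL-Library.FuncSet"
begin

text \<open>An alphabet with a complementation is a set \<open>S\<close> together with a function \<open>c\<close>;
  only the values of \<open>c\<close> on \<open>S\<close> matter, and \<open>c s\<close> is the letter written \<open>s'\<close>.\<close>

definition complementation :: "'a set \<Rightarrow> ('a \<Rightarrow> 'a) \<Rightarrow> bool" where
  "complementation S c \<longleftrightarrow> bij_betw c S S \<and> (\<forall>s\<in>S. c (c s) = s \<and> c s \<noteq> s)"

text \<open>Words are functions on \<open>{1..d}\<close>, extended by \<open>undefined\<close> so that distinct words are
  distinct functions.\<close>

definition words :: "'a set \<Rightarrow> nat \<Rightarrow> (nat \<Rightarrow> 'a) set" where
  "words S d = {1..d} \<rightarrow>\<^sub>E S"

definition dichotomous :: "('a \<Rightarrow> 'a) \<Rightarrow> nat \<Rightarrow> (nat \<Rightarrow> 'a) \<Rightarrow> (nat \<Rightarrow> 'a) \<Rightarrow> bool" where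
  "dichotomous c d u v \<longleftrightarrow> (\<exists>j\<in>{1..d}. c (u j) = v j)"

definition polybox_code :: "'a set \<Rightarrow> ('a \<Rightarrow> 'a) \<Rightarrow> nat \<Rightarrow> (nat \<Rightarrow> 'a) set \<Rightarrow> bool" where
  "polybox_code S c d V \<longleftrightarrow> V \<subseteq> words S d \<and> pairwise (dichotomous c d) V"

definition twin_pair :: "('a \<Rightarrow> 'a) \<Rightarrow> nat \<Rightarrow> (nat \<Rightarrow> 'a) \<Rightarrow> (nat \<Rightarrow> 'a) \<Rightarrow> bool" where
  "twin_pair c d u v \<longleftrightarrow>
     (\<exists>j\<in>{1..d}. c (u j) = v j \<and> (\<forall>i\<in>{1..d} - {j}. u i = v i))"

text \<open>The sets \<open>X i\<close> may be infinite, hence \<open>|X i| \<ge> 2\<close> is not expressed by \<open>card\<close> alone.\<close>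

definition preserves_dichotomies ::
    "'a set \<Rightarrow> ('a \<Rightarrow> 'a) \<Rightarrow> nat \<Rightarrow> ((nat \<Rightarrow> 'a) \<Rightarrow> (nat \<Rightarrow> 'x) set) \<Rightarrow> bool" where
  "preserves_dichotomies S c d f \<longleftrightarrow>
     (\<exists>(X :: nat \<Rightarrow> 'x set) (F :: nat \<Rightarrow> 'a \<Rightarrow> 'x set).
        (\<forall>i\<in>{1..d}. (infinite (X i) \<or> card (X i) \<ge> 2) \<and>
           (\<forall>s\<in>S. F i s \<subseteq> X i \<and> F i s \<noteq> {} \<and> F i s \<noteq> X i \<and> F i (c s) = X i - F i s)) \<and>
        (\<forall>u\<in>words S d. f u = (\<Pi>\<^sub>E i\<in>{1..d}. F i (u i))))"

text \<open>HOL cannot quantify over the type containing the sets \<open>X i\<close>, so they are taken in the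
  type \<open>'a set\<close> here. This loses nothing: by the lemma \<open>equivalent_codes_any_type\<close> below,
  the same equality of unions then holds for maps with values over an arbitrary type.\<close>

definition equivalent_codes ::
    "'a set \<Rightarrow> ('a \<Rightarrow> 'a) \<Rightarrow> nat \<Rightarrow> (nat \<Rightarrow> 'a) set \<Rightarrow> (nat \<Rightarrow> 'a) set \<Rightarrow> bool" where
  "equivalent_codes S c d V W \<longleftrightarrow>
     (\<forall>f :: (nat \<Rightarrow> 'a) \<Rightarrow> (nat \<Rightarrow> 'a set) set.
        preserves_dichotomies S c d f \<longrightarrow> (\<Union>v\<in>V. f v) = (\<Union>w\<in>W. f w))"

lemma equivalent_codes_sym: "equivalent_codes S c d V W \<Longrightarrow> equivalent_codes S c d W V"
  unfolding equivalent_codes_def by (intro allI impI) (rule sym, blast)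

lemma equivalent_codes_any_type_aux:
  fixes f :: "(nat \<Rightarrow> 'a) \<Rightarrow> (nat \<Rightarrow> 'x) set"
  assumes c: "complementation S c"
    and V: "V \<subseteq> words S d" and W: "W \<subseteq> words S d"
    and eq: "equivalent_codes S c d V W"
    and f: "preserves_dichotomies S c d f"
  shows "(\<Union>v\<in>V. f v) \<subseteq> (\<Union>w\<in>W. f w)"
proof
  fix x assume "x \<in> (\<Union>v\<in>V. f v)"
  then obtain v where v: "v \<in> V" "x \<in> f v" by auto
  obtain X F where XF0: "\<forall>i\<in>{1..d}. (infinite (X i) \<or> card (X i) \<ge> 2) \<and>
       (\<forall>s\<in>S. F i s \<subseteq> X i \<and> F i s \<noteq> {} \<and> F i s \<noteq> X i \<and> F i (c s) = X i - F i s)"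
    and fF0: "\<forall>u\<in>words S d. f u = (\<Pi>\<^sub>E i\<in>{1..d}. F i (u i))"
    using f unfolding preserves_dichotomies_def by (elim exE conjE) (rule that)
  have XF: "F i s \<subseteq> X i \<and> F i s \<noteq> {} \<and> F i s \<noteq> X i \<and> F i (c s) = X i - F i s"
    if "i \<in> {1..d}" "s \<in> S" for i s
    using XF0[THEN bspec, OF that(1)] that(2) by simp
  have fF: "f u = (\<Pi>\<^sub>E i\<in>{1..d}. F i (u i))" if "u \<in> words S d" for u
    using fF0 that by (rule bspec)
  define T where "T = (\<lambda>i y. {s\<in>S. y \<in> F i s})"
  define Y where "Y = (\<lambda>i. T i ` X i)"
  define G where "G = (\<lambda>i s. T i ` F i s)"
  define g where "g = (\<lambda>u::nat \<Rightarrow> 'a. \<Pi>\<^sub>E i\<in>{1..d}. G i (u i))"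
  have cS: "c s \<in> S" if "s \<in> S" for s
    using c that unfolding complementation_def bij_betw_def by auto
  have memG: "T i y \<in> G i s \<longleftrightarrow> y \<in> F i s" if "s \<in> S" for i y s
    using that unfolding G_def T_def by auto
  have GY: "G i s \<subseteq> Y i \<and> G i s \<noteq> {} \<and> G i s \<noteq> Y i \<and> G i (c s) = Y i - G i s"
    if "i \<in> {1..d}" "s \<in> S" for i s
  proof -
    note h = XF[OF that]
    have 1: "G i s \<subseteq> Y i" "G i s \<noteq> {}" using h unfolding G_def Y_def by auto
    obtain y where y: "y \<in> X i" "y \<notin> F i s" using h by blast
    have 2: "G i s \<noteq> Y i" using y memG[OF that(2)] unfolding Y_def by blast
    have 3: "G i (c s) = Y i - G i s"
      using h memG[OF that(2)] unfolding Y_def by (auto simp: G_def)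
    show ?thesis using 1 2 3 by simp
  qed
  have two: "infinite (Y i) \<or> card (Y i) \<ge> 2" if i: "i \<in> {1..d}" for i
  proof -
    have "v i \<in> S" using v(1) V i unfolding words_def by (blast dest: PiE_mem)
    from GY[OF i this] obtain a b where "a \<in> Y i" "b \<in> Y i" "a \<noteq> b" by blast
    then show ?thesis
      using card_le_Suc0_iff_eq[of "Y i"] by (cases "finite (Y i)") (auto simp: not_less_eq_eq[symmetric] numeral_2_eq_2)
  qed
  have "preserves_dichotomies S c d g"
    unfolding preserves_dichotomies_def
    by (rule exI[of _ Y], rule exI[of _ G], intro conjI ballI, rule two, assumption)
       (simp_all add: GY g_def)
  then have g: "(\<Union>v\<in>V. g v) = (\<Union>w\<in>W. g w)"
    using eq unfolding equivalent_codes_def by blast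
  define t where "t = (\<lambda>i\<in>{1..d}. T i (x i))"
  have tg: "t \<in> g u \<longleftrightarrow> (\<forall>i\<in>{1..d}. x i \<in> F i (u i))" if "u \<in> words S d" for u
  proof -
    have "u i \<in> S" if "i \<in> {1..d}" for i using \<open>u \<in> words S d\<close> that unfolding words_def
      by (rule PiE_mem)
    then show ?thesis unfolding g_def t_def PiE_iff using memG by auto
  qed
  have xE: "x \<in> extensional {1..d}" "\<forall>i\<in>{1..d}. x i \<in> F i (v i)"
    using v fF[of v] subsetD[OF V v(1)] by (simp_all add: PiE_iff)
  then have "t \<in> g v" using tg v V by blast
  then obtain w where w: "w \<in> W" "t \<in> g w" using g v by blast
  then have "\<forall>i\<in>{1..d}. x i \<in> F i (w i)" using tg W by blast
  then have "x \<in> f w" using fF[of w] subsetD[OF W w(1)] xE by (simp add: PiE_iff)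
  then show "x \<in> (\<Union>w\<in>W. f w)" using w by auto
qed

lemma equivalent_codes_any_type:
  fixes f :: "(nat \<Rightarrow> 'a) \<Rightarrow> (nat \<Rightarrow> 'x) set"
  assumes "complementation S c" "V \<subseteq> words S d" "W \<subseteq> words S d"
    and "equivalent_codes S c d V W" "preserves_dichotomies S c d f"
  shows "(\<Union>v\<in>V. f v) = (\<Union>w\<in>W. f w)"
  using equivalent_codes_any_type_aux[OF assms]
    equivalent_codes_any_type_aux[OF assms(1,3,2) equivalent_codes_sym[OF assms(4)] assms(5)]
  by (rule subset_antisym)

end

theory Submission
  imports Defs "HOL-Library.Multiset"
begin

text \<open>Write a letter as a pair of a class and a sign, so that \<open>V\<close> and \<open>W\<close> have the same sum as functions
  on points. Comparing two points that differ at coordinate \<open>i\<close> in the class of \<open>s\<close> only gives, for words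
  without their coordinate \<open>i\<close>, the identity \<open>V\<^sup>s + W\<^sup>s\<^sup>' = W\<^sup>s + V\<^sup>s\<^sup>'\<close>, where \<open>V\<^sup>s\<close> consists of the words
  of \<open>V\<close> with letter \<open>s\<close> at \<open>i\<close>. The sizes \<open>m\<close> of one side of these identities, summed over the classes at
  \<open>i\<close>, make up \<open>|V|\<close>, and some \<open>i\<close> has at least two classes; hence \<open>|V| < 12\<close> forces \<open>0 < m \<le> 5\<close> somewhere.

  If some words of \<open>V\<close> and \<open>W\<close> differ in one coordinate only, a covering argument gives two classes with
  \<open>m \<ge> 6\<close>. Otherwise the two sides of each identity are kept apart so well that \<open>0 < m \<le> 5\<close> implies
  \<open>m = 4\<close>, and then at some other coordinate \<open>k\<close> one side consists of four words \<open>bc\<close>, \<open>bc'\<close>, \<open>b'e\<close>, \<open>b'e'\<close>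
  with equal remaining letters. The twins \<open>bc\<close>, \<open>bc'\<close> come one from \<open>V\<close> and one from \<open>W\<close>, and this is
  incompatible with \<open>m \<le> 5\<close> for the class of \<open>b\<close> at \<open>k\<close>. The other classes at \<open>k\<close> contribute a further
  \<open>6\<close> or at least \<open>4 + 4\<close>.\<close>

section \<open>Trades\<close>

text \<open>Deleting a coordinate destroys the code property: a word of \<open>V\<close> and a word
  of \<open>W\<close> may then overlap or even coincide. The sides of an identity are therefore
  multisets of which only the counts at points are compared. Two things make up for the loss. Some
  incidence conditions survive the deletion, but only if no word of \<open>V\<close> is adjacent to
  a word of \<open>W\<close>, which is why that case is treated apart. And fixing the choice of
  letters at a further coordinate cuts a trade into two trades whose sizes add up to its own. Trades
  of one, two or three words can be listed completely. A good trade of at most five words admits no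
  selection of size zero or one at a coordinate where its sides differ, so four words split as 2 + 2
  and five as 2 + 3, both within the list. The split 2 + 3 leads to contradictions throughout, while
  2 + 2 leaves the four words of the overview. The bound six for adjacent words has another source:
  a code without twins needs five words to cover a word that it does not contain, and six if its
  words meeting that word all avoid one of its letters.\<close>

text \<open>A letter is a class together with a sign, and a point \<open>om\<close> selects one letter of every class at every
  coordinate. Words may be arbitrary outside the index set \<open>J\<close>, so \<open>agree J\<close> replaces equality, and a
  coordinate is deleted by passing from \<open>J\<close> to \<open>J - {j}\<close>.\<close>

definition neg :: "'k \<times> bool \<Rightarrow> 'k \<times> bool" where
  "neg l = (fst l, \<not> snd l)"

lemma fst_neg [simp]: "fst (neg l) = fst l"
  and snd_neg [simp]: "snd (neg l) = (\<not> snd l)"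
  and neg_neg [simp]: "neg (neg l) = l"
  and neg_neq [simp]: "neg l \<noteq> l" "l \<noteq> neg l"
  by (cases l; simp add: neg_def)+

lemma neg_eq_iff [simp]: "neg a = neg b \<longleftrightarrow> a = b"
  by (metis neg_neg)

lemma class_eqD: "fst a = fst b \<Longrightarrow> a = b \<or> a = neg b"
  by (cases a; cases b; auto simp: neg_def)

definition agree :: "'i set \<Rightarrow> ('i \<Rightarrow> 'l) \<Rightarrow> ('i \<Rightarrow> 'l) \<Rightarrow> bool" where
  "agree J u v \<longleftrightarrow> (\<forall>i\<in>J. u i = v i)"

definition hit :: "'i set \<Rightarrow> ('i \<Rightarrow> 'k \<Rightarrow> bool) \<Rightarrow> ('i \<Rightarrow> 'k \<times> bool) \<Rightarrow> bool" where
  "hit J om w \<longleftrightarrow> (\<forall>i\<in>J. om i (fst (w i)) = snd (w i))"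

definition ev :: "'i set \<Rightarrow> ('i \<Rightarrow> 'k \<Rightarrow> bool) \<Rightarrow> ('i \<Rightarrow> 'k \<times> bool) multiset \<Rightarrow> nat" where
  "ev J om F = size (filter_mset (hit J om) F)"

definition trade :: "'i set \<Rightarrow> ('i \<Rightarrow> 'k \<times> bool) multiset \<Rightarrow> ('i \<Rightarrow> 'k \<times> bool) multiset \<Rightarrow> bool" where
  "trade J F G \<longleftrightarrow> (\<forall>om. ev J om F = ev J om G)"

definition at :: "'i \<Rightarrow> 'k \<times> bool \<Rightarrow> ('i \<Rightarrow> 'k \<times> bool) multiset \<Rightarrow> ('i \<Rightarrow> 'k \<times> bool) multiset" where
  "at j l F = filter_mset (\<lambda>w. w j = l) F"

definition sel :: "'i \<Rightarrow> ('k \<Rightarrow> bool) \<Rightarrow> ('i \<Rightarrow> 'k \<times> bool) multiset \<Rightarrow> ('i \<Rightarrow> 'k \<times> bool) multiset" where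
  "sel j q F = filter_mset (\<lambda>w. q (fst (w j)) = snd (w j)) F"

lemma agree_refl [simp]: "agree J u u"
  by (simp add: agree_def)

lemma agree_sym: "agree J u v \<Longrightarrow> agree J v u"
  by (simp add: agree_def)

lemma agree_trans: "agree J u v \<Longrightarrow> agree J v w \<Longrightarrow> agree J u w"
  by (simp add: agree_def)

lemma agree_insertI: "agree (J - {j}) u v \<Longrightarrow> u j = v j \<Longrightarrow> agree J u v"
  by (auto simp: agree_def)

lemma hit_agree: "agree J u v \<Longrightarrow> hit J om u = hit J om v"
  by (simp add: agree_def hit_def)

lemma ev_simps [simp]:
  "ev J om {#} = 0"
  "ev J om (add_mset w F) = of_bool (hit J om w) + ev J om F"
  "ev J om (F + G) = ev J om F + ev J om G"
  by (simp_all add: ev_def)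

lemma trade_refl: "trade J F F"
  and trade_sym: "trade J F G \<Longrightarrow> trade J G F"
  and trade_trans: "trade J F G \<Longrightarrow> trade J G H \<Longrightarrow> trade J F H"
  and trade_add: "trade J F G \<Longrightarrow> trade J F' G' \<Longrightarrow> trade J (F + F') (G + G')"
  by (simp_all add: trade_def)

lemma trade_cancel: "trade J (F + H) (G + H') \<Longrightarrow> trade J H H' \<Longrightarrow> trade J F G"
  by (simp add: trade_def)

lemma at_simps [simp]:
  "at j l {#} = {#}"
  "at j l (add_mset w F) = (if w j = l then add_mset w (at j l F) else at j l F)"
  "at j l (F + G) = at j l F + at j l G"
  "w \<in># at j l F \<longleftrightarrow> w \<in># F \<and> w j = l"
  by (simp_all add: at_def)

lemma sel_simps [simp]:
  "sel j q {#} = {#}"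
  "sel j q (add_mset w F) = (if q (fst (w j)) = snd (w j) then add_mset w (sel j q F) else sel j q F)"
  "sel j q (F + G) = sel j q F + sel j q G"
  "w \<in># sel j q F \<longleftrightarrow> w \<in># F \<and> q (fst (w j)) = snd (w j)"
  by (simp_all add: sel_def)

lemma at_sel: "q (fst l) = snd l \<Longrightarrow> at j l (sel j q F) = at j l F"
  unfolding at_def sel_def filter_filter_mset by (rule filter_mset_cong) auto

lemma sel_compl: "sel j q F + sel j (\<lambda>x. \<not> q x) F = F"
  by (induction F) auto

lemma sel_flip:
  "sel j (q(fst l := \<not> snd l)) F + at j l F = sel j (q(fst l := snd l)) F + at j (neg l) F"
  by (induction F) (auto simp: neg_def prod_eq_iff)

lemma trade_sel:
  assumes "trade J F G" "j \<in> J"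
  shows "trade (J - {j}) (sel j q F) (sel j q G)"
proof -
  have "ev (J - {j}) om (sel j q H) = ev J (om(j := q)) H" for om H
  proof -
    have "hit J (om(j := q)) w \<longleftrightarrow> q (fst (w j)) = snd (w j) \<and> hit (J - {j}) om w" for w
      using assms(2) by (auto simp: hit_def)
    then have "hit J (om(j := q)) = (\<lambda>w. q (fst (w j)) = snd (w j) \<and> hit (J - {j}) om w)"
      by auto
    then show ?thesis by (simp add: ev_def sel_def filter_filter_mset)
  qed
  with assms(1) show ?thesis by (simp add: trade_def)
qed

lemma trade_at:
  assumes "trade J F G" "j \<in> J"
  shows "trade (J - {j}) (at j l F + at j (neg l) G) (at j l G + at j (neg l) F)"
  unfolding trade_def
proof
  fix om
  define q1 q2 where "q1 = (\<lambda>_. True)(fst l := snd l)" and "q2 = (\<lambda>_. True)(fst l := \<not> snd l)"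
  have e: "ev (J - {j}) om (sel j q2 H) + ev (J - {j}) om (at j l H)
      = ev (J - {j}) om (sel j q1 H) + ev (J - {j}) om (at j (neg l) H)" for H
    using arg_cong[OF sel_flip[of j "\<lambda>_. True" l H], of "ev (J - {j}) om"]
    by (simp add: q1_def q2_def)
  have "ev (J - {j}) om (sel j q F) = ev (J - {j}) om (sel j q G)" for q
    using trade_sel[OF assms] by (simp add: trade_def)
  from this[of q1] this[of q2] e[of F] e[of G]
  show "ev (J - {j}) om (at j l F + at j (neg l) G) = ev (J - {j}) om (at j l G + at j (neg l) F)"
    by simp
qed

text \<open>Every word is selected by exactly one of a choice and its complement, so the two
  selected trades add up to the whole.\<close>

lemma trade_erase:
  assumes "trade J F G"
  shows "trade (J - {j}) F G"
proof (cases "j \<in> J")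
  case True
  let ?q = "\<lambda>_. True"
  from trade_add[OF trade_sel[OF assms True, of ?q] trade_sel[OF assms True, of "\<lambda>x. \<not> ?q x"]]
  show ?thesis unfolding sel_compl .
next
  case False
  then show ?thesis using assms by simp
qed

lemma trade_size:
  assumes "finite J" "trade J F G"
  shows "size F = size G"
  using assms
proof (induction J rule: finite_induct)
  case empty
  then have "ev {} undefined F = ev {} undefined G" unfolding trade_def by (rule allE)
  then show ?case by (simp add: ev_def hit_def[abs_def])
next
  case (insert j J)
  from trade_erase[OF insert.prems, of j] insert.hyps insert.IH show ?case by simp
qed

text \<open>With a constant letter at \<open>j\<close>, a point either misses all words or counts
  them as it does without the coordinate \<open>j\<close>.\<close>

lemma trade_extend:
  assumes "trade (J - {j}) F G" "\<And>w. w \<in># F + G \<Longrightarrow> w j = l"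
  shows "trade J F G"
proof -
  have "ev J om H = (if j \<in> J \<longrightarrow> om j (fst l) = snd l then ev (J - {j}) om H else 0)"
    if "\<And>w. w \<in># H \<Longrightarrow> w j = l" for om H
    using that
  proof (induction H)
    case (add w H)
    have "hit J om w \<longleftrightarrow> (j \<in> J \<longrightarrow> om j (fst l) = snd l) \<and> hit (J - {j}) om w"
      using add.prems[of w] by (auto simp: hit_def)
    with add show ?case by simp
  qed simp
  from this[of F] this[of G] assms show ?thesis by (simp add: trade_def)
qed

lemma trade_1:
  assumes "trade J {#a#} {#b#}"
  shows "agree J a b"
proof -
  \<comment> \<open>This point hits \<open>a\<close>, and in a class that \<open>a\<close> does not
    use it misses the letter of \<open>b\<close>. Hence it hits \<open>b\<close> only if
    \<open>b\<close> has the letters of \<open>a\<close>.\<close>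
  define om where "om = (\<lambda>i x. if x = fst (a i) then snd (a i) else \<not> snd (b i))"
  have "hit J om a" by (simp add: hit_def om_def)
  moreover have "ev J om {#a#} = ev J om {#b#}" using assms by (simp add: trade_def)
  ultimately have "hit J om b" by (cases "hit J om b") simp_all
  then show ?thesis
    by (auto simp: hit_def om_def agree_def prod_eq_iff split: if_splits)
qed

section \<open>Trades of size two and three\<close>

text \<open>The form of a nontrivial trade of two words for two words: letters \<open>x\<close>, \<open>x'\<close> against \<open>y\<close>, \<open>y'\<close> at \<open>l\<close>.\<close>

definition sq :: "'i set \<Rightarrow> 'i \<Rightarrow> ('i \<Rightarrow> 'k \<times> bool) \<Rightarrow> ('i \<Rightarrow> 'k \<times> bool) \<Rightarrow>
    ('i \<Rightarrow> 'k \<times> bool) \<Rightarrow> ('i \<Rightarrow> 'k \<times> bool) \<Rightarrow> bool" where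
  "sq J l a b e f \<longleftrightarrow> l \<in> J \<and> agree (J - {l}) a b \<and> agree (J - {l}) a e \<and> agree (J - {l}) a f
     \<and> b l = neg (a l) \<and> f l = neg (e l) \<and> fst (a l) \<noteq> fst (e l)"

lemma trade_agree: "agree J a b \<Longrightarrow> trade J {#a#} {#b#}"
  by (simp add: trade_def hit_agree)

text \<open>At a coordinate where \<open>a\<close> and \<open>e\<close> differ, counting the class
  of \<open>a l\<close> leaves two possibilities: \<open>a\<close> trades against \<open>f\<close>
  alone, which \<open>ne\<close> excludes, or \<open>b\<close> has the complementary letter while
  \<open>e\<close> and \<open>f\<close> avoid the class. The class of \<open>e l\<close> is then
  settled in the same way.\<close>

lemma trade_2:
  assumes fin: "finite J" and tr: "trade J {#a, b#} {#e, f#}"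
    and ne: "\<not> agree J a e" "\<not> agree J a f"
  shows "\<exists>l. sq J l a b e f"
proof -
  from ne(1) obtain l where l: "l \<in> J" "a l \<noteq> e l" by (auto simp: agree_def)
  note D = trade_at[OF tr l(1)]
  note Z = trade_size[OF finite_Diff[OF fin] D]
  have single: "\<not> (b l = neg (a l) \<and> e l = neg (a l) \<and> f l = a l)"
  proof
    assume h: "b l = neg (a l) \<and> e l = neg (a l) \<and> f l = a l"
    from trade_sel[OF tr l(1), of "\<lambda>_. snd (a l)"] h have "trade (J - {l}) {#a#} {#f#}"
      by (simp split: if_splits)
    from trade_1[OF this] h ne(2) show False by (auto intro: agree_insertI)
  qed
  have notaf: "\<not> (f l = a l \<and> b l \<noteq> a l \<and> b l \<noteq> neg (a l) \<and> e l \<noteq> neg (a l))"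
  proof
    assume h: "f l = a l \<and> b l \<noteq> a l \<and> b l \<noteq> neg (a l) \<and> e l \<noteq> neg (a l)"
    with D[of "a l"] l have "trade (J - {l}) {#a#} {#f#}" by simp
    from trade_1[OF this] h ne(2) show False by (auto intro: agree_insertI)
  qed
  have bl: "b l = neg (a l)" "e l \<noteq> neg (a l)" "f l \<noteq> a l" "f l \<noteq> neg (a l)"
    using Z[of "a l"] l(2) single notaf by (auto split: if_splits)
  from D[of "a l"] bl l have "trade (J - {l}) {#a#} {#b#}" by simp
  then have ab: "agree (J - {l}) a b" by (rule trade_1)
  have fe: "fst (a l) \<noteq> fst (e l)" using l(2) bl by (metis class_eqD neg_neg)
  have nb: "a l \<noteq> neg (e l)" using fe by auto
  have fl: "f l = neg (e l)"
    using Z[of "e l"] l(2) bl fe nb by (auto split: if_splits)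
  from D[of "e l"] bl l fl nb have "trade (J - {l}) {#f#} {#e#}" by (simp split: if_splits)
  then have ef: "agree (J - {l}) e f" by (metis trade_1 agree_sym)
  \<comment> \<open>Off \<open>l\<close> the words of each pair match, so erasing \<open>l\<close>
    equates twice the count of \<open>a\<close> with twice the count of \<open>e\<close>.\<close>
  have "trade (J - {l}) {#a#} {#e#}"
    using trade_erase[OF tr, of l] hit_agree[OF ab, symmetric] hit_agree[OF ef, symmetric]
    by (simp add: trade_def of_bool_def) (smt (verit) add_is_0 zero_neq_one)
  then have "agree (J - {l}) a e" by (rule trade_1)
  with ab ef bl fl fe l show ?thesis unfolding sq_def by (metis agree_trans)
qed

lemma size_1D: "size F = Suc 0 \<Longrightarrow> \<exists>a. F = {#a#}"
  using size_1_singleton_mset[of F] by simp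

lemma in_size_pos: "x \<in># F \<Longrightarrow> 0 < size F"
  by (cases F) auto

lemma size_2D:
  assumes "size F = 2"
  shows "\<exists>a b. F = {#a, b#}"
proof -
  from assms have "size F = Suc (Suc 0)" by simp
  from size_eq_Suc_imp_eq_union[OF this] obtain a A where A: "F = add_mset a A" by blast
  with assms have "size A = Suc 0" by simp
  then obtain b where "A = {#b#}" using size_1D by blast
  with A show ?thesis by (intro exI[of _ a] exI[of _ b]) simp
qed

lemma at_memD: "at j l F = A \<Longrightarrow> w \<in># A \<Longrightarrow> w \<in># F \<and> w j = l"
  by (metis at_simps(4))

lemma sel_memD: "sel j r F = A \<Longrightarrow> w \<in># A \<Longrightarrow> w \<in># F \<and> r (fst (w j)) = snd (w j)"
  by (metis sel_simps(4))

lemma trade_single: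
  assumes "finite J" "trade J {#a#} G"
  shows "\<exists>b. G = {#b#} \<and> agree J a b"
proof -
  have "size G = Suc 0" using trade_size[OF assms] by simp
  then obtain b where b: "G = {#b#}" using size_1D by blast
  show ?thesis using trade_1 assms(2) b by blast
qed

lemma mset_split3:
  assumes "size F = 3" "a \<in># F" "b \<in># F" "a \<noteq> b"
  shows "\<exists>c. F = {#a, b, c#}"
proof -
  obtain F1 where F1: "F = add_mset a F1" using assms(2) by (auto dest: multi_member_split)
  with assms have "b \<in># F1" by auto
  then obtain F2 where F2: "F1 = add_mset b F2" by (auto dest: multi_member_split)
  with F1 assms(1) have "size F2 = 1" by simp
  then obtain c where "F2 = {#c#}" using size_1D by fastforce
  with F1 F2 show ?thesis by (intro exI[of _ c]) simp
qed

lemma at_add_mset: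
  assumes "at j l F = A" "g \<in># F" "g j \<noteq> l" "size F = Suc (size A)"
  shows "F = add_mset g A"
proof -
  let ?B = "filter_mset (\<lambda>w. w j \<noteq> l) F"
  have F: "F = A + ?B" unfolding assms(1)[symmetric] at_def by (rule multiset_partition)
  have "size F = size A + size ?B" using arg_cong[OF F, of size] by simp
  with assms(4) have "size ?B = Suc 0" by simp
  then obtain c where c: "?B = {#c#}" using size_1D by blast
  moreover have "g \<in># ?B" using assms by simp
  ultimately have "?B = {#g#}" by auto
  then show ?thesis using F by simp
qed

lemma size_at2: "l \<noteq> l' \<Longrightarrow> size (at j l F) + size (at j l' F) \<le> size F"
  by (induction F) auto

section \<open>Selections of a single word and trades of three words\<close>

lemma ev_flip_pair:
  assumes "p \<in> J" "agree (J - {p}) u v" "v p = neg (u p)"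
  shows "ev J om {#u, v#} = ev (J - {p}) om {#u#}"
proof -
  have "hit J om w \<longleftrightarrow> om p (fst (w p)) = snd (w p) \<and> hit (J - {p}) om w" for w
    using assms(1) by (auto simp: hit_def)
  from this[of u] this[of v] hit_agree[OF assms(2), of om] assms(3) show ?thesis
    by (cases "om p (fst (u p)) = snd (u p)") simp_all
qed

text \<open>The two selected words trade against each other off \<open>p\<close>. In the identities
  for their classes all terms at the selected letters reduce to \<open>f\<close> or
  \<open>g\<close>. The size bound holds because \<open>neg (f p)\<close> and
  \<open>neg (g p)\<close> are distinct letters of the complementary choice, which selects all words
  of \<open>F\<close> except \<open>f\<close>.\<close>

lemma one_one:
  assumes fin: "finite J" and tr: "trade J F G" and p: "p \<in> J"
    and sF: "sel p q F = {#f#}" and sG: "sel p q G = {#g#}" and ne: "\<not> agree J f g"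
  shows "agree (J - {p}) f g" and "fst (f p) \<noteq> fst (g p)"
    and "trade (J - {p}) ({#f#} + at p (neg (f p)) G) (at p (neg (f p)) F)"
    and "trade (J - {p}) ({#g#} + at p (neg (g p)) F) (at p (neg (g p)) G)"
    and "size (at p (neg (f p)) F) + size (at p (neg (g p)) F) < size F"
proof -
  have f: "f \<in># F" "q (fst (f p)) = snd (f p)" and g: "g \<in># G" "q (fst (g p)) = snd (g p)"
    using sel_memD[OF sF] sel_memD[OF sG] by auto
  show fg: "agree (J - {p}) f g"
    using trade_sel[OF tr p, of q] sF sG by (simp add: trade_1)
  then have "f p \<noteq> g p" using ne by (auto intro: agree_insertI)
  then show cl: "fst (f p) \<noteq> fst (g p)" using f(2) g(2) by (auto simp: prod_eq_iff)
  have A: "at p l F = at p l {#f#}" "at p l G = at p l {#g#}" if "q (fst l) = snd l" for l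
    unfolding sF[symmetric] sG[symmetric] using that by (simp_all add: at_sel)
  have 1: "at p (f p) F = {#f#}" "at p (f p) G = {#}"
    "at p (g p) F = {#}" "at p (g p) G = {#g#}"
    unfolding A[OF f(2)] A[OF g(2)] using \<open>f p \<noteq> g p\<close> by simp_all
  show "trade (J - {p}) ({#f#} + at p (neg (f p)) G) (at p (neg (f p)) F)"
    using trade_at[OF tr p, of "f p"] 1 by simp
  show "trade (J - {p}) ({#g#} + at p (neg (g p)) F) (at p (neg (g p)) G)"
    using trade_sym[OF trade_at[OF tr p, of "g p"]] 1 by simp
  let ?r = "\<lambda>x. \<not> q x"
  have n: "at p (neg (f p)) F = at p (neg (f p)) (sel p ?r F)"
    "at p (neg (g p)) F = at p (neg (g p)) (sel p ?r F)"
    using at_sel[of ?r "neg (f p)" p F] at_sel[of ?r "neg (g p)" p F] f g by auto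
  have "neg (f p) \<noteq> neg (g p)" using \<open>f p \<noteq> g p\<close> by simp
  from size_at2[OF this, of p "sel p ?r F"] n
  have "size (at p (neg (f p)) F) + size (at p (neg (g p)) F) \<le> size (sel p ?r F)" by simp
  moreover have "size F = 1 + size (sel p ?r F)"
    using arg_cong[OF sel_compl[of p q F], of size] sF by simp
  ultimately show "size (at p (neg (f p)) F) + size (at p (neg (g p)) F) < size F" by simp
qed

definition apart where
  "apart J X Y \<longleftrightarrow> (\<forall>x\<in>#X. \<forall>y\<in>#Y. \<not> agree J x y)"

lemma apartD: "apart J X Y \<Longrightarrow> x \<in># X \<Longrightarrow> y \<in># Y \<Longrightarrow> \<not> agree J x y"
  by (simp add: apart_def)

lemma apart_sym: "apart J X Y \<Longrightarrow> apart J Y X"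
  by (auto simp: apart_def dest: agree_sym)

text \<open>With letters \<open>a\<close>, \<open>b\<close> at \<open>p\<close> and \<open>e\<close>, \<open>g\<close> at \<open>q\<close>, the words are
  \<open>x1 = ae\<close>, \<open>x2 = a'e\<close>, \<open>x3 = be'\<close>, \<open>y1 = bg\<close>, \<open>y2 = bg'\<close>, \<open>y3 = b'e\<close>.\<close>

definition tri where
  "tri J p q x1 x2 x3 y1 y2 y3 \<longleftrightarrow> p \<in> J \<and> q \<in> J \<and> p \<noteq> q \<and>
     agree (J - {p, q}) x1 x2 \<and> agree (J - {p, q}) x1 x3 \<and>
     agree (J - {p, q}) x1 y1 \<and> agree (J - {p, q}) x1 y2 \<and> agree (J - {p, q}) x1 y3 \<and>
     x2 p = neg (x1 p) \<and> fst (x3 p) \<noteq> fst (x1 p) \<and> y1 p = x3 p \<and> y2 p = x3 p \<and> y3 p = neg (x3 p) \<and>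
     x2 q = x1 q \<and> y3 q = x1 q \<and> x3 q = neg (x1 q) \<and> fst (y1 q) \<noteq> fst (x1 q) \<and> y2 q = neg (y1 q)"

lemma tri_sym:
  assumes "tri J p q x1 x2 x3 y1 y2 y3"
  shows "tri J q p y1 y2 y3 x1 x2 x3"
proof -
  have e: "J - {p, q} = J - {q, p}" by blast
  have 1: "agree (J - {q, p}) x1 x2" "agree (J - {q, p}) x1 x3" "agree (J - {q, p}) x1 y1"
    "agree (J - {q, p}) x1 y2" "agree (J - {q, p}) x1 y3"
    using assms unfolding tri_def e by blast+
  show ?thesis
    unfolding tri_def
    by (intro conjI agree_trans[OF agree_sym[OF 1(3)]] 1 agree_refl)
      (insert assms, unfold tri_def, (metis)+)
qed

text \<open>As \<open>Y\<close> avoids \<open>neg (f p)\<close>, the word \<open>f\<close> has a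
  twin \<open>f2\<close> in \<open>X\<close>. The third word \<open>x3\<close> has letter
  \<open>neg (g p)\<close>: otherwise \<open>g\<close> has a twin as well, the two twin pairs
  cancel, and a trade of single words remains, against \<open>apart\<close>. What is left at
  \<open>neg (g p)\<close> is a trade of two words, which supplies the second coordinate of the
  triangle.\<close>

lemma trade_3_aux:
  assumes fin: "finite J" and tr: "trade J X Y" and sz: "size X = 3"
    and ap: "apart J X Y"
    and p: "p \<in> J" and sX: "sel p r X = {#f#}" and sY: "sel p r Y = {#g#}"
    and em: "at p (neg (f p)) Y = {#}"
  shows "\<exists>q x1 x2 x3 y1 y2 y3. X = {#x1, x2, x3#} \<and> Y = {#y1, y2, y3#} \<and> tri J p q x1 x2 x3 y1 y2 y3"
proof -
  have f: "f \<in># X" "r (fst (f p)) = snd (f p)" and g: "g \<in># Y" "r (fst (g p)) = snd (g p)"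
    using sel_memD[OF sX] sel_memD[OF sY] by auto
  note o = one_one[OF fin tr p sX sY apartD[OF ap, OF f(1) g(1)]]
  have fin': "finite (J - {p})" using fin by simp
  have szY: "size Y = 3" using trade_size[OF fin tr] sz by simp
  let ?n = "neg (f p)" and ?m = "neg (g p)"
  from o(3) em have t1: "trade (J - {p}) {#f#} (at p ?n X)" by simp
  from trade_single[OF fin' t1] obtain f2 where f2: "at p ?n X = {#f2#}" "agree (J - {p}) f f2" by blast
  note ff2 = f2(2)
  have f2X: "f2 \<in># X" "f2 p = ?n" using at_memD[OF f2(1)] by auto
  have "f \<noteq> f2" using f2X by auto
  then obtain x3 where X: "X = {#f, f2, x3#}" using mset_split3[OF sz f(1) f2X(1)] by blast
  have gn: "g p \<noteq> f p" "g p \<noteq> ?n" "?m \<noteq> ?n" "?m \<noteq> f p" using o(2) by (auto dest: arg_cong[of _ _ fst])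
  have gf2: "agree (J - {p}) g f2" using o(1) ff2 by (metis agree_sym agree_trans)
  have x3m: "x3 p = ?m"
  proof (rule ccontr)
    assume h: "x3 p \<noteq> ?m"
    then have "at p ?m X = {#}" using X gn f2X by auto
    with o(4) have t2: "trade (J - {p}) {#g#} (at p ?m Y)" by simp
    from trade_single[OF fin' t2] obtain g1
      where g1: "at p ?m Y = {#g1#}" and gg1: "agree (J - {p}) g g1" by blast
    have g1Y: "g1 \<in># Y" "g1 p = ?m" using at_memD[OF g1] by auto
    have "g \<noteq> g1" using g1Y by auto
    then obtain y where Y: "Y = {#g, g1, y#}" using mset_split3[OF szY g(1) g1Y(1)] by blast
    have "trade J {#f, f2#} {#g, g1#}"
      unfolding trade_def ev_flip_pair[OF p ff2 f2X(2)] ev_flip_pair[OF p gg1 g1Y(2)]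
      using hit_agree[OF o(1)] by simp
    moreover have "trade J ({#x3#} + {#f, f2#}) ({#y#} + {#g, g1#})"
      using tr unfolding X Y by (simp add: trade_def ac_simps)
    ultimately have "trade J {#x3#} {#y#}" by (metis trade_cancel)
    with ap X Y show False by (auto simp: apart_def dest: trade_1)
  qed
  then have aX: "at p ?m X = {#x3#}" using X gn f2X by auto
  with o(4) have t2: "trade (J - {p}) {#g, x3#} (at p ?m Y)"
    by (simp add: add_mset_commute)
  from trade_size[OF fin' this] have "size (at p ?m Y) = 2" by simp
  then obtain g1 g2 where g12: "at p ?m Y = {#g1, g2#}" using size_2D by blast
  have g1: "g1 \<in># Y" "g1 p = ?m" and g2: "g2 \<in># Y" "g2 p = ?m"
    using at_memD[OF g12] by auto
  have "Y = add_mset g {#g1, g2#}"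
    using at_add_mset[OF g12 g(1)] szY by simp
  then have Y: "Y = {#g1, g2, g#}" by (simp add: add_mset_commute)
  have x3: "x3 \<in># X" using X by simp
  have na: "\<not> agree (J - {p}) g1 x3" "\<not> agree (J - {p}) g2 x3"
    using apartD[OF ap, OF x3 g1(1)] apartD[OF ap, OF x3 g2(1)] x3m g1(2) g2(2)
    agree_insertI[of J p x3 g1] agree_insertI[of J p x3 g2] agree_sym[of "J - {p}" _ x3] by auto
  have "\<not> agree (J - {p}) g1 g"
  proof
    assume h: "agree (J - {p}) g1 g"
    have "trade (J - {p}) ({#x3#} + {#g#}) ({#g2#} + {#g1#})"
      using t2 g12 by (simp add: add_mset_commute)
    then have "trade (J - {p}) {#x3#} {#g2#}"
      by (rule trade_cancel) (rule trade_sym[OF trade_agree[OF h]])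
    with na(2) show False by (metis trade_1 agree_sym)
  qed
  moreover have "trade (J - {p}) {#g1, g2#} {#g, x3#}" using trade_sym[OF t2] g12 by simp
  ultimately obtain l where l: "sq (J - {p}) l g1 g2 g x3"
    using trade_2[OF fin' _ _ na(1)] by blast
  have sub: "agree (J - {p, l}) u v" if "agree (J - {p}) u v \<or> agree (J - {p} - {l}) u v" for u v
    using that by (auto simp: agree_def)
  have "agree (J - {p, l}) f f2" "agree (J - {p, l}) f g" "agree (J - {p, l}) g1 g"
    "agree (J - {p, l}) g1 g2" "agree (J - {p, l}) g1 x3"
    using l ff2 o(1) by (simp_all add: sub sq_def)
  then have "agree (J - {p, l}) f f2 \<and> agree (J - {p, l}) f x3 \<and> agree (J - {p, l}) f g1 \<and>
      agree (J - {p, l}) f g2 \<and> agree (J - {p, l}) f g"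
    by (simp add: agree_def)
  moreover have "f2 l = f l" "g l = f l" "l \<noteq> p" "l \<in> J"
    using l ff2 o(1) by (auto simp: sq_def agree_def)
  ultimately have tri: "tri J p l f f2 x3 g1 g2 g"
    unfolding tri_def using l p f2X(2) x3m g1(2) g2(2) o(2) by (simp add: sq_def)
  show ?thesis
    by (rule exI[of _ l], rule exI[of _ f], rule exI[of _ f2], rule exI[of _ x3],
        rule exI[of _ g1], rule exI[of _ g2], rule exI[of _ g]) (intro conjI X Y tri)
qed

lemma trade_3:
  assumes fin: "finite J" and tr: "trade J X Y" and sz: "size X = 3"
    and ap: "apart J X Y"
  shows "\<exists>p q x1 x2 x3 y1 y2 y3. X = {#x1, x2, x3#} \<and> Y = {#y1, y2, y3#} \<and> tri J p q x1 x2 x3 y1 y2 y3"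
proof -
  have szY: "size Y = 3" using trade_size[OF fin tr] sz by simp
  obtain x y where xy: "x \<in># X" "y \<in># Y"
    using sz szY by (metis multiset_nonemptyE size_empty zero_neq_numeral)
  with ap obtain p where p: "p \<in> J" "x p \<noteq> y p" by (fastforce simp: agree_def apart_def)
  \<comment> \<open>This choice selects \<open>x\<close>, and its complement selects
    \<open>y\<close>. Neither selection is empty and the sizes add up to three, so one of them is a
    single word.\<close>
  define r where "r = (\<lambda>c. if c = fst (x p) then snd (x p) else \<not> snd (y p))"
  have "x \<in># sel p r X" "y \<in># sel p (\<lambda>c. \<not> r c) Y"
    using xy p by (auto simp: r_def prod_eq_iff)
  note this[THEN in_size_pos]
  moreover have e: "size (sel p s X) = size (sel p s Y)" for s
    using trade_size[OF _ trade_sel[OF tr p(1)]] fin by simp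
  moreover have "size (sel p r X) + size (sel p (\<lambda>c. \<not> r c) X) = 3"
    using arg_cong[OF sel_compl[of p r X], of size] sz by simp
  ultimately have "size (sel p r X) = 1 \<or> size (sel p (\<lambda>c. \<not> r c) X) = 1"
    using e[of "\<lambda>c. \<not> r c"] by linarith
  then obtain s where s: "size (sel p s X) = 1" by blast
  with e obtain f g where fg: "sel p s X = {#f#}" "sel p s Y = {#g#}"
    using size_1D[of "sel p s X"] size_1D[of "sel p s Y"] by (metis One_nat_def)
  have f: "f \<in># X" and g: "g \<in># Y"
    using sel_memD[OF fg(1)] sel_memD[OF fg(2)] by auto
  have fin': "finite (J - {p})" using fin by simp
  note o = one_one[OF fin tr p(1) fg apartD[OF ap, OF f g]]
  \<comment> \<open>If both were nonempty, \<open>X\<close> would have at least two words with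
    letter \<open>neg (f p)\<close> and one with \<open>neg (g p)\<close>, while the bound of
    \<open>one_one\<close> allows two in total.\<close>
  have "size (at p (neg (f p)) Y) = 0 \<or> size (at p (neg (g p)) X) = 0"
    using trade_size[OF fin' o(3)] o(5) sz by (simp del: size_eq_0_iff_empty) linarith
  then show ?thesis
  proof
    assume "size (at p (neg (f p)) Y) = 0"
    then have "at p (neg (f p)) Y = {#}" by simp
    from trade_3_aux[OF fin tr sz ap p(1) fg this] show ?thesis by (rule exI)
  next
    assume "size (at p (neg (g p)) X) = 0"
    then have em: "at p (neg (g p)) X = {#}" by simp
    from trade_3_aux[OF fin trade_sym[OF tr] szY apart_sym[OF ap] p(1) fg(2,1) em]
    obtain q y1 y2 y3 x1 x2 x3 where Y: "Y = {#y1, y2, y3#}" and X: "X = {#x1, x2, x3#}"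
      and t: "tri J p q y1 y2 y3 x1 x2 x3" by (elim exE conjE) (rule that)
    show ?thesis
      by (rule exI[of _ q], rule exI[of _ p], rule exI[of _ x1], rule exI[of _ x2], rule exI[of _ x3],
          rule exI[of _ y1], rule exI[of _ y2], rule exI[of _ y3])
        (rule conjI[OF X conjI[OF Y tri_sym[OF t]]])
  qed
qed

section \<open>Good trades\<close>

definition adj where
  "adj J u v \<longleftrightarrow> (\<exists>l\<in>J. agree (J - {l}) u v \<and> fst (u l) \<noteq> fst (v l))"

definition dich where
  "dich J u v \<longleftrightarrow> (\<exists>i\<in>J. v i = neg (u i))"

definition lines where
  "lines J F G \<longleftrightarrow> (\<forall>f\<in>#F. \<forall>f'\<in>#F. \<forall>g\<in>#G. \<forall>l\<in>J.
     f' l = neg (f l) \<longrightarrow> agree (J - {l}) f f' \<longrightarrow> \<not> agree (J - {l}) f g)"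

definition nbr where
  "nbr J F G \<longleftrightarrow> (\<forall>f\<in>#F. \<forall>f'\<in>#F. \<forall>g\<in>#G.
     adj J f g \<longrightarrow> adj J f' g \<longrightarrow> agree J f f' \<or> dich J f f')"

text \<open>The conditions \<open>lines\<close> and \<open>nbr\<close> are what remains of the absence of twins in \<open>V\<close> and in \<open>W\<close>, and of
  adjacent words between \<open>V\<close> and \<open>W\<close>, when only the sums \<open>V\<^sup>s + W\<^sup>s\<^sup>'\<close> and \<open>W\<^sup>s + V\<^sup>s\<^sup>'\<close> are known.\<close>

definition good where
  "good J F G \<longleftrightarrow> finite J \<and> trade J F G \<and> apart J F G \<and>
     lines J F G \<and> lines J G F \<and> nbr J F G \<and> nbr J G F"

lemma good_sym: "good J F G \<Longrightarrow> good J G F"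
  unfolding good_def
  by (elim conjE) (intro conjI trade_sym[of J F G] apart_sym[of J F G]; assumption)

lemma goodD:
  assumes "good J F G"
  shows "finite J" "finite (J - {j})" "trade J F G" "apart J F G"
    "lines J F G" "lines J G F" "nbr J F G" "size F = size G"
  using assms trade_size[of J F G] unfolding good_def by simp_all

lemma linesD:
  "lines J F G \<Longrightarrow> f \<in># F \<Longrightarrow> f' \<in># F \<Longrightarrow> g \<in># G \<Longrightarrow> l \<in> J \<Longrightarrow>
    f' l = neg (f l) \<Longrightarrow> agree (J - {l}) f f' \<Longrightarrow> \<not> agree (J - {l}) f g"
  by (simp add: lines_def)

lemma apart_mono: "apart J F G \<Longrightarrow> F' \<subseteq># F \<Longrightarrow> G' \<subseteq># G \<Longrightarrow> apart J F' G'"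
  unfolding apart_def by (meson mset_subset_eqD)

lemma lines_mono: "lines J F G \<Longrightarrow> F' \<subseteq># F \<Longrightarrow> G' \<subseteq># G \<Longrightarrow> lines J F' G'"
  unfolding lines_def by (meson mset_subset_eqD)

lemma nbr_mono: "nbr J F G \<Longrightarrow> F' \<subseteq># F \<Longrightarrow> G' \<subseteq># G \<Longrightarrow> nbr J F' G'"
  unfolding nbr_def by (meson mset_subset_eqD)

lemma good_sub:
  assumes "good J F G" "F' \<subseteq># F" "G' \<subseteq># G" "trade J F' G'"
  shows "good J F' G'"
  using assms apart_mono lines_mono nbr_mono unfolding good_def by metis

lemma apart_same_letter:
  "apart J F G \<Longrightarrow> f \<in># F \<Longrightarrow> g \<in># G \<Longrightarrow> f p = g p \<Longrightarrow> \<not> agree (J - {p}) f g"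
  using agree_insertI[of J p f g] apartD[of J F G f g] by auto

text \<open>A square makes \<open>f1\<close> and \<open>f2\<close> twins with \<open>g\<close> on
  their line, and the common letter at \<open>p\<close> lifts this configuration from
  \<open>J - {p}\<close> to \<open>J\<close>, where \<open>lines\<close> forbids it. A trivial trade
  would match \<open>g\<close> with \<open>f1\<close> or \<open>f2\<close>, against
  \<open>apart\<close>.\<close>

lemma same_letter_pair:
  assumes g: "good J F G" and p: "p \<in> J" and f: "f1 \<in># F" "f2 \<in># F" and gG: "g \<in># G"
    and l: "f1 p = g p" "f2 p = g p" and tr: "trade (J - {p}) {#f1, f2#} {#g, x#}"
  shows False
proof -
  note G = goodD[OF g]
  have n: "\<not> agree (J - {p}) f1 g" "\<not> agree (J - {p}) f2 g"
    using apart_same_letter[OF G(4)] f gG l by auto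
  have "\<not> agree (J - {p}) f1 x"
  proof
    assume h: "agree (J - {p}) f1 x"
    have "trade (J - {p}) ({#f2#} + {#f1#}) ({#g#} + {#x#})"
      using tr by (simp add: add_mset_commute)
    then have "trade (J - {p}) {#f2#} {#g#}"
      by (rule trade_cancel) (rule trade_agree[OF h])
    then show False using n(2) trade_1 by blast
  qed
  from trade_2[OF G(2) tr n(1) this] obtain k where "sq (J - {p}) k f1 f2 g x" by blast
  then have "k \<in> J" "f2 k = neg (f1 k)" "agree (J - {k}) f1 f2" "agree (J - {k}) f1 g"
    using l by (auto simp: sq_def agree_def)
  with linesD[OF G(5) f gG] show False by blast
qed

text \<open>If no word of \<open>G\<close> has the letter \<open>neg (f p)\<close>, then
  \<open>f\<close> has a twin in \<open>F\<close> and \<open>g\<close> lies on the line of the two.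
  If one word \<open>g1\<close> has it, two words of \<open>F\<close> share this letter with
  \<open>g1\<close> and trade against \<open>g1\<close> and \<open>f\<close>.\<close>

lemma one_one_small:
  assumes g: "good J F G" and p: "p \<in> J"
    and s: "sel p r F = {#f#}" "sel p r G = {#g#}" and sz: "size (at p (neg (f p)) G) \<le> 1"
  shows False
proof -
  note G = goodD[OF g]
  have f: "f \<in># F" and gG: "g \<in># G" using sel_memD[OF s(1)] sel_memD[OF s(2)] by auto
  note o = one_one[OF G(1,3) p s apartD[OF G(4) f gG]]
  let ?n = "neg (f p)"
  consider "at p ?n G = {#}" | g1 where "at p ?n G = {#g1#}"
    using sz size_1D[of "at p ?n G"] by (cases "at p ?n G = {#}") (auto simp: le_Suc_eq)
  then show False
  proof cases
    case 1
    with o(3) have "trade (J - {p}) {#f#} (at p ?n F)" by simp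
    from trade_single[OF G(2) this] obtain f2
      where f2: "at p ?n F = {#f2#}" "agree (J - {p}) f f2" by blast
    have "f2 \<in># F" "f2 p = ?n" using at_memD[OF f2(1)] by auto
    with linesD[OF G(5) f _ gG p] f2(2) o(1) show False by blast
  next
    case 2
    with o(3) have t: "trade (J - {p}) {#f, g1#} (at p ?n F)" by (simp add: add_mset_commute)
    from trade_size[OF G(2) t] have "size (at p ?n F) = 2" by simp
    then obtain f1 f2 where f12: "at p ?n F = {#f1, f2#}" using size_2D by blast
    have m: "f1 \<in># F" "f1 p = ?n" "f2 \<in># F" "f2 p = ?n" "g1 \<in># G" "g1 p = ?n"
      using at_memD[OF f12] at_memD[OF 2] by auto
    have "trade (J - {p}) {#f1, f2#} {#g1, f#}"
      using trade_sym[OF t] f12 by (simp add: add_mset_commute)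
    from same_letter_pair[OF g p m(1,3,5) _ _ this] m show False by simp
  qed
qed

text \<open>The lower bound four for smaller trades enters as the assumption \<open>IH\<close>,
  because this lemma is itself the induction step of that bound.\<close>

lemma sel_ge2_aux:
  fixes F G :: "('i \<Rightarrow> 'k \<times> bool) multiset"
  assumes g: "good J F G" and sz: "size F \<le> 5" and j: "j \<in> J"
    and fg: "f \<in># F" "g \<in># G" "f j \<noteq> g j"
    and IH: "\<And>(F' :: ('i \<Rightarrow> 'k \<times> bool) multiset) G'. good J F' G' \<Longrightarrow> F' \<noteq> {#} \<Longrightarrow> size F' < size F \<Longrightarrow> 4 \<le> size F'"
  shows "2 \<le> size (sel j r F)"
proof (rule ccontr)
  note G = goodD[OF g]
  have e: "size (sel j r F) = size (sel j r G)"
    using trade_size[OF G(2) trade_sel[OF G(3) j]] .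
  assume "\<not> 2 \<le> size (sel j r F)"
  then consider "size (sel j r F) = 0" | "size (sel j r F) = Suc 0" by linarith
  then show False
  proof cases
    case 1
    with e have s: "sel j r F = {#}" "sel j r G = {#}" by simp_all
    let ?l = "f j"
    have "f \<notin># sel j r F" using s by simp
    then have "r (fst (neg ?l)) = snd (neg ?l)" using fg(1) by simp
    then have n: "at j (neg ?l) F = {#}" "at j (neg ?l) G = {#}"
      using at_sel[of r "neg ?l" j F] at_sel[of r "neg ?l" j G] s by simp_all
    \<comment> \<open>With \<open>neg ?l\<close> absent from both sides, the words with letter
      \<open>?l\<close> trade among themselves and split off. This part and the rest are good
      trades, nonempty because of \<open>f\<close> and \<open>g\<close>, so they would take 4 + 4
      words.\<close>
    have "trade (J - {j}) (at j ?l F) (at j ?l G)" using trade_at[OF G(3) j, of ?l] n by simp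
    then have t: "trade J (at j ?l F) (at j ?l G)"
      by (rule trade_extend) auto
    let ?F = "filter_mset (\<lambda>w. w j \<noteq> ?l) F" and ?G = "filter_mset (\<lambda>w. w j \<noteq> ?l) G"
    have pF: "F = ?F + at j ?l F" and pG: "G = ?G + at j ?l G"
      unfolding at_def using multiset_partition[of F "\<lambda>w. w j = ?l"] multiset_partition[of G "\<lambda>w. w j = ?l"]
      by (simp_all add: ac_simps)
    have t2: "trade J ?F ?G" using G(3) t pF pG by (metis trade_cancel)
    have g1: "good J (at j ?l F) (at j ?l G)" using good_sub[OF g _ _ t] by (simp add: at_def)
    have g2: "good J ?F ?G" using good_sub[OF g _ _ t2] by simp
    have 1: "f \<in># at j ?l F" "g \<in># ?G" using fg by auto
    then have p: "0 < size (at j ?l F)" "0 < size ?F"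
      using in_size_pos[OF 1(1)] in_size_pos[OF 1(2)] trade_size[OF G(1) t2] by simp_all
    then have q: "at j ?l F \<noteq> {#}" "?F \<noteq> {#}" by force+
    have z: "size F = size ?F + size (at j ?l F)" using arg_cong[OF pF, of size] by simp
    have "4 \<le> size (at j ?l F)" using IH[OF g1 q(1)] z p(2) by linarith
    moreover have "4 \<le> size ?F" using IH[OF g2 q(2)] z p(1) by linarith
    ultimately show False using sz z by linarith
  next
    case 2
    with e obtain f0 g0 where s: "sel j r F = {#f0#}" "sel j r G = {#g0#}" by (metis size_1D)
    have f0: "f0 \<in># F" and g0: "g0 \<in># G" using sel_memD[OF s(1)] sel_memD[OF s(2)] by auto
    note o = one_one[OF G(1,3) j s apartD[OF G(4) f0 g0]]
    \<comment> \<open>Otherwise at least three words of \<open>F\<close> have letter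
      \<open>neg (f0 j)\<close> and at least two have \<open>neg (g0 j)\<close>, but by
      \<open>one_one\<close> their total is below the size of \<open>F\<close>, hence below
      five.\<close>
    have "size (at j (neg (f0 j)) G) \<le> 1 \<or> size (at j (neg (g0 j)) F) \<le> 1"
      using trade_size[OF G(2) o(3)] o(5) sz by (simp del: size_eq_0_iff_empty) linarith
    then show False
      using one_one_small[OF g j s] one_one_small[OF good_sym[OF g] j s(2,1)] by blast
  qed
qed

lemma good_nonconst:
  assumes "good J F G" "F \<noteq> {#}"
  obtains j f g where "j \<in> J" "f \<in># F" "g \<in># G" "f j \<noteq> g j"
proof -
  obtain f where f: "f \<in># F" using assms(2) by blast
  then have "0 < size G" using goodD(8)[OF assms(1)] in_size_pos[OF f] by simp
  then obtain g where g: "g \<in># G" by (metis multiset_nonemptyE nonempty_has_size)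
  from apartD[OF goodD(4)[OF assms(1)] f g] that f g show ?thesis by (auto simp: agree_def)
qed

lemma sel_sum: "size (sel j r F) + size (sel j (\<lambda>x. \<not> r x) F) = size F"
  using arg_cong[OF sel_compl[of j r F], of size] by simp

lemma good_size4:
  assumes "good J F G" "F \<noteq> {#}"
  shows "4 \<le> size F"
  using assms
proof (induction "size F" arbitrary: F G rule: less_induct)
  case less
  show ?case
  proof (rule ccontr)
    assume n: "\<not> 4 \<le> size F"
    obtain j f g where *: "j \<in> J" "f \<in># F" "g \<in># G" "f j \<noteq> g j"
      using good_nonconst[OF less.prems] by metis
    have "2 \<le> size (sel j r F)" for r
      by (rule sel_ge2_aux[OF less.prems(1) _ *]) (use n less.hyps in auto)
    from this[of "\<lambda>_. True"] this[of "\<lambda>x. \<not> True"] sel_sum[of j "\<lambda>_. True" F] n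
    show False by linarith
  qed
qed

lemma sel_ge2:
  assumes "good J F G" "size F \<le> 5" "j \<in> J" "f \<in># F" "g \<in># G" "f j \<noteq> g j"
  shows "2 \<le> size (sel j r F)"
  by (rule sel_ge2_aux[OF assms]) (rule good_size4)

lemma rot3: "{#a, b, c#} = add_mset c {#a, b#}"
  by (simp add: add_mset_commute)

section \<open>Good trades of size five\<close>

lemma size_sel_sum:
  assumes "finite C" "\<And>w. w \<in># F \<Longrightarrow> fst (w j) \<in> C"
  shows "size (sel j r F) = (\<Sum>x\<in>C. size (at j (x, r x) F))"
  using assms(2)
proof (induction F)
  case (add w F)
  have "(\<Sum>x\<in>C. size (at j (x, r x) (add_mset w F)))
      = (\<Sum>x\<in>C. of_bool (x = fst (w j) \<and> r (fst (w j)) = snd (w j)) + size (at j (x, r x) F))"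
    by (rule sum.cong) (auto simp: prod_eq_iff)
  also have "\<dots> = (\<Sum>x\<in>C. of_bool (x = fst (w j) \<and> r (fst (w j)) = snd (w j)))
      + (\<Sum>x\<in>C. size (at j (x, r x) F))"
    by (rule sum.distrib)
  also have "(\<Sum>x\<in>C. of_bool (x = fst (w j) \<and> r (fst (w j)) = snd (w j)))
      = (\<Sum>x\<in>C. if x = fst (w j) then of_bool (r (fst (w j)) = snd (w j)) else 0 :: nat)"
    by (rule sum.cong) auto
  also have "\<dots> = of_bool (r (fst (w j)) = snd (w j))"
    using assms(1) add.prems[of w] by simp
  finally show ?case using add by simp
qed simp

lemma size_sel_flip:
  "size (sel j (r(fst l := \<not> snd l)) F) + size (at j l F)
    = size (sel j (r(fst l := snd l)) F) + size (at j (neg l) F)"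
  using arg_cong[OF sel_flip[of j r l F], of size] by simp

text \<open>If the letters \<open>x\<close>, \<open>x'\<close> at \<open>j\<close> occur in \<open>F\<close> as \<open>xu\<close>, \<open>x'w'\<close> and in \<open>G\<close> as \<open>xw\<close>, \<open>x'u'\<close>, then \<open>f\<close> and
  one of \<open>z\<close>, \<open>z'\<close> are adjacent to the same word of \<open>G\<close> without being dichotomous.\<close>

lemma no_twisted:
  assumes g: "good J F G" and j: "j \<in> J" and z: "z \<in># F" "z' \<in># F" and b: "b \<in># G" "b' \<in># G"
    and lt: "z j = b j" "z' j = neg (b j)" "b' j = neg (b j)"
    and s: "sq (J - {j}) i z b' b z'"
    and fg: "f \<in># F" "g \<in># G" "f j = g j" "fst (f j) \<noteq> fst (b j)"
    and tr: "trade (J - {j}) {#f, z#} {#g, b#}"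
  shows False
proof -
  note G = goodD[OF g]
  have i: "i \<in> J" "i \<noteq> j" "b' i = neg (z i)" "z' i = neg (b i)" "fst (z i) \<noteq> fst (b i)"
    and ag: "\<And>k. k \<in> J \<Longrightarrow> k \<noteq> j \<Longrightarrow> k \<noteq> i \<Longrightarrow> b' k = z k \<and> b k = z k \<and> z' k = z k"
    using s by (auto simp: sq_def agree_def)
  have zb: "agree (J - {i}) z b" "agree (J - {i}) z' b'"
  proof -
    have "z k = b k \<and> z' k = b' k" if "k \<in> J - {i}" for k
      using that ag[of k] lt by (cases "k = j") auto
    then show "agree (J - {i}) z b" "agree (J - {i}) z' b'" by (simp_all add: agree_def)
  qed
  have nb: "agree J u v \<or> dich J u v" if "u \<in># F" "v \<in># F" "w \<in># G" "adj J u w" "adj J v w" for u v w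
    using G(7) that unfolding nbr_def by blast
  show False
  proof (cases "agree (J - {j}) f b")
    case True
    then have fk: "\<And>k. k \<in> J \<Longrightarrow> k \<noteq> j \<Longrightarrow> f k = b k" by (simp add: agree_def)
    have "adj J f b" unfolding adj_def using j True fg(4) by blast
    moreover have "adj J z b" unfolding adj_def using i zb by (metis fst_neg)
    ultimately have "agree J f z \<or> dich J f z" using nb fg(1) z(1) b(1) by blast
    then show False
    proof
      assume "agree J f z"
      then show False using j lt(1) fg(4) by (auto simp: agree_def)
    next
      assume "dich J f z"
      then obtain k where k: "k \<in> J" "z k = neg (f k)" by (auto simp: dich_def)
      then have "fst (z k) = fst (f k)" by simp
      with i(5) lt(1) fg(4) fk[of i] i have "k \<noteq> j" "k \<noteq> i" by auto
      with k fk[of k] ag[of k] show False by simp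
    qed
  next
    case False
    have nfg: "\<not> agree (J - {j}) f g" using apart_same_letter[OF G(4) fg(1,2,3)] .
    from trade_2[OF G(2) tr nfg False] obtain i2 where s2: "sq (J - {j}) i2 f z g b" by blast
    then have i2: "z i2 = neg (f i2)" "b i2 = neg (g i2)"
      and ag2: "\<And>k. k \<in> J \<Longrightarrow> k \<noteq> j \<Longrightarrow> k \<noteq> i2 \<Longrightarrow> z k = f k \<and> g k = f k \<and> b k = f k"
      by (auto simp: sq_def agree_def)
    \<comment> \<open>Off \<open>j\<close>, the words \<open>z\<close> and \<open>b\<close> differ
      at \<open>i\<close> only, and a square differs in class at its own coordinate.\<close>
    have ii: "i2 = i" using ag2[of i] i by (cases "i2 = i") auto
    have fb: "agree (J - {j}) f b'" unfolding agree_def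
    proof
      fix k assume "k \<in> J - {j}"
      then show "f k = b' k" using i ii i2 ag[of k] ag2[of k] by (cases "k = i") auto
    qed
    have "adj J f b'" unfolding adj_def using j fb fg(4) lt(3) by (intro bexI[of _ j]) auto
    moreover have "adj J z' b'" unfolding adj_def using i zb by (metis fst_neg)
    ultimately have "agree J f z' \<or> dich J f z'" using nb fg(1) z(2) b(2) by blast
    then show False
    proof
      assume "agree J f z'"
      then show False using j lt(2) fg(4) by (auto simp: agree_def)
    next
      assume "dich J f z'"
      then obtain k where k: "k \<in> J" "z' k = neg (f k)" by (auto simp: dich_def)
      then have e: "fst (z' k) = fst (f k)" by simp
      have "k \<noteq> j" using e lt(2) fg(4) by auto
      moreover have "k \<noteq> i"
      proof
        assume "k = i"
        with e i(4) i2(1) ii i(5) have "fst (b i) = fst (z i)" by auto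
        with i(5) show False by simp
      qed
      ultimately have "z' k = f k" using k ag[of k] ag2[of k] ii by simp
      with k show False by simp
    qed
  qed
qed

text \<open>A match between some \<open>b1\<close> or \<open>b2\<close> and \<open>Y\<close> reduces
  to \<open>same_letter_pair\<close>, so \<open>trade_3\<close> gives a triangle. Since
  \<open>b1\<close> and \<open>b2\<close> have equal classes, \<open>f\<close> can only be the odd
  word \<open>x3\<close>; but \<open>x3\<close> lies on the line of the twins \<open>y1\<close>,
  \<open>y2\<close>.\<close>

lemma same_letter_triple:
  assumes g: "good J F G" and j: "j \<in> J"
    and Y: "size Y = 3" "\<And>y. y \<in># Y \<Longrightarrow> y \<in># G \<and> y j = n" and f: "f \<in># F" "f j = n"
    and b: "\<And>i. i \<in> J - {j} \<Longrightarrow> fst (b1 i) = fst (b2 i)"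
    and tr: "trade (J - {j}) {#b1, b2, f#} Y"
  shows False
proof -
  note G = goodD[OF g] and gs = good_sym[OF g]
  have nb: "\<not> agree (J - {j}) b y" if y: "y \<in># Y" and b: "b = b1 \<and> b' = b2 \<or> b = b2 \<and> b' = b1" for b b' y
  proof
    assume h: "agree (J - {j}) b y"
    obtain Y' where Y': "Y = add_mset y Y'" using y by (metis multi_member_split)
    then have "size Y' = 2" using Y(1) by simp
    then obtain y1 y2 where y12: "Y' = {#y1, y2#}" using size_2D by blast
    have e: "{#b1, b2, f#} = {#f, b'#} + {#b#}" using b by auto
    have "trade (J - {j}) ({#f, b'#} + {#b#}) ({#y1, y2#} + {#y#})"
      using tr unfolding e Y' y12 by simp
    then have "trade (J - {j}) {#f, b'#} {#y1, y2#}"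
      by (rule trade_cancel) (rule trade_agree[OF h])
    from same_letter_pair[OF gs j _ _ f(1) _ _ trade_sym[OF this]] show False
      using Y(2)[of y1] Y(2)[of y2] f(2) Y' y12 by simp
  qed
  have "\<not> agree (J - {j}) f y" if "y \<in># Y" for y
    using apart_same_letter[OF G(4) f(1)] Y(2)[OF that] f(2) by metis
  then have "apart (J - {j}) {#b1, b2, f#} Y"
    using nb unfolding apart_def by auto
  from trade_3[OF G(2) tr _ this] obtain p q x1 x2 x3 y1 y2 y3
    where X: "{#b1, b2, f#} = {#x1, x2, x3#}" and YY: "Y = {#y1, y2, y3#}"
      and t: "tri (J - {j}) p q x1 x2 x3 y1 y2 y3" by auto
  have y: "y1 \<in># G" "y2 \<in># G" "y1 j = n" "y2 j = n" using Y(2)[of y1] Y(2)[of y2] YY by auto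
  have cl: "fst (u p) = fst (v p)" if "{#u, v#} = {#b1, b2#}" for u v
  proof -
    have "p \<in> J - {j}" using t by (simp add: tri_def)
    from b[OF this] that show ?thesis by (auto simp: add_eq_conv_ex)
  qed
  have "f \<in># {#x1, x2, x3#}" unfolding X[symmetric] by simp
  then consider "f = x3" | "f = x1" | "f = x2" by auto
  then show False
  proof cases
    case 1
    from t have q: "q \<in> J" "q \<noteq> j" "p \<noteq> q" "y2 q = neg (y1 q)" "y1 p = x3 p" "y2 p = x3 p"
      and a: "agree (J - {j} - {p, q}) x1 x3" "agree (J - {j} - {p, q}) x1 y1" "agree (J - {j} - {p, q}) x1 y2"
      unfolding tri_def by blast+
    have "y1 k = y2 k \<and> y1 k = f k" if "k \<in> J - {q}" for k
    proof -
      consider "k = j" | "k = p" | "k \<in> J - {j} - {p, q}" using \<open>k \<in> J - {q}\<close> by blast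
      then show ?thesis using a q y(3,4) f(2) 1 by cases (simp_all add: agree_def)
    qed
    then have "agree (J - {q}) y1 y2" "agree (J - {q}) y1 f"
      unfolding agree_def by blast+
    with linesD[OF G(6) y(1,2) f(1) q(1,4)] show False by blast
  next
    case 2
    have "add_mset f {#x2, x3#} = add_mset f {#b1, b2#}" using X 2 rot3 by metis
    then have "{#x2, x3#} = {#b1, b2#}" by simp
    from cl[OF this] t show False unfolding tri_def by (metis fst_neg)
  next
    case 3
    have "add_mset f {#x1, x3#} = add_mset f {#b1, b2#}"
      using X 3 rot3 add_mset_commute by metis
    then have "{#x1, x3#} = {#b1, b2#}" by simp
    from cl[OF this] t show False unfolding tri_def by (metis fst_neg)
  qed
qed

text \<open>In a good trade of size five each selection at \<open>j\<close> has size two or three. Hence exactly one class is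
  unbalanced, by one; \<open>l\<close> is its rarer letter and \<open>r\<close> a selection of size two.\<close>

locale five =
  fixes J :: "'i set" and F G :: "('i \<Rightarrow> 'k \<times> bool) multiset"
    and j :: 'i and r :: "'k \<Rightarrow> bool" and l :: "'k \<times> bool"
  assumes good: "good J F G" and j: "j \<in> J" and l: "r (fst l) = snd l"
    and szF: "size (sel j r F) = 2" and szG: "size (sel j r G) = 2"
    and stepF: "size (at j (neg l) F) = Suc (size (at j l F))"
    and stepG: "size (at j (neg l) G) = Suc (size (at j l G))"
    and balF: "\<And>m. r (fst m) = snd m \<Longrightarrow> m \<noteq> l \<Longrightarrow> size (at j (neg m) F) = size (at j m F)"
    and balG: "\<And>m. r (fst m) = snd m \<Longrightarrow> m \<noteq> l \<Longrightarrow> size (at j (neg m) G) = size (at j m G)"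
begin

lemma swapped: "five J G F j r l"
  by unfold_locales
    (use good_sym[OF good] j l szF szG stepF stepG balF balG in auto)

lemmas G = goodD[OF good]

lemma tr_sel: "trade (J - {j}) (sel j r F) (sel j r G)"
  by (rule trade_sel[OF G(3) j])

lemma tr_at: "trade (J - {j}) (at j m F + at j (neg m) G) (at j m G + at j (neg m) F)"
  by (rule trade_at[OF G(3) j])

lemma at_le: "size (at j l F) \<le> 2"
  using at_sel[of r l j F, OF l] szF size_filter_mset_lesseq[of "\<lambda>w. w j = l" "sel j r F"]
  by (simp add: at_def)

lemma twin_ex:
  assumes z: "at j m F = {#z#}" and e: "at j m G = {#}" and m: "r (fst m) = snd m" "m \<noteq> l"
  shows "\<exists>z'. z' \<in># F \<and> z' j = neg m \<and> agree (J - {j}) z z'"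
proof -
  have "at j (neg m) G = {#}" using balG[OF m] e by simp
  with tr_at[of m] z e have "trade (J - {j}) {#z#} (at j (neg m) F)" by simp
  from trade_single[OF G(2) this] obtain z' where "at j (neg m) F = {#z'#}" "agree (J - {j}) z z'"
    by blast
  with at_memD[OF this(1), of z'] show ?thesis by auto
qed

text \<open>The digits in the names of the cases are the numbers of words with letter
  \<open>l\<close> in \<open>F\<close> and in \<open>G\<close>; exchanging \<open>F\<close> and
  \<open>G\<close> covers the remaining ones.\<close>

lemma case_00: "size (at j l F) = 0 \<Longrightarrow> size (at j l G) = 0 \<Longrightarrow> False"
proof -
  assume "size (at j l F) = 0" "size (at j l G) = 0"
  moreover from this obtain f g where fg: "at j (neg l) F = {#f#}" "at j (neg l) G = {#g#}"
    using stepF stepG size_1D by metis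
  ultimately have "trade (J - {j}) {#g#} {#f#}" using tr_at[of l] by simp
  then have "agree (J - {j}) g f" by (rule trade_1)
  moreover have "f \<in># F" "g \<in># G" "f j = g j" using at_memD[OF fg(1)] at_memD[OF fg(2)] by auto
  ultimately show False using apart_same_letter[OF G(4)] agree_sym by metis
qed

lemma case_10: "size (at j l F) = 1 \<Longrightarrow> size (at j l G) = 0 \<Longrightarrow> False"
proof -
  assume h: "size (at j l F) = 1" "size (at j l G) = 0"
  obtain f where f: "at j l F = {#f#}" using h(1) size_1D by (metis One_nat_def)
  obtain g where gg: "at j (neg l) G = {#g#}" using h(2) stepG size_1D by metis
  have "size (at j (neg l) F) = 2" using h(1) stepF by simp
  then obtain f1 f2 where ff: "at j (neg l) F = {#f1, f2#}" using size_2D by blast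
  have "trade (J - {j}) {#f1, f2#} {#g, f#}"
    using trade_sym[OF tr_at[of l]] h(2) f gg ff by (simp add: add_mset_commute)
  moreover have "f1 \<in># F" "f2 \<in># F" "f1 j = neg l" "f2 j = neg l" "g \<in># G" "g j = neg l"
    using at_memD[OF ff] at_memD[OF gg] by auto
  ultimately show False using same_letter_pair[OF good j, of f1 f2 g f] by simp
qed

lemma sel_all:
  assumes "size (at j l F) = 2"
  shows "sel j r F = at j l F"
proof -
  have "at j l F \<subseteq># sel j r F" using at_sel[of r l j F, OF l] by (metis at_def multiset_filter_subset)
  then show ?thesis
    using assms szF by (metis mset_subset_size subset_mset.le_imp_less_or_eq less_irrefl)
qed

lemma case_21: "size (at j l F) = 2 \<Longrightarrow> size (at j l G) = 1 \<Longrightarrow> False"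
proof -
  assume h: "size (at j l F) = 2" "size (at j l G) = 1"
  obtain g where gg: "at j l G = {#g#}" using h(2) size_1D by (metis One_nat_def)
  then have gG: "g \<in># G" "g j = l" using at_memD[OF gg] by auto
  then have "g \<in># sel j r G" using l by simp
  then obtain G' where G': "sel j r G = add_mset g G'" by (metis multi_member_split)
  then have "size G' = Suc 0" using szG by simp
  then obtain x where x: "G' = {#x#}" using size_1D by blast
  obtain f1 f2 where ff: "at j l F = {#f1, f2#}" using size_2D[OF h(1)] by blast
  have "sel j r F = {#f1, f2#}" using sel_all[OF h(1)] ff by simp
  with tr_sel G' x have "trade (J - {j}) {#f1, f2#} {#g, x#}" by simp
  moreover have "f1 \<in># F" "f2 \<in># F" "f1 j = l" "f2 j = l" using at_memD[OF ff] by auto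
  ultimately show False using same_letter_pair[OF good j, of f1 f2 g x] gG by simp
qed

text \<open>The three words of \<open>?Y\<close> trade against \<open>f\<close> together with
  \<open>g1\<close>, \<open>g2\<close>, or equally with \<open>z1\<close>, \<open>z2\<close>. In
  each case one of these pairs turns out to be a side of a square, so that
  \<open>same_letter_triple\<close> applies, or else a word of \<open>G\<close> lies on the line of
  twins of \<open>F\<close>.\<close>

lemma case_02:
  assumes h: "size (at j l F) = 0" "size (at j l G) = 2"
  shows False
proof -
  interpret s: five J G F j r l by (rule swapped)
  obtain f where f: "at j (neg l) F = {#f#}" using h(1) stepF size_1D by metis
  then have fF: "f \<in># F" "f j = neg l" using at_memD[OF f] by auto
  let ?Y = "at j (neg l) G"
  have Y: "size ?Y = 3" "\<And>y. y \<in># ?Y \<Longrightarrow> y \<in># G \<and> y j = neg l" using h(2) stepG by auto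
  have eG: "sel j r G = at j l G" using s.sel_all[OF h(2)] .
  obtain g1 g2 where gg: "at j l G = {#g1, g2#}" using size_2D[OF h(2)] by blast
  then have gG: "g1 \<in># G" "g2 \<in># G" using at_memD[OF gg] by auto
  obtain z1 z2 where zz: "sel j r F = {#z1, z2#}" using size_2D[OF szF] by blast
  have zF: "z1 \<in># F" "z2 \<in># F" "r (fst (z1 j)) = snd (z1 j)" "r (fst (z2 j)) = snd (z2 j)"
    using sel_memD[OF zz] by auto
  have tzg: "trade (J - {j}) {#z1, z2#} {#g1, g2#}" using tr_sel zz eG gg by simp
  have tY: "trade (J - {j}) {#g1, g2, f#} ?Y"
    using trade_sym[OF tr_at[of l]] h(1) gg f by (simp add: add_mset_commute)
  have tY': "trade (J - {j}) {#z1, z2, f#} ?Y"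
  proof (rule trade_trans[OF _ tY])
    show "trade (J - {j}) {#z1, z2, f#} {#g1, g2, f#}"
      using trade_add[OF tzg trade_refl[of _ "{#f#}"]] by (simp add: add_mset_commute)
  qed
  show False
  proof (cases "agree (J - {j}) z1 g1 \<or> agree (J - {j}) z1 g2")
    case False
    then obtain k where "sq (J - {j}) k z1 z2 g1 g2" using trade_2[OF G(2) tzg] by blast
    then have "fst (g1 i) = fst (g2 i)" if "i \<in> J - {j}" for i
      using that by (cases "i = k") (auto simp: sq_def agree_def)
    from same_letter_triple[OF good j Y fF this tY] show False .
  next
    case True
    then obtain g where g: "g \<in># G" "agree (J - {j}) z1 g" using gG by blast
    let ?m = "z1 j"
    have nl: "z1 j \<noteq> l" using h(1) zF(1) by (metis at_simps(4) empty_iff set_mset_empty size_eq_0_iff_empty)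
    have eF: "at j ?m F = at j ?m {#z1, z2#}" using at_sel[of r ?m j F] zF(3) zz by simp
    have "at j ?m G = at j ?m (at j l G)" using at_sel[of r ?m j G] zF(3) eG by simp
    also have "\<dots> = {#}" using at_memD[OF gg, of g1] at_memD[OF gg, of g2] nl unfolding gg by auto
    finally have e: "at j ?m G = {#}" .
    show False
    proof (cases "z2 j = ?m")
      case False
      then have "at j ?m F = {#z1#}" using eF by simp
      from twin_ex[OF this e zF(3) nl] obtain z' where "z' \<in># F" "z' j = neg ?m" "agree (J - {j}) z1 z'"
        by blast
      with linesD[OF G(5) zF(1) _ g(1) j] g(2) show False by blast
    next
      case True
      then have e12: "at j ?m F = {#z1, z2#}" using eF by simp
      then have "size (at j (neg ?m) F) = 2" using balF[OF zF(3) nl] by simp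
      then obtain z3 z4 where e34: "at j (neg ?m) F = {#z3, z4#}" using size_2D by blast
      have z34: "z3 \<in># F" "z4 \<in># F" "z3 j = neg ?m" "z4 j = neg ?m" using at_memD[OF e34] by auto
      have "at j (neg ?m) G = {#}" using balG[OF zF(3) nl] e by simp
      then have "trade (J - {j}) {#z1, z2#} {#z3, z4#}" using tr_at[of ?m] e e12 e34 by simp
      moreover have "\<not> agree (J - {j}) z1 z3" "\<not> agree (J - {j}) z1 z4"
        using linesD[OF G(5) zF(1) _ g(1) j] g(2) z34 by blast+
      ultimately obtain k where "sq (J - {j}) k z1 z2 z3 z4" using trade_2[OF G(2)] by blast
      then have "fst (z1 i) = fst (z2 i)" if "i \<in> J - {j}" for i
        using that by (cases "i = k") (auto simp: sq_def agree_def)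
      from same_letter_triple[OF good j Y fF this tY'] show False .
    qed
  qed
qed

lemma case_22:
  assumes h: "size (at j l F) = 2" "size (at j l G) = 2"
  shows False
proof -
  interpret s: five J G F j r l by (rule swapped)
  have "trade (J - {j}) (at j l F) (at j l G)"
    using tr_sel unfolding sel_all[OF h(1)] s.sel_all[OF h(2)] .
  then have t: "trade J (at j l F) (at j l G)" by (rule trade_extend[where l = l]) auto
  have "good J (at j l F) (at j l G)" by (rule good_sub[OF good _ _ t]) (simp_all add: at_def)
  moreover have "at j l F \<noteq> {#}" using h(1) by auto
  ultimately show False using good_size4 h(1) by fastforce
qed

text \<open>If \<open>G\<close> avoids the letter of \<open>z\<close>, balance provides the twin. If
  \<open>b\<close> shares this letter, a failure to be twins would be the crossed square that
  \<open>no_twisted\<close> excludes.\<close>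

lemma twin_11:
  assumes eF: "at j l F = {#f#}" "sel j r F = {#f, z#}" and eG: "at j l G = {#g#}" "sel j r G = {#g, b#}"
  shows "\<exists>z'. z' \<in># F \<and> z' j = neg (z j) \<and> agree (J - {j}) z z'"
proof -
  have f: "f \<in># F" "f j = l" and gG: "g \<in># G" "g j = l" using at_memD[OF eF(1)] at_memD[OF eG(1)] by auto
  have z: "z \<in># F" "r (fst (z j)) = snd (z j)" and b: "b \<in># G" "r (fst (b j)) = snd (b j)"
    using sel_memD[OF eF(2)] sel_memD[OF eG(2)] by auto
  have zl: "z j \<noteq> l" using at_sel[of r l j F, OF l] eF f(2) by (auto split: if_splits)
  let ?m = "z j"
  have mF: "at j ?m F = {#z#}" using at_sel[of r ?m j F, OF z(2)] eF f(2) zl by simp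
  have mG: "at j ?m G = at j ?m {#g, b#}" using at_sel[of r ?m j G, OF z(2)] eG by simp
  show ?thesis
  proof (cases "b j = ?m")
    case False
    with mG gG zl have "at j ?m G = {#}" by simp
    from twin_ex[OF mF this z(2) zl] show ?thesis .
  next
    case True
    with mG gG zl have mG1: "at j ?m G = {#b#}" by simp
    from mF balF[OF z(2) zl] obtain z2 where z2: "at j (neg ?m) F = {#z2#}" using size_1D by force
    from mG1 balG[OF z(2) zl] obtain b2 where b2: "at j (neg ?m) G = {#b2#}" using size_1D by force
    have zz: "z2 \<in># F" "z2 j = neg ?m" and bb: "b2 \<in># G" "b2 j = neg ?m"
      using at_memD[OF z2] at_memD[OF b2] by auto
    have t: "trade (J - {j}) {#z, b2#} {#b, z2#}"
      using tr_at[of ?m] mF mG1 z2 b2 by (simp add: add_mset_commute)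
    have "agree (J - {j}) z z2"
    proof (rule ccontr)
      assume n: "\<not> agree (J - {j}) z z2"
      have "\<not> agree (J - {j}) z b" using apart_same_letter[OF G(4) z(1) b(1)] True by simp
      from trade_2[OF G(2) t this n] obtain k where s: "sq (J - {j}) k z b2 b z2" by blast
      have "fst (f j) \<noteq> fst (b j)" using True zl f(2) z(2) l by (auto simp: prod_eq_iff)
      moreover have "trade (J - {j}) {#f, z#} {#g, b#}" using tr_sel eF eG by simp
      ultimately show False
        using no_twisted[OF good j z(1) zz(1) b(1) bb(1) _ _ _ s f(1) gG(1)] True zz bb f gG by simp
    qed
    with zz show ?thesis by blast
  qed
qed

lemma sel_step:
  assumes "at j l F = {#f#}" "sel j r F = {#f, z#}" "at j (neg l) F = {#f1, f2#}"
  shows "sel j (r(fst l := \<not> snd l)) F = {#z, f1, f2#}"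
proof -
  have "r(fst l := snd l) = r" using l by (rule fun_upd_idem)
  with sel_flip[of j r l F] assms
  have "add_mset f (sel j (r(fst l := \<not> snd l)) F) = add_mset f {#z, f1, f2#}"
    by (simp add: add_mset_commute)
  then show ?thesis by simp
qed

lemma sel_pair:
  assumes "at j l F = {#f#}"
  shows "\<exists>z. sel j r F = {#f, z#}"
proof -
  have "f \<in># sel j r F" using at_memD[OF assms, of f] l by simp
  then obtain F' where F': "sel j r F = add_mset f F'" by (metis multi_member_split)
  then have "size F' = Suc 0" using szF by simp
  then obtain z where "F' = {#z#}" using size_1D by blast
  with F' show ?thesis by blast
qed

text \<open>The selection of size two is a square, so off \<open>j\<close> the words
  \<open>z\<close> and \<open>b\<close> differ at one coordinate only. Flipping the class of
  \<open>l\<close> yields a triangle containing both. Most placements of \<open>z\<close> and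
  \<open>b\<close> in it differ at both coordinates \<open>p\<close> and \<open>q\<close>; the
  others leave twins from one side and a word of the other side on their line, all with the letter
  \<open>neg l\<close>.\<close>

lemma case_11:
  assumes h: "size (at j l F) = 1" "size (at j l G) = 1"
  shows False
proof -
  interpret s: five J G F j r l by (rule swapped)
  obtain f g where fg: "at j l F = {#f#}" "at j l G = {#g#}" using h size_1D by (metis One_nat_def)
  obtain z where z: "sel j r F = {#f, z#}" using sel_pair[OF fg(1)] by blast
  obtain b where b: "sel j r G = {#g, b#}" using s.sel_pair[OF fg(2)] by blast
  have "size (at j (neg l) F) = 2" "size (at j (neg l) G) = 2" using h stepF stepG by simp_all
  then obtain f1 f2 g1 g2 where ff: "at j (neg l) F = {#f1, f2#}" and gg: "at j (neg l) G = {#g1, g2#}"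
    using size_2D[of "at j (neg l) F"] size_2D[of "at j (neg l) G"] by blast
  have mF: "f \<in># F" "f j = l" "z \<in># F" "f1 \<in># F" "f2 \<in># F" "f1 j = neg l" "f2 j = neg l"
    using at_memD[OF fg(1)] at_memD[OF ff] sel_memD[OF z] by auto
  have mG: "g \<in># G" "g j = l" "b \<in># G" "g1 \<in># G" "g2 \<in># G" "g1 j = neg l" "g2 j = neg l"
    using at_memD[OF fg(2)] at_memD[OF gg] sel_memD[OF b] by auto
  obtain z' where z': "z' \<in># F" "z' j = neg (z j)" "agree (J - {j}) z z'"
    using twin_11[OF fg(1) z fg(2) b] by blast
  obtain b' where b': "b' \<in># G" "b' j = neg (b j)" "agree (J - {j}) b b'"
    using s.twin_11[OF fg(2) b fg(1) z] by blast
  have nz: "\<not> agree (J - {j}) z w" if "w \<in># G" for w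
    using linesD[OF G(5) mF(3) z'(1) that j z'(2,3)] .
  have nb: "\<not> agree (J - {j}) w b" if "w \<in># F" for w
    using linesD[OF G(6) mG(3) b'(1) that j b'(2,3)] agree_sym by blast
  have nl: "\<not> agree (J - {j}) u v" if "u \<in># F" "v \<in># G" "u j = v j" for u v
    using apart_same_letter[OF G(4)] that by metis
  have "trade (J - {j}) {#f, z#} {#g, b#}" using tr_sel z b by simp
  moreover have "\<not> agree (J - {j}) f g" using nl[OF mF(1) mG(1)] mF(2) mG(2) by simp
  ultimately obtain k where k: "sq (J - {j}) k f z g b"
    using trade_2[OF G(2) _ _ nb[OF mF(1)]] by blast
  have zb: "z i = b i" if "i \<in> J - {j}" "i \<noteq> k" for i using k that by (auto simp: sq_def agree_def)
  have kc: "fst (z k) \<noteq> fst (b k)" using k by (simp add: sq_def)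
  have t3: "trade (J - {j}) {#z, f1, f2#} {#b, g1, g2#}"
    using trade_sel[OF G(3) j, of "r(fst l := \<not> snd l)"]
    unfolding sel_step[OF fg(1) z ff] s.sel_step[OF fg(2) b gg] .
  have "apart (J - {j}) {#z, f1, f2#} {#b, g1, g2#}"
    unfolding apart_def using nz nb nl mF mG by simp
  from trade_3[OF G(2) t3 _ this] obtain p q x1 x2 x3 y1 y2 y3
    where X: "{#z, f1, f2#} = {#x1, x2, x3#}" and Y: "{#b, g1, g2#} = {#y1, y2, y3#}"
      and t: "tri (J - {j}) p q x1 x2 x3 y1 y2 y3"
    by (elim meta_impE exE conjE) (simp, rule that)
  have pq: "p \<in> J - {j}" "q \<in> J - {j}" "p \<noteq> q" using t unfolding tri_def by blast+
  have ag1: "x1 i = u i" if "u \<in> {x1, x2, x3, y1, y2, y3}" "i \<in> J - {j} - {p, q}" for u i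
  proof -
    have "\<forall>u\<in>{x1, x2, x3, y1, y2, y3}. agree (J - {j} - {p, q}) x1 u"
      using t unfolding tri_def by simp
    with that show ?thesis unfolding agree_def by blast
  qed
  have ag: "u i = v i" if "u \<in> {x1, x2, x3, y1, y2, y3}" "v \<in> {x1, x2, x3, y1, y2, y3}"
    "i \<in> J - {j} - {p, q}" for u v i
    using ag1[OF that(1,3)] ag1[OF that(2,3)] by simp
  have inX: "x \<in># F \<and> x j = neg l" if "x \<in># {#f1, f2#}" for x using that mF by auto
  have inY: "y \<in># G \<and> y j = neg l" if "y \<in># {#g1, g2#}" for y using that mG by auto
  have cancel: "{#u, v#} = {#c, e#}" if "{#a, c, e#} = {#a, u, v#}" for a c e u v :: "'i \<Rightarrow> 'k \<times> bool"
    using that by simp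
  have two: "\<not> (x \<in> {x1, x2} \<and> y \<in> {y1, y2} \<and> x = z \<and> y = b)" for x y
  proof
    assume h: "x \<in> {x1, x2} \<and> y \<in> {y1, y2} \<and> x = z \<and> y = b"
    then have "fst (z p) = fst (x1 p)" "fst (b p) = fst (x3 p)" "fst (z q) = fst (x1 q)" "fst (b q) = fst (y1 q)"
      using t unfolding tri_def by auto
    then have "z p \<noteq> b p" "z q \<noteq> b q" using t unfolding tri_def by auto
    with zb pq show False by metis
  qed
  have nXX: False if "{#x1, x2#} = {#f1, f2#}" "y3 \<in># {#g1, g2#}"
  proof -
    have i: "x1 \<in># F \<and> x1 j = neg l" "x2 \<in># F \<and> x2 j = neg l" "y3 \<in># G \<and> y3 j = neg l"
      using inX[of x1] inX[of x2] inY[OF that(2)] unfolding that(1)[symmetric] by auto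
    have v: "x2 p = neg (x1 p)" "x2 q = x1 q" "y3 q = x1 q" using t unfolding tri_def by blast+
    have "x1 c = x2 c \<and> x1 c = y3 c" if "c \<in> J - {p}" for c
      using that i v ag[of x1 x2 c] ag[of x1 y3 c] by (cases "c = j"; cases "c = q") auto
    then have "agree (J - {p}) x1 x2" "agree (J - {p}) x1 y3"
      unfolding agree_def by blast+
    with linesD[OF G(5)] i v(1) pq show False by blast
  qed
  have nYY: False if "{#y1, y2#} = {#g1, g2#}" "x3 \<in># {#f1, f2#}"
  proof -
    have i: "y1 \<in># G \<and> y1 j = neg l" "y2 \<in># G \<and> y2 j = neg l" "x3 \<in># F \<and> x3 j = neg l"
      using inY[of y1] inY[of y2] inX[OF that(2)] unfolding that(1)[symmetric] by auto
    have v: "y2 q = neg (y1 q)" "y2 p = y1 p" "x3 p = y1 p" using t unfolding tri_def by metis+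
    have "y1 c = y2 c \<and> y1 c = x3 c" if "c \<in> J - {q}" for c
      using that i v ag[of y1 y2 c] ag[of y1 x3 c] by (cases "c = j"; cases "c = p") auto
    then have "agree (J - {q}) y1 y2" "agree (J - {q}) y1 x3"
      unfolding agree_def by blast+
    with linesD[OF G(6)] i v(1) pq show False by blast
  qed
  have "z \<in># {#x1, x2, x3#}" unfolding X[symmetric] by simp
  then consider "z = x3" | "z \<in> {x1, x2}" by auto
  then show False
  proof cases
    case 1
    have e: "{#x1, x2#} = {#f1, f2#}"
    proof (rule cancel)
      show "{#z, f1, f2#} = {#z, x1, x2#}" unfolding 1 using trans[OF X rot3] unfolding 1 .
    qed
    have "b \<noteq> y3"
    proof
      assume "b = y3"
      then have "b p = neg (z p)" "z q = neg (b q)" using t 1 unfolding tri_def by metis+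
      then have "z p \<noteq> b p" "z q \<noteq> b q" by auto
      with zb pq show False by metis
    qed
    moreover have "y3 \<in># {#b, g1, g2#}" unfolding Y by simp
    ultimately have "y3 \<in># {#g1, g2#}" by auto
    with nXX e show False by blast
  next
    case 2
    have x3: "x3 \<in># {#f1, f2#}"
    proof -
      have "z = x1 \<or> z = x2" using 2 by blast
      then have "{#f1, f2#} = {#x2, x3#} \<or> {#f1, f2#} = {#x1, x3#}"
      proof
        assume "z = x1"
        then show ?thesis using X by simp
      next
        assume "z = x2"
        then have "{#x2, f1, f2#} = {#x2, x1, x3#}" using trans[OF X add_mset_commute] by simp
        then show ?thesis by simp
      qed
      moreover have "x3 \<in># {#x2, x3#}" "x3 \<in># {#x1, x3#}" by simp_all
      ultimately show ?thesis by metis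
    qed
    have "b \<in># {#y1, y2, y3#}" unfolding Y[symmetric] by simp
    with two[of z b] 2 have "b = y3" by auto
    have "{#y1, y2#} = {#g1, g2#}"
    proof (rule cancel)
      show "{#b, g1, g2#} = {#b, y1, y2#}"
        unfolding \<open>b = y3\<close> using trans[OF Y rot3] unfolding \<open>b = y3\<close> .
    qed
    with nYY x3 show False by blast
  qed
qed

lemma contradiction: False
proof -
  interpret s: five J G F j r l by (rule swapped)
  have F: "size (at j l F) = 0 \<or> size (at j l F) = 1 \<or> size (at j l F) = 2" using at_le by linarith
  have G: "size (at j l G) = 0 \<or> size (at j l G) = 1 \<or> size (at j l G) = 2" using s.at_le by linarith
  show False
    by (insert F G, elim disjE; (erule (1) case_00 case_10 case_21 case_02 case_22 case_11
          s.case_10 s.case_21 s.case_02))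
qed

end

lemma good_not5:
  assumes g: "good J F G"
  shows "size F \<noteq> 5"
proof
  assume 5: "size F = 5"
  note G = goodD[OF g]
  from 5 have "F \<noteq> {#}" by auto
  from good_nonconst[OF g this] obtain j f h where *: "j \<in> J" "f \<in># F" "h \<in># G" "f j \<noteq> h j" by metis
  define N where "N = (\<lambda>r. size (sel j r F))"
  have NG: "size (sel j r G) = N r" for r
    using trade_size[OF G(2) trade_sel[OF G(3) *(1)]] by (simp add: N_def)
  have ge: "2 \<le> N r" for r using sel_ge2[OF g _ *] 5 by (simp add: N_def)
  have sm: "N r + N (\<lambda>x. \<not> r x) = 5" for r using sel_sum[of j r F] 5 by (simp add: N_def)
  have N23: "N r = 2 \<or> N r = 3" for r using ge[of r] ge[of "\<lambda>x. \<not> r x"] sm[of r] by linarith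
  have "N (\<lambda>_. True) = 2 \<or> N (\<lambda>x. \<not> True) = 2"
    using sm[of "\<lambda>_. True"] N23[of "\<lambda>_. True"] by linarith
  then obtain r where r: "N r = 2" by blast
  have fl: "N (r'(fst l := \<not> snd l)) + size (at j l H) = N (r'(fst l := snd l)) + size (at j (neg l) H)"
    if "H = F \<or> H = G" for r' l H
    using size_sel_flip[of j r' l H] NG that by (auto simp: N_def)
  have fl': "N (r'(fst l := \<not> snd l)) + size (at j l H) = N r' + size (at j (neg l) H)"
    if "H = F \<or> H = G" "r' (fst l) = snd l" for r' l H
  proof -
    have "r'(fst l := snd l) = r'" using that(2) by (rule fun_upd_idem)
    with fl[OF that(1), of r' l] show ?thesis by simp
  qed
  \<comment> \<open>If all letters of \<open>r\<close> were balanced, \<open>r\<close> and its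
    complement would select equally many of the five words.\<close>
  have "\<exists>l. r (fst l) = snd l \<and> size (at j (neg l) F) \<noteq> size (at j l F)"
  proof (rule ccontr)
    assume h: "\<not> ?thesis"
    have e: "size (at j (x, \<not> r x) F) = size (at j (x, r x) F)" for x
      using h[unfolded not_ex, rule_format, of "(x, r x)"] by (simp add: neg_def)
    let ?C = "(\<lambda>w. fst (w j)) ` set_mset F"
    have "N (\<lambda>x. \<not> r x) = (\<Sum>x\<in>?C. size (at j (x, \<not> r x) F))"
      unfolding N_def by (rule size_sel_sum) auto
    also have "\<dots> = (\<Sum>x\<in>?C. size (at j (x, r x) F))" unfolding e ..
    also have "\<dots> = N r" unfolding N_def by (rule size_sel_sum[symmetric]) auto
    finally show False using sm[of r] r by simp
  qed
  then obtain l where l: "r (fst l) = snd l" "size (at j (neg l) F) \<noteq> size (at j l F)" by blast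
  have r3: "N (r(fst l := \<not> snd l)) = 3"
    using fl'[of F r l] l r N23[of "r(fst l := \<not> snd l)"] by auto
  have step: "size (at j (neg l) H) = Suc (size (at j l H))" if "H = F \<or> H = G" for H
    using fl'[of H r l, OF that l(1)] r r3 by simp
  \<comment> \<open>Flipping the class of \<open>m\<close> changes the count by the same amount from
    \<open>r\<close>, where it is 2, and from \<open>r\<close> flipped at \<open>l\<close>, where it
    is 3. Both results lie in {2, 3}, so the change is zero.\<close>
  have bal: "size (at j (neg m) H) = size (at j m H)"
    if "H = F \<or> H = G" "r (fst m) = snd m" "m \<noteq> l" for m H
  proof -
    have c: "fst m \<noteq> fst l" using that l(1) by (auto simp: prod_eq_iff)
    let ?r = "r(fst l := \<not> snd l)"
    have 1: "?r (fst m) = snd m" using c that(2) by simp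
    show ?thesis
      using fl'[of H r m, OF that(1,2)] fl'[of H ?r m, OF that(1) 1] r r3
        N23[of "r(fst m := \<not> snd m)"] N23[of "?r(fst m := \<not> snd m)"] by linarith
  qed
  have "five J F G j r l"
  proof
    show "good J F G" "j \<in> J" "r (fst l) = snd l" using g *(1) l(1) by simp_all
    show "size (sel j r F) = 2" "size (sel j r G) = 2" using r NG[of r] by (simp_all add: N_def)
  qed (use step bal in simp_all)
  then show False by (rule five.contradiction)
qed

section \<open>Good trades of size four\<close>

text \<open>The twin pairs of encoded words.\<close>

definition compl where
  "compl K u v \<longleftrightarrow> (\<exists>l\<in>K. v l = neg (u l) \<and> agree (K - {l}) u v)"

lemma compl_sym: "compl K u v \<Longrightarrow> compl K v u"
  unfolding compl_def by (metis neg_neg agree_sym)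

lemma sq_compl: "sq K l a b e f \<Longrightarrow> compl K a b \<and> compl K e f"
  unfolding sq_def compl_def by (metis agree_sym agree_trans)

definition block where
  "block J k m F \<longleftrightarrow> (\<exists>u1 u2 w1 w2. at k m F = {#u1, u2#} \<and> at k (neg m) F = {#w1, w2#} \<and>
     compl (J - {k}) u1 u2 \<and> compl (J - {k}) w1 w2)"

text \<open>The alternatives serve the final count of words at \<open>k\<close>: next to the block
  of \<open>G\<close>, a block of \<open>F\<close> yields a second heavy class, and two different
  classes of \<open>F\<close> yield two classes of moderate weight.\<close>

definition outcome where
  "outcome J k m G F \<longleftrightarrow> block J k m G \<and> (\<forall>f\<in>#F. fst (f k) \<noteq> fst m) \<and>
     ((\<exists>a. block J k a F \<and> (\<forall>g\<in>#G. fst (g k) \<noteq> fst a)) \<or>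
      (\<exists>f1\<in>#F. \<exists>f2\<in>#F. fst (f1 k) \<noteq> fst (f2 k)))"

lemma mset_pair_eq:
  assumes "size A = 2" "x \<in># A" "y \<in># A" "x \<noteq> y"
  shows "A = {#x, y#}"
proof -
  obtain A1 where A1: "A = add_mset x A1" using assms(2) by (metis multi_member_split)
  with assms have "y \<in># A1" by auto
  then obtain A2 where "A1 = add_mset y A2" by (metis multi_member_split)
  with A1 assms(1) show ?thesis by simp
qed

text \<open>If \<open>f1\<close> matches a word with letter \<open>neg a\<close>, then
  \<open>lines\<close> keeps \<open>G\<close> off this line and both pairs trade nontrivially
  against \<open>g1\<close>, \<open>g2\<close>. Otherwise they trade nontrivially against each
  other. A nontrivial trade of two words has twins on each side.\<close>

lemma pairs_compl:
  assumes g: "good J F G" and j: "j \<in> J"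
    and f: "at j a F = {#f1, f2#}" "at j (neg a) F = {#f3, f4#}" and gG: "g1 \<in># G" "g2 \<in># G"
    and t: "trade (J - {j}) {#f1, f2#} {#f3, f4#}" "trade (J - {j}) {#f1, f2#} {#g1, g2#}"
  shows "compl (J - {j}) f1 f2 \<and> compl (J - {j}) f3 f4"
proof -
  note G = goodD[OF g]
  have mF: "f1 \<in># F" "f1 j = a" "f3 \<in># F" "f3 j = neg a" "f4 \<in># F" "f4 j = neg a"
    using at_memD[OF f(1)] at_memD[OF f(2)] by auto
  have *: "compl (J - {j}) f1 f2 \<and> compl (J - {j}) x y"
    if x: "x \<in># F" "x j = neg a" "agree (J - {j}) f1 x" and txy: "trade (J - {j}) {#f1, f2#} {#x, y#}" for x y
  proof -
    have n: "\<not> agree (J - {j}) f1 w" if "w \<in># G" for w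
      using linesD[OF G(5) mF(1) x(1) that j _ x(3)] x(2) mF(2) by simp
    then have n': "\<not> agree (J - {j}) x w" if "w \<in># G" for w
      using x(3) that agree_trans by blast
    have "trade (J - {j}) {#x, y#} {#g1, g2#}" using trade_trans[OF trade_sym[OF txy] t(2)] .
    from trade_2[OF G(2) this n'[OF gG(1)] n'[OF gG(2)]]
    obtain k where k: "sq (J - {j}) k x y g1 g2" by blast
    from trade_2[OF G(2) t(2) n[OF gG(1)] n[OF gG(2)]]
    obtain k' where k': "sq (J - {j}) k' f1 f2 g1 g2" by blast
    show ?thesis using sq_compl[OF k] sq_compl[OF k'] by simp
  qed
  show ?thesis
  proof (cases "agree (J - {j}) f1 f3 \<or> agree (J - {j}) f1 f4")
    case True
    then show ?thesis
    proof
      assume "agree (J - {j}) f1 f3"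
      from *[OF mF(3,4) this t(1)] show ?thesis .
    next
      assume "agree (J - {j}) f1 f4"
      moreover have "trade (J - {j}) {#f1, f2#} {#f4, f3#}" using t(1) by (simp add: add_mset_commute)
      ultimately show ?thesis using *[OF mF(5,6)] compl_sym by blast
    qed
  next
    case False
    then obtain k where k: "sq (J - {j}) k f1 f2 f3 f4" using trade_2[OF G(2) t(1)] by blast
    show ?thesis using sq_compl[OF k] .
  qed
qed

lemma at_empty: "(\<And>w. w \<in># F \<Longrightarrow> w j \<noteq> m) \<Longrightarrow> at j m F = {#}"
  by (induction F) auto

text \<open>This is what \<open>sel_ge2\<close> leaves for four words. Since every choice selects
  the same number, all classes at \<open>j\<close> are balanced.\<close>

locale four =
  fixes J :: "'i set" and F G :: "('i \<Rightarrow> 'k \<times> bool) multiset" and j :: 'i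
  assumes good: "good J F G" and j: "j \<in> J"
    and szF: "\<And>r. size (sel j r F) = 2" and szG: "\<And>r. size (sel j r G) = 2"
begin

lemma swapped: "four J G F j"
  by unfold_locales (simp_all add: good_sym[OF good] j szF szG)

lemmas G = goodD[OF good]

lemma tr_sel: "trade (J - {j}) (sel j r F) (sel j r G)"
  by (rule trade_sel[OF G(3) j])

lemma tr_at: "trade (J - {j}) (at j m F + at j (neg m) G) (at j m G + at j (neg m) F)"
  by (rule trade_at[OF G(3) j])

lemma bal: "size (at j (neg m) F) = size (at j m F)"
  using size_sel_flip[of j "\<lambda>_. True" m F] szF by simp

lemma at_le: "size (at j m F) \<le> 2"
proof -
  let ?r = "\<lambda>_. snd m"
  have "at j m F = filter_mset (\<lambda>w. w j = m) (sel j ?r F)" using at_sel[of ?r m j F] by (simp add: at_def)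
  then show ?thesis using size_filter_mset_lesseq[of "\<lambda>w. w j = m" "sel j ?r F"] szF by simp
qed

lemma all_class:
  assumes "size (at j m F) = 2"
  shows "\<forall>f\<in>#F. fst (f j) = fst m"
proof -
  have "size (at j m H) + size (at j (neg m) H) = size (filter_mset (\<lambda>w. fst (w j) = fst m) H)" for H
    by (induction H) (auto dest: class_eqD)
  from this[of F] assms bal[of m] have "size (filter_mset (\<lambda>w. fst (w j) = fst m) F) = 4" by simp
  moreover have "size F = 4" using sel_sum[of j "\<lambda>_. True" F] szF by simp
  moreover have "size F = size (filter_mset (\<lambda>w. fst (w j) = fst m) F)
      + size (filter_mset (\<lambda>w. fst (w j) \<noteq> fst m) F)"
    by (metis multiset_partition size_union)
  ultimately have "filter_mset (\<lambda>w. fst (w j) \<noteq> fst m) F = {#}" by simp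
  then have "\<forall>x. x \<in># F \<longrightarrow> fst (x j) = fst m" by simp
  then show ?thesis by blast
qed

lemma sel_pair:
  assumes "at j m F = {#f#}" "r (fst m) = snd m"
  shows "\<exists>z. sel j r F = {#f, z#} \<and> z \<in># F \<and> r (fst (z j)) = snd (z j) \<and> z j \<noteq> m"
proof -
  have "f \<in># sel j r F" using at_memD[OF assms(1), of f] assms(2) by simp
  then obtain F' where F': "sel j r F = add_mset f F'" by (metis multi_member_split)
  then have "size F' = Suc 0" using szF[of r] by simp
  then obtain z where "F' = {#z#}" using size_1D by blast
  with F' have z: "sel j r F = {#f, z#}" by simp
  then have "at j m {#f, z#} = {#f#}" using at_sel[of r m j F] assms by simp
  moreover have "f j = m" using at_memD[OF assms(1)] by simp
  ultimately have "z j \<noteq> m" by auto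
  then show ?thesis using z sel_memD[OF z, of z] by auto
qed

lemma twin_ex:
  assumes "at j m F = {#z#}" "at j m G = {#}"
  shows "\<exists>z'. at j (neg m) F = {#z'#} \<and> agree (J - {j}) z z'"
proof -
  interpret s: four J G F j by (rule swapped)
  have "at j (neg m) G = {#}" using s.bal[of m] assms(2) by simp
  with tr_at[of m] assms have "trade (J - {j}) {#z#} (at j (neg m) F)" by simp
  from trade_single[OF G(2) this] show ?thesis .
qed

lemma twin_no_line:
  assumes "at j m F = {#z#}" "at j (neg m) F = {#z'#}" "agree (J - {j}) z z'" "w \<in># G"
  shows "\<not> agree (J - {j}) z w"
  using linesD[OF G(5) _ _ assms(4) j _ assms(3)] at_memD[OF assms(1), of z] at_memD[OF assms(2), of z']
  by simp

lemma sel_step: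
  assumes "at j m F = {#f#}" "sel j r F = {#f, z#}" "at j (neg m) F = {#f'#}" "r (fst m) = snd m"
  shows "sel j (r(fst m := \<not> snd m)) F = {#f', z#}"
proof -
  have "r(fst m := snd m) = r" using assms(4) by (rule fun_upd_idem)
  with sel_flip[of j r m F] assms
  have "add_mset f (sel j (r(fst m := \<not> snd m)) F) = add_mset f {#f', z#}"
    by (simp add: add_mset_commute)
  then show ?thesis by simp
qed

text \<open>If \<open>f\<close> and \<open>f'\<close> do not match, the class identity is a square
  with a crossing. When the other selected words \<open>z\<close> and \<open>b\<close> share their
  letter, \<open>no_twisted\<close> applies. Otherwise \<open>b\<close> has a twin, so both choices
  for the class of \<open>m\<close> give squares, and these lie at the same coordinate
  \<open>i\<close>; comparing them with \<open>z\<close> forces \<open>f i = f' i\<close>, which the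
  first square denies.\<close>

lemma one_each:
  assumes f: "at j m F = {#f#}" "at j (neg m) F = {#f'#}" and h: "at j m G = {#g#}" "at j (neg m) G = {#g'#}"
  shows "agree (J - {j}) f f' \<and> agree (J - {j}) g g' \<and> adj (J - {j}) f g"
proof -
  interpret s: four J G F j by (rule swapped)
  define r where "r = (\<lambda>_ :: 'k. snd m)"
  have r: "r (fst m) = snd m" by (simp add: r_def)
  obtain z where z: "sel j r F = {#f, z#}" "z \<in># F" "r (fst (z j)) = snd (z j)" "z j \<noteq> m"
    using sel_pair[of m f r, OF f(1) r] by blast
  obtain b where b: "sel j r G = {#g, b#}" "b \<in># G" "r (fst (b j)) = snd (b j)" "b j \<noteq> m"
    using s.sel_pair[of m g r, OF h(1) r] by blast
  have mF: "f \<in># F" "f j = m" "f' \<in># F" "f' j = neg m"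
    using at_memD[OF f(1)] at_memD[OF f(2)] by auto
  have mG: "g \<in># G" "g j = m" "g' \<in># G" "g' j = neg m"
    using at_memD[OF h(1)] at_memD[OF h(2)] by auto
  have nfg: "\<not> agree (J - {j}) f g" "\<not> agree (J - {j}) f' g'"
    using apart_same_letter[OF G(4)] mF mG by metis+
  have t1: "trade (J - {j}) {#f, z#} {#g, b#}" using tr_sel[of r] z b by simp
  have t2: "trade (J - {j}) {#f', z#} {#g', b#}"
    using tr_sel[of "r(fst m := \<not> snd m)"] sel_step[of m f r z f', OF f(1) z(1) f(2) r] s.sel_step[of m g r b g', OF h(1) b(1) h(2) r]
    by simp
  have D: "trade (J - {j}) {#f, g'#} {#g, f'#}"
    using tr_at[of m] f h by (simp add: add_mset_commute)
  have ff: "agree (J - {j}) f f'"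
  proof (rule ccontr)
    assume n: "\<not> agree (J - {j}) f f'"
    from trade_2[OF G(2) D nfg(1) n] obtain i where i: "sq (J - {j}) i f g' g f'" by blast
    show False
    proof (cases "z j = b j")
      case True
      have "fst (z j) \<noteq> fst (g j)" using z(3,4) mG(2) r by (auto simp: prod_eq_iff)
      moreover have "trade (J - {j}) {#z, f#} {#b, g#}" using t1 by (simp add: add_mset_commute)
      ultimately show False
        using no_twisted[OF good j mF(1,3) mG(1,3) _ _ _ i z(2) b(2) True] mF mG by simp
    next
      case False
      have "at j (b j) F = at j (b j) {#f, z#}" using at_sel[of r "b j" j F] b(3) z(1) by simp
      also have "\<dots> = {#}" using False b(4) mF(2) by auto
      finally have e: "at j (b j) F = {#}" .
      have "at j (b j) G = {#b#}" using at_sel[of r "b j" j G] b mG(2) by simp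
      from s.twin_no_line[OF this] s.twin_ex[OF this e]
      have nb: "\<not> agree (J - {j}) w b" if "w \<in># F" for w using that agree_sym by blast
      from trade_2[OF G(2) t1 nfg(1) nb[OF mF(1)]] obtain k where k: "sq (J - {j}) k f z g b" by blast
      from trade_2[OF G(2) t2 nfg(2) nb[OF mF(3)]] obtain k' where k': "sq (J - {j}) k' f' z g' b" by blast
      have "k = i" using i k unfolding sq_def agree_def by (metis Diff_iff singletonD)
      moreover have "fst (f' i) \<noteq> fst (g' i)" using i unfolding sq_def by (metis fst_neg)
      then have "k' = i" using i k' unfolding sq_def agree_def by (metis Diff_iff singletonD)
      ultimately have "z i = neg (f i)" "z i = neg (f' i)" using k k' by (simp_all add: sq_def)
      then have "f i = f' i" by simp
      with i show False unfolding sq_def by (metis fst_neg)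
    qed
  qed
  have gg: "agree (J - {j}) g g'"
  proof -
    have "trade (J - {j}) ({#g'#} + {#f#}) ({#g#} + {#f'#})" using D by (simp add: add_mset_commute)
    from trade_1[OF trade_cancel[OF this trade_agree[OF ff]]] show ?thesis by (rule agree_sym)
  qed
  have "\<not> agree (J - {j}) f b" using twin_no_line[OF f ff b(2)] .
  from trade_2[OF G(2) t1 nfg(1) this] obtain l where "sq (J - {j}) l f z g b" by blast
  then have "adj (J - {j}) f g" unfolding sq_def adj_def by blast
  with ff gg show ?thesis by blast
qed

text \<open>No word of \<open>F\<close> is in the class of \<open>m\<close>: two with one letter
  would give a good trade of size two, and one would contradict \<open>same_letter_pair\<close>. The
  letter in this class can then be chosen independently of those of \<open>F\<close>, so each pair
  of \<open>G\<close> trades against a pair of \<open>F\<close>. These trades are squares because of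
  twins of \<open>F\<close> at \<open>j\<close>, or else \<open>pairs_compl\<close> applies.\<close>

lemma single_class:
  assumes cl: "\<forall>g\<in>#G. fst (g j) = fst m"
  shows "outcome J j m G F"
proof -
  interpret s: four J G F j by (rule swapped)
  have eG: "sel j r G = at j m' G" if "r (fst m') = snd m'" "fst m' = fst m" for r m'
    unfolding sel_def at_def by (rule filter_mset_cong) (use cl that in \<open>auto simp: prod_eq_iff\<close>)
  have sz: "size (at j m' G) = 2" if "fst m' = fst m" for m'
    using eG[of "\<lambda>_. snd m'" m'] szG[of "\<lambda>_. snd m'"] that by simp
  have "size (at j m F) \<noteq> 2"
  proof
    assume h: "size (at j m F) = 2"
    define r where "r = (\<lambda>_ :: 'k. snd m)"
    have "sel j r F = at j m F"
      unfolding sel_def at_def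
      by (rule filter_mset_cong) (use all_class[OF h] in \<open>auto simp: prod_eq_iff r_def\<close>)
    moreover have "sel j r G = at j m G" by (rule eG) (simp_all add: r_def)
    ultimately have "trade (J - {j}) (at j m F) (at j m G)" using tr_sel[of r] by simp
    then have t: "trade J (at j m F) (at j m G)" by (rule trade_extend[where l = m]) auto
    have "good J (at j m F) (at j m G)" by (rule good_sub[OF good _ _ t]) (simp_all add: at_def)
    moreover have "at j m F \<noteq> {#}" using h by auto
    ultimately show False using good_size4 h by fastforce
  qed
  moreover have "size (at j m F) \<noteq> Suc 0"
  proof
    assume "size (at j m F) = Suc 0"
    then obtain f where f: "at j m F = {#f#}" using size_1D by blast
    define r where "r = (\<lambda>_ :: 'k. snd m)"
    have r: "r (fst m) = snd m" by (simp add: r_def)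
    obtain z where z: "sel j r F = {#f, z#}" using sel_pair[of m f r, OF f r] by blast
    obtain g1 g2 where gg: "at j m G = {#g1, g2#}" using size_2D[OF sz[of m]] by blast
    have "trade (J - {j}) {#g1, g2#} {#f, z#}"
      using trade_sym[OF tr_sel[of r]] eG[of r m, OF r] z gg by simp
    moreover have "g1 \<in># G" "g2 \<in># G" "g1 j = m" "g2 j = m" "f \<in># F" "f j = m"
      using at_memD[OF gg] at_memD[OF f] by auto
    ultimately show False using same_letter_pair[OF good_sym[OF good] j, of g1 g2 f z] by simp
  qed
  ultimately have "size (at j m F) = 0" using at_le[of m] by linarith
  then have "at j m F = {#}" "at j (neg m) F = {#}" using bal[of m] by simp_all
  then have noF: "\<forall>f\<in>#F. fst (f j) \<noteq> fst m"
    by (metis at_simps(4) class_eqD empty_iff set_mset_empty)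
  obtain g1 g2 where g12: "at j m G = {#g1, g2#}" using size_2D[OF sz[of m]] by blast
  obtain g3 g4 where g34: "at j (neg m) G = {#g3, g4#}" using size_2D[OF sz[of "neg m"]] by auto
  have mG: "g1 \<in># G" "g2 \<in># G" "g3 \<in># G" "g4 \<in># G"
    using at_memD[OF g12] at_memD[OF g34] by auto
  show ?thesis
  proof (cases "\<exists>f1\<in>#F. \<exists>f2\<in>#F. fst (f1 j) \<noteq> fst (f2 j)")
    case True
    then obtain f1 f2 where f: "f1 \<in># F" "f2 \<in># F" "fst (f1 j) \<noteq> fst (f2 j)" by blast
    have c: "compl (J - {j}) x y" if m': "fst m' = fst m" and xy: "at j m' G = {#x, y#}" for m' x y
    proof -
      \<comment> \<open>The letters \<open>m'\<close>, \<open>f1 j\<close> and \<open>f2 j\<close>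
        belong to three different classes, so one choice can select all of them.\<close>
      define r where "r = (\<lambda>c. if c = fst m then snd m' else if c = fst (f1 j) then snd (f1 j) else snd (f2 j))"
      have r: "r (fst m') = snd m'" "r (fst (f1 j)) = snd (f1 j)" "r (fst (f2 j)) = snd (f2 j)"
        using noF f m' by (auto simp: r_def)
      have e: "sel j r F = {#f1, f2#}"
        using mset_pair_eq[OF szF[of r], of f1 f2] f r by auto
      have e1: "at j (f1 j) F = {#f1#}"
      proof -
        have "f2 j \<noteq> f1 j" using f(3) by auto
        then have "at j (f1 j) {#f1, f2#} = {#f1#}" by simp
        then show ?thesis using at_sel[of r "f1 j" j F] r(2) e by simp
      qed
      have e2: "at j (f1 j) G = {#}"
        using cl noF f(1) by (auto intro!: at_empty)
      obtain z where z: "at j (neg (f1 j)) F = {#z#}" "agree (J - {j}) f1 z" using twin_ex[OF e1 e2] by blast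
      have n: "\<not> agree (J - {j}) f1 w" if "w \<in># G" for w using twin_no_line[OF e1 z that] .
      have t: "trade (J - {j}) {#f1, f2#} {#x, y#}"
        using tr_sel[of r] e eG[of r m', OF r(1) m'] xy by simp
      have "x \<in># G" "y \<in># G" using at_memD[OF xy] by auto
      from trade_2[OF G(2) t n[OF this(1)] n[OF this(2)]] obtain k where "sq (J - {j}) k f1 f2 x y" by blast
      from sq_compl[OF this] show ?thesis by simp
    qed
    have "block J j m G" unfolding block_def
      using g12 g34 c[of m g1 g2] c[of "neg m" g3 g4] by auto
    with noF True show ?thesis unfolding outcome_def by simp
  next
    case False
    have "size F = 4" using sel_sum[of j "\<lambda>_. True" F] szF by simp
    then obtain f0 where f0: "f0 \<in># F" by (metis multiset_nonemptyE size_empty zero_neq_numeral)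
    let ?a = "f0 j"
    have clF: "\<forall>f\<in>#F. fst (f j) = fst ?a" using False f0 by blast
    have eF: "sel j r F = at j m' F" if "r (fst m') = snd m'" "fst m' = fst ?a" for r m'
      unfolding sel_def at_def by (rule filter_mset_cong) (use clF that in \<open>auto simp: prod_eq_iff\<close>)
    have szf: "size (at j m' F) = 2" if "fst m' = fst ?a" for m'
      using eF[of "\<lambda>_. snd m'" m'] szF[of "\<lambda>_. snd m'"] that by simp
    obtain f1 f2 where f12: "at j ?a F = {#f1, f2#}" using size_2D[OF szf[of ?a]] by blast
    obtain f3 f4 where f34: "at j (neg ?a) F = {#f3, f4#}" using size_2D[OF szf[of "neg ?a"]] by auto
    have mF: "f1 \<in># F" "f2 \<in># F" using at_memD[OF f12] by auto
    have am: "fst ?a \<noteq> fst m" using noF f0 by blast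
    have noG: "\<forall>g\<in>#G. fst (g j) \<noteq> fst ?a" using cl am by simp
    have "at j ?a G = {#}" "at j (neg ?a) G = {#}"
      using noG by (auto intro!: at_empty)
    then have tF: "trade (J - {j}) {#f1, f2#} {#f3, f4#}"
      using tr_at[of ?a] f12 f34 by simp
    have tG: "trade (J - {j}) {#g1, g2#} {#g3, g4#}"
      using trade_sym[OF tr_at[of m]] \<open>at j m F = {#}\<close> \<open>at j (neg m) F = {#}\<close> g12 g34
      by (metis add.right_neutral add.left_neutral trade_sym)
    define r where "r = (\<lambda>c. if c = fst m then snd m else snd ?a)"
    have r: "r (fst m) = snd m" "r (fst ?a) = snd ?a" using am by (auto simp: r_def)
    have tFG: "trade (J - {j}) {#f1, f2#} {#g1, g2#}"
      using tr_sel[of r] eF[of r ?a, OF r(2)] eG[of r m, OF r(1)] f12 g12 by simp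
    have "block J j ?a F" unfolding block_def
      using f12 f34 pairs_compl[OF good j f12 f34 mG(1,2) tF tFG] by blast
    moreover have "block J j m G" unfolding block_def
      using g12 g34 pairs_compl[OF good_sym[OF good] j g12 g34 mF tG trade_sym[OF tFG]] by blast
    ultimately show ?thesis using noF noG unfolding outcome_def by blast
  qed
qed

lemma twin_any:
  assumes f: "at j m F = {#f#}" and n: "\<not> (\<forall>g\<in>#G. fst (g j) = fst m)"
  shows "\<exists>f'. at j (neg m) F = {#f'#} \<and> agree (J - {j}) f f'"
proof -
  interpret s: four J G F j by (rule swapped)
  have "size (at j m G) \<noteq> 2" using s.all_class[of m] n by blast
  then consider "size (at j m G) = 0" | "size (at j m G) = Suc 0" using s.at_le[of m] by linarith
  then show ?thesis
  proof cases
    case 1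
    then show ?thesis using twin_ex[OF f] by simp
  next
    case 2
    then obtain g where g: "at j m G = {#g#}" using size_1D by blast
    obtain f' where f': "at j (neg m) F = {#f'#}" using bal[of m] f size_1D by force
    obtain g' where g': "at j (neg m) G = {#g'#}" using s.bal[of m] g size_1D by force
    from one_each[OF f f' g g'] f' show ?thesis by blast
  qed
qed

lemma sel_two:
  assumes n: "\<not> (\<exists>m :: 'k \<times> bool. \<forall>f\<in>#F. fst (f j) = fst m)" "\<not> (\<exists>m :: 'k \<times> bool. \<forall>g\<in>#G. fst (g j) = fst m)"
  shows "\<exists>f1 f2 f1' f2'. sel j r F = {#f1, f2#} \<and> F = {#f1, f2, f1', f2'#} \<and>
    f1' j = neg (f1 j) \<and> f2' j = neg (f2 j) \<and> agree (J - {j}) f1 f1' \<and> agree (J - {j}) f2 f2'"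
proof -
  obtain f1 f2 where f: "sel j r F = {#f1, f2#}" using size_2D[OF szF] by blast
  have m: "f1 \<in># F" "f2 \<in># F" "r (fst (f1 j)) = snd (f1 j)" "r (fst (f2 j)) = snd (f2 j)"
    using sel_memD[OF f] by auto
  have ne: "f1 j \<noteq> f2 j"
  proof
    assume "f1 j = f2 j"
    then have "at j (f1 j) F = {#f1, f2#}" using at_sel[of r "f1 j" j F] m(3) f by simp
    then have "size (at j (f1 j) F) = 2" by simp
    from all_class[OF this] n(1) show False by blast
  qed
  have e: "at j (f1 j) F = {#f1#}" "at j (f2 j) F = {#f2#}"
    using at_sel[of r "f1 j" j F] at_sel[of r "f2 j" j F] m f ne by auto
  obtain f1' where f1': "at j (neg (f1 j)) F = {#f1'#}" "agree (J - {j}) f1 f1'"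
    using twin_any[OF e(1)] n(2) by blast
  obtain f2' where f2': "at j (neg (f2 j)) F = {#f2'#}" "agree (J - {j}) f2 f2'"
    using twin_any[OF e(2)] n(2) by blast
  have m': "f1' \<in># F" "f2' \<in># F" "f1' j = neg (f1 j)" "f2' j = neg (f2 j)"
    using at_memD[OF f1'(1)] at_memD[OF f2'(1)] by auto
  then have "f1' \<noteq> f2'" using ne by auto
  then have "sel j (\<lambda>x. \<not> r x) F = {#f1', f2'#}"
    using mset_pair_eq[OF szF, of f1' "\<lambda>x. \<not> r x" f2'] m m' by simp
  then have "F = {#f1, f2#} + {#f1', f2'#}" using sel_compl[of j r F] f by metis
  also have "\<dots> = {#f1, f2, f1', f2'#}" by (simp add: add_mset_commute)
  finally have "F = {#f1, f2, f1', f2'#}" .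
  with f m' f1' f2' show ?thesis by blast
qed

text \<open>If neither side keeps to one class at \<open>j\<close>, each side consists of two pairs
  of twins at \<open>j\<close>. A selection at \<open>j\<close> is then a square at some
  \<open>l\<close>, and seen from \<open>l\<close> the twins form a block on each side. Thus the
  coordinate of the outcome need not be \<open>j\<close>.\<close>

lemma outcome_ex: "\<exists>k\<in>J. \<exists>m. outcome J k m G F \<or> outcome J k m F G"
proof -
  interpret s: four J G F j by (rule swapped)
  show ?thesis
  proof (cases "(\<exists>m :: 'k \<times> bool. \<forall>g\<in>#G. fst (g j) = fst m) \<or> (\<exists>m :: 'k \<times> bool. \<forall>f\<in>#F. fst (f j) = fst m)")
    case True
    then show ?thesis using single_class s.single_class j by blast
  next
    case False
    then have n: "\<not> (\<exists>m :: 'k \<times> bool. \<forall>f\<in>#F. fst (f j) = fst m)" "\<not> (\<exists>m :: 'k \<times> bool. \<forall>g\<in>#G. fst (g j) = fst m)" by auto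
    let ?r = "\<lambda>_ :: 'k. True"
    obtain f1 f2 f1' f2' where f: "sel j ?r F = {#f1, f2#}" "F = {#f1, f2, f1', f2'#}"
      "f1' j = neg (f1 j)" "f2' j = neg (f2 j)" "agree (J - {j}) f1 f1'" "agree (J - {j}) f2 f2'"
      using sel_two[OF n] by blast
    obtain g1 g2 g1' g2' where g: "sel j ?r G = {#g1, g2#}" "G = {#g1, g2, g1', g2'#}"
      "g1' j = neg (g1 j)" "g2' j = neg (g2 j)" "agree (J - {j}) g1 g1'" "agree (J - {j}) g2 g2'"
      using s.sel_two[OF n(2,1)] by blast
    have "\<not> agree (J - {j}) f1 w" if "w \<in># G" for w
      using linesD[OF G(5) _ _ that j f(3,5)] f(2) by simp
    then have "\<not> agree (J - {j}) f1 g1" "\<not> agree (J - {j}) f1 g2" using g(2) by simp_all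
    from trade_2[OF G(2) _ this] tr_sel[of ?r] f(1) g(1) obtain l where s: "sq (J - {j}) l f1 f2 g1 g2"
      by auto
    then have l: "l \<in> J - {j}" "f2 l = neg (f1 l)" "g2 l = neg (g1 l)" "fst (f1 l) \<noteq> fst (g1 l)"
      by (auto simp: sq_def)
    have l': "f1' l = f1 l" "f2' l = f2 l" "g1' l = g1 l" "g2' l = g2 l"
      using l(1) f(5,6) g(5,6) by (simp_all add: agree_def)
    have c: "compl (J - {l}) u v" if "v j = neg (u j)" "agree (J - {j}) u v" for u v :: "'i \<Rightarrow> 'k \<times> bool"
      unfolding compl_def using that j l(1) by (intro bexI[of _ j]) (auto simp: agree_def)
    have nn: "neg (f1 l) \<noteq> f1 l" "neg (g1 l) \<noteq> g1 l" by simp_all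
    have "block J l (f1 l) F" unfolding block_def
      by (rule exI[of _ f1], rule exI[of _ f1'], rule exI[of _ f2], rule exI[of _ f2'])
        (use c f l l' nn in \<open>simp add: f(2)\<close>)
    moreover have "block J l (g1 l) G" unfolding block_def
      by (rule exI[of _ g1], rule exI[of _ g1'], rule exI[of _ g2], rule exI[of _ g2'])
        (use c g l l' nn in \<open>simp add: g(2)\<close>)
    moreover have "\<forall>w\<in>#F. fst (w l) \<noteq> fst (g1 l)" "\<forall>w\<in>#G. fst (w l) \<noteq> fst (f1 l)"
      using l l' f(2) g(2) by auto
    ultimately have "outcome J l (g1 l) G F" unfolding outcome_def by blast
    then show ?thesis using l(1) by blast
  qed
qed

end

lemma good_small:
  assumes g: "good J F G" "F \<noteq> {#}" "size F \<le> 5"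
  shows "size F = 4" and "\<And>j f h. j \<in> J \<Longrightarrow> f \<in># F \<Longrightarrow> h \<in># G \<Longrightarrow> f j \<noteq> h j \<Longrightarrow> four J F G j"
    and "\<exists>k\<in>J. \<exists>m. outcome J k m G F \<or> outcome J k m F G"
proof -
  note G = goodD[OF g(1)]
  show 4: "size F = 4" using good_size4[OF g(1,2)] good_not5[OF g(1)] g(3) by linarith
  show *: "four J F G j" if j: "j \<in> J" "f \<in># F" "h \<in># G" "f j \<noteq> h j" for j f h
  proof
    have ge: "2 \<le> size (sel j r F)" for r using sel_ge2[OF g(1,3) j] .
    show F: "size (sel j r F) = 2" for r
      using ge[of r] ge[of "\<lambda>x. \<not> r x"] sel_sum[of j r F] 4 by linarith
    show "size (sel j r G) = 2" for r
      using trade_size[OF G(2) trade_sel[OF G(3) j(1)]] F by metis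
  qed (use g j in simp_all)
  obtain j f h where "j \<in> J" "f \<in># F" "h \<in># G" "f j \<noteq> h j" using good_nonconst[OF g(1,2)] by metis
  from four.outcome_ex[OF *[OF this]]
  show "\<exists>k\<in>J. \<exists>m. outcome J k m G F \<or> outcome J k m F G" .
qed

section \<open>Words covered by codes\<close>

definition code where
  "code I A \<longleftrightarrow> (\<forall>u\<in>A. \<forall>v\<in>A. u \<noteq> v \<longrightarrow> dich I u v) \<and> (\<forall>u\<in>A. \<forall>v\<in>A. \<not> compl I u v)"

definition covers where
  "covers I A u \<longleftrightarrow> (\<forall>om. hit I om u \<longrightarrow> (\<exists>a\<in>A. hit I om a))"

lemma code_mono: "code I A \<Longrightarrow> B \<subseteq> A \<Longrightarrow> code I B"
  unfolding code_def by blast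

lemma hit_dich: "hit I om u \<Longrightarrow> hit I om v \<Longrightarrow> \<not> dich I u v"
  unfolding dich_def hit_def by (metis fst_neg snd_neg)

lemma code_hit_eq: "code I A \<Longrightarrow> a \<in> A \<Longrightarrow> b \<in> A \<Longrightarrow> hit I om a \<Longrightarrow> hit I om b \<Longrightarrow> a = b"
  unfolding code_def using hit_dich by blast

lemma hit_split: "j \<in> I \<Longrightarrow> hit I om w \<longleftrightarrow> om j (fst (w j)) = snd (w j) \<and> hit (I - {j}) om w"
  by (auto simp: hit_def)

lemma hit_word_upd: "hit (I - {j}) om (w(j := y)) \<longleftrightarrow> hit (I - {j}) om w"
  by (simp add: hit_def)

lemma hit_point_upd: "hit (I - {j}) (om(j := q)) w \<longleftrightarrow> hit (I - {j}) om w"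
  by (simp add: hit_def)

definition meet_point where
  "meet_point u v = (\<lambda>i c. if c = fst (u i) then snd (u i) else snd (v i))"

lemma meet_point:
  assumes "\<not> dich I u v"
  shows "hit I (meet_point u v) u" "hit I (meet_point u v) v"
proof -
  show "hit I (meet_point u v) u" by (simp add: hit_def meet_point_def)
  show "hit I (meet_point u v) v" unfolding hit_def meet_point_def
    using assms class_eqD unfolding dich_def by (metis)
qed

lemma covers_meeting:
  assumes "covers I A u"
  shows "covers I {a \<in> A. \<not> dich I a u} u"
  unfolding covers_def
proof (intro allI impI)
  fix om assume h: "hit I om u"
  then obtain a where "a \<in> A" "hit I om a" using assms unfolding covers_def by blast
  with h hit_dich show "\<exists>a\<in>{a \<in> A. \<not> dich I a u}. hit I om a" by blast
qed

locale cover =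
  fixes I :: "'i set" and B :: "('i \<Rightarrow> 'k \<times> bool) set" and u :: "'i \<Rightarrow> 'k \<times> bool"
  assumes fin: "finite B" and code: "code I B" and covers: "covers I B u"
    and meets: "\<And>a. a \<in> B \<Longrightarrow> \<not> dich I a u"
begin

text \<open>Take two points of \<open>u\<close> that differ at \<open>j\<close> only, in the class
  of \<open>y\<close>, the first one hit by \<open>a\<close>. A word covering the second point
  cannot avoid this class: it would contain the first point too and so be equal to
  \<open>a\<close>.\<close>

lemma transfer:
  assumes j: "j \<in> I" and y: "fst y \<noteq> fst (u j)" and om: "hit (I - {j}) om u"
    and a: "a \<in> B" "a j = y" "hit (I - {j}) om a"
  shows "\<exists>a'\<in>B. a' j = neg y \<and> hit (I - {j}) om a'"
proof -
  define r where "r = (\<lambda>_. True)(fst (u j) := snd (u j))"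
  let ?om1 = "om(j := r(fst y := snd y))" and ?om2 = "om(j := r(fst y := \<not> snd y))"
  note ext = hit_split[OF j] hit_point_upd
  have h1: "hit I ?om1 a" using a by (simp add: ext)
  have "hit I ?om2 u" using y om by (simp add: ext r_def)
  then obtain a' where a': "a' \<in> B" "hit I ?om2 a'" using covers unfolding covers_def by blast
  have "a' j = neg y"
  proof (rule ccontr)
    assume n: "a' j \<noteq> neg y"
    have "a' j \<noteq> y" using a'(2) by (auto simp: ext)
    with n have "fst (a' j) \<noteq> fst y" using class_eqD by metis
    with a'(2) have "hit I ?om1 a'" by (simp add: ext)
    then have "a' = a" using code_hit_eq[OF code a'(1) a(1)] h1 by blast
    with a(2) \<open>a' j \<noteq> y\<close> show False by simp
  qed
  with a' show ?thesis by (auto simp: ext)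
qed

lemma ex_letter:
  assumes j: "j \<in> I" and a: "a \<in> B" "a j \<noteq> u j"
  shows "fst (a j) \<noteq> fst (u j)" and "\<exists>a'\<in>B. a' j = neg (a j)"
proof -
  show cl: "fst (a j) \<noteq> fst (u j)"
    using meets[OF a(1)] a(2) j class_eqD unfolding dich_def by (metis neg_neg)
  have "hit (I - {j}) (meet_point a u) a" "hit (I - {j}) (meet_point a u) u"
    using meet_point[OF meets[OF a(1)]] by (auto simp: hit_def)
  with transfer[OF j cl] a(1) show "\<exists>a'\<in>B. a' j = neg (a j)" by blast
qed

lemma half_covers:
  assumes j: "j \<in> I" and y: "fst y \<noteq> fst (u j)" and all: "\<forall>a\<in>B. a j = y \<or> a j = neg y"
  shows "covers I {a \<in> B. a j = y} (u(j := y))"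
  unfolding covers_def
proof (intro allI impI)
  fix om assume h: "hit I om (u(j := y))"
  have h': "hit (I - {j}) om u" using h by (simp add: hit_split[OF j] hit_word_upd)
  let ?om = "om(j := (om j)(fst (u j) := snd (u j)))"
  have "hit I ?om u" using h' by (simp add: hit_split[OF j] hit_point_upd)
  then obtain a where a: "a \<in> B" "hit I ?om a" using covers unfolding covers_def by blast
  then have ha: "hit (I - {j}) om a" by (simp add: hit_split[OF j] hit_point_upd)
  have "\<exists>a'\<in>B. a' j = y \<and> hit (I - {j}) om a'"
  proof (cases "a j = y")
    case True
    with a ha show ?thesis by blast
  next
    case False
    then have "a j = neg y" using all a(1) by blast
    from transfer[OF j _ h' a(1) this ha] y show ?thesis by simp
  qed
  then obtain a' where a': "a' \<in> B" "a' j = y" "hit (I - {j}) om a'" by blast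
  moreover have "om j (fst y) = snd y" using h by (simp add: hit_split[OF j])
  ultimately have "hit I om a'" by (simp add: hit_split[OF j])
  with a' show "\<exists>a\<in>{a \<in> B. a j = y}. hit I om a" by blast
qed

text \<open>Where the class of \<open>z\<close> differs from that of \<open>u\<close>, every word
  with letter \<open>neg y\<close> must agree with \<open>z\<close>. This is why the words at
  \<open>neg y\<close> cover the whole modified word \<open>z\<close>, and not only its part inside
  \<open>u\<close>.\<close>

lemma single_covers:
  assumes j: "j \<in> I" and y: "fst y \<noteq> fst (u j)" and z: "{a \<in> B. a j = y} = {z}"
  shows "covers I {a \<in> B. a j = neg y} (z(j := neg y))"
  unfolding covers_def
proof (intro allI impI)
  fix om assume h: "hit I om (z(j := neg y))"
  have zB: "z \<in> B" "z j = y" using z by auto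
  have eq: "a i = z i" if a: "a \<in> B" "a j = neg y" and i: "i \<in> I" "i \<noteq> j" "fst (z i) \<noteq> fst (u i)" for a i
  proof (rule ccontr)
    assume n: "a i \<noteq> z i"
    let ?p = "meet_point a u"
    \<comment> \<open>The flipped point still lies in \<open>a\<close> and in \<open>u\<close> off
      \<open>j\<close> but misses \<open>z\<close>, the only word that \<open>transfer\<close> could
      return.\<close>
    let ?q = "?p(i := (?p i)(fst (z i) := \<not> snd (z i)))"
    have p: "hit I ?p a" "hit I ?p u" using meet_point[OF meets[OF a(1)]] .
    have "hit (I - {j}) ?q a" unfolding hit_def
    proof
      fix k assume k: "k \<in> I - {j}"
      then have "?p k (fst (a k)) = snd (a k)" using p(1) unfolding hit_def by blast
      then show "?q k (fst (a k)) = snd (a k)" using n by (cases "k = i") (auto simp: prod_eq_iff)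
    qed
    moreover have "hit (I - {j}) ?q u" unfolding hit_def
    proof
      fix k assume k: "k \<in> I - {j}"
      then have "?p k (fst (u k)) = snd (u k)" using p(2) unfolding hit_def by blast
      then show "?q k (fst (u k)) = snd (u k)" using i(3) by (cases "k = i") auto
    qed
    ultimately obtain a' where a': "a' \<in> B" "a' j = y" "hit (I - {j}) ?q a'"
      using transfer[OF j, of "neg y" ?q a] y a by auto
    then have "a' = z" using z by blast
    with a'(3) i have "?q i (fst (z i)) = snd (z i)" unfolding hit_def by blast
    then show False by simp
  qed
  \<comment> \<open>The point is moved into \<open>u\<close> only at coordinates where the classes
    of \<open>z\<close> and \<open>u\<close> differ, and only in the class of \<open>u\<close>. This
    affects neither \<open>z\<close> nor, by \<open>eq\<close>, any word with letter
    \<open>neg y\<close>.\<close>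
  define q where "q = (\<lambda>i c. if fst (z i) \<noteq> fst (u i) \<and> c = fst (u i) then snd (u i) else om i c)"
  have zh: "om i (fst (z i)) = snd (z i)" if "i \<in> I" "i \<noteq> j" for i
    using bspec[OF h[unfolded hit_def] that(1)] that(2) by simp
  have zu: "z i = u i" if "i \<in> I" "fst (z i) = fst (u i)" for i
    using meets[OF zB(1)] that class_eqD unfolding dich_def by (metis neg_neg)
  have "hit (I - {j}) q z" unfolding hit_def q_def using zh by simp
  moreover have "hit (I - {j}) q u"
    unfolding hit_def
  proof
    fix i assume i: "i \<in> I - {j}"
    show "q i (fst (u i)) = snd (u i)"
    proof (cases "fst (z i) = fst (u i)")
      case True
      then show ?thesis using zu[of i] zh[of i] i by (simp add: q_def)
    qed (simp add: q_def)
  qed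
  ultimately obtain a where a: "a \<in> B" "a j = neg y" "hit (I - {j}) q a"
    using transfer[OF j y _ zB] by blast
  have "hit I om a" unfolding hit_def
  proof
    fix i assume i: "i \<in> I"
    show "om i (fst (a i)) = snd (a i)"
    proof (cases "i = j")
      case True
      then show ?thesis using bspec[OF h[unfolded hit_def] i] a(2) by simp
    next
      case False
      show ?thesis
      proof (cases "fst (z i) = fst (u i)")
        case True
        have "q i (fst (a i)) = snd (a i)" using a(3) i False unfolding hit_def by blast
        then show ?thesis using True by (simp add: q_def)
      next
        case f: False
        from eq[OF a(1,2) i False f] zh[OF i False] show ?thesis by simp
      qed
    qed
  qed
  with a show "\<exists>a\<in>{a \<in> B. a j = neg y}. hit I om a" by blast
qed

end

section \<open>Lower bounds for the size of a cover\<close>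

lemma coverI:
  assumes "finite A" "code I A" "covers I A u"
  shows "cover I {a \<in> A. \<not> dich I a u} u"
proof
  show "code I {a \<in> A. \<not> dich I a u}" using assms(2) by (rule code_mono) blast
qed (use assms covers_meeting in auto)

text \<open>Among at most four words, a lone word at a letter foreign to \<open>u\<close> would by
  \<open>single_covers\<close> and induction require five at the complementary letter. So the words
  split as 2 + 2 within one class, and each half covers \<open>u\<close> with the new letter. By
  induction each half contains that very word, and the two words are twins.\<close>

lemma cover_5:
  assumes "finite A" "code I A" "covers I A u" "\<And>a. a \<in> A \<Longrightarrow> \<not> agree I a u"
  shows "5 \<le> card A"
  using assms
proof (induction "card A" arbitrary: A u rule: less_induct)
  case less
  let ?B = "{a \<in> A. \<not> dich I a u}"
  have BA: "finite ?B" "card ?B \<le> card A" "?B \<subseteq> A" using less.prems(1) by (auto intro: card_mono)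
  interpret cover I ?B u using coverI less.prems by blast
  have sub5: "5 \<le> card C" if "C \<subset> ?B" "covers I C w" "\<And>a. a \<in> C \<Longrightarrow> \<not> agree I a w" for C w
  proof -
    have "card C < card ?B" using psubset_card_mono[OF BA(1) that(1)] .
    then show ?thesis
      using less.hyps[of C w] that BA finite_subset[of C ?B] code_mono[OF code, of C] by (auto simp: psubset_eq)
  qed
  show ?case
  proof (rule ccontr)
    assume "\<not> 5 \<le> card A"
    then have c4: "card ?B \<le> 4" using BA(2) by linarith
    have "hit I (meet_point u u) u" by (simp add: hit_def meet_point_def)
    then obtain b where b: "b \<in> ?B" using covers unfolding covers_def by blast
    then obtain j where j: "j \<in> I" "b j \<noteq> u j" using less.prems(4) by (auto simp: agree_def)
    let ?y = "b j"
    let ?P = "{a \<in> ?B. a j = ?y}" and ?N = "{a \<in> ?B. a j = neg ?y}"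
    note cl = ex_letter(1)[OF j(1) b j(2)]
    obtain b' where b': "b' \<in> ?B" "b' j = neg ?y" using ex_letter(2)[OF j(1) b j(2)] by blast
    have fP: "finite ?P" "finite ?N" using less.prems(1) by simp_all
    have "b' \<notin> ?P" "b \<notin> ?N" using b'(2) by simp_all
    then have ss: "?P \<subset> ?B" "?N \<subset> ?B" using b b'(1) by blast+
    have dj: "?P \<inter> ?N = {}"
    proof (rule equals0I)
      fix a assume "a \<in> ?P \<inter> ?N"
      then have "?y = neg ?y" by (metis (mono_tags, lifting) IntE mem_Collect_eq)
      then show False by simp
    qed
    have sub: "?P \<union> ?N \<subseteq> ?B" by blast
    have un: "card ?P + card ?N \<le> card ?B"
      using card_Un_disjoint[OF fP dj] card_mono[OF BA(1) sub] by linarith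
    have twin: False if "x \<in> ?B" "x' \<in> ?B" "x' j = neg (x j)" "agree (I - {j}) x x'" for x x'
      using code that j(1) unfolding code_def compl_def by blast
    have one: "5 \<le> card {a \<in> ?B. a j = neg y}"
      if y: "fst y \<noteq> fst (u j)" and z: "{a \<in> ?B. a j = y} = {z}" for y z
    proof (rule sub5[OF _ single_covers[OF j(1) y z]])
      have "z \<in> ?B" "z j = y" using z by blast+
      then have "z \<notin> {a \<in> ?B. a j = neg y}" by simp
      with \<open>z \<in> ?B\<close> show "{a \<in> ?B. a j = neg y} \<subset> ?B" by blast
      fix a assume a: "a \<in> {a \<in> ?B. a j = neg y}"
      show "\<not> agree I a (z(j := neg y))"
      proof
        assume "agree I a (z(j := neg y))"
        then have "agree (I - {j}) z a" by (simp add: agree_def)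
        moreover have "z \<in> ?B" "z j = y" using z by blast+
        ultimately show False using twin[of z a] a by simp
      qed
    qed
    have "b \<in> ?P" "b' \<in> ?N" using b b' by simp_all
    then have "?P \<noteq> {}" "?N \<noteq> {}" by blast+
    then have "card ?P \<noteq> 0" "card ?N \<noteq> 0" using fP by (simp_all only: card_eq_0_iff) blast+
    moreover have "card ?P \<noteq> 1"
    proof
      assume "card ?P = 1"
      then obtain z where "?P = {z}" by (rule card_1_singletonE)
      from one[OF cl this] un c4 show False by linarith
    qed
    moreover have "card ?N \<noteq> 1"
    proof
      assume "card ?N = 1"
      then obtain z where z: "?N = {z}" by (rule card_1_singletonE)
      have "fst (neg ?y) \<noteq> fst (u j)" using cl by simp
      from one[OF this z] have "5 \<le> card ?P" by (simp only: neg_neg)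
      with un c4 show False by linarith
    qed
    ultimately have c2: "card ?P \<ge> 2" "card ?N \<ge> 2" by linarith+
    then have "card (?P \<union> ?N) = card ?B" using card_Un_disjoint[OF fP dj] un c4 by linarith
    then have "?P \<union> ?N = ?B" using card_subset_eq[OF BA(1), of "?P \<union> ?N"] by blast
    then have all: "\<forall>a\<in>?B. a j = ?y \<or> a j = neg ?y" by blast
    then have all': "\<forall>a\<in>?B. a j = neg ?y \<or> a j = neg (neg ?y)" by auto
    have "\<exists>a\<in>?P. agree I a (u(j := ?y))"
    proof (rule ccontr)
      assume "\<not> ?thesis"
      then have "5 \<le> card ?P" using sub5[OF ss(1) half_covers[OF j(1) cl all]] by blast
      with un c4 show False by linarith
    qed
    moreover have "\<exists>a\<in>?N. agree I a (u(j := neg ?y))"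
    proof (rule ccontr)
      assume "\<not> ?thesis"
      then have "5 \<le> card ?N" using sub5[OF ss(2) half_covers[OF j(1) _ all']] cl by auto
      with un c4 show False by linarith
    qed
    ultimately obtain x x' where x: "x \<in> ?P" "x' \<in> ?N" "agree I x (u(j := ?y))" "agree I x' (u(j := neg ?y))"
      by blast
    then have "agree (I - {j}) x x'" by (simp add: agree_def)
    with twin[of x x'] x(1,2) show False by simp
  qed
qed

context cover
begin

definition part where
  "part j y = {a \<in> B. a j = y}"

lemma finite_part: "finite (part j y)"
  using fin by (simp add: part_def)

lemma no_twin: "x \<in> B \<Longrightarrow> x' \<in> B \<Longrightarrow> j \<in> I \<Longrightarrow> x' j = neg (x j) \<Longrightarrow> \<not> agree (I - {j}) x x'"
  using code unfolding code_def compl_def by blast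

lemma part_code: "code I (part j y)"
  using code by (rule code_mono) (auto simp: part_def)

lemma single_5:
  assumes j: "j \<in> I" and y: "fst y \<noteq> fst (u j)" and z: "part j y = {z}"
  shows "5 \<le> card (part j (neg y))"
proof (rule cover_5[OF finite_part part_code])
  show "covers I (part j (neg y)) (z(j := neg y))"
    using single_covers[OF j y] z unfolding part_def by blast
  fix a assume a: "a \<in> part j (neg y)"
  show "\<not> agree I a (z(j := neg y))"
  proof
    assume "agree I a (z(j := neg y))"
    then have "agree (I - {j}) z a" by (simp add: agree_def)
    moreover have "z \<in> part j y" using z by simp
    ultimately show False using no_twin[of z a j] a j by (simp add: part_def)
  qed
qed

lemma part_sizes:
  assumes j: "j \<in> I" and b: "b \<in> B" "b j \<noteq> u j"
  shows "6 \<le> card (part j (b j)) + card (part j (neg (b j)))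
    \<or> 2 \<le> card (part j (b j)) \<and> 2 \<le> card (part j (neg (b j)))"
proof -
  note cl = ex_letter(1)[OF j b]
  obtain b' where b': "b' \<in> B" "b' j = neg (b j)" using ex_letter(2)[OF j b] by blast
  have "b \<in> part j (b j)" "b' \<in> part j (neg (b j))" using b b' by (simp_all add: part_def)
  then have "part j (b j) \<noteq> {}" "part j (neg (b j)) \<noteq> {}" by blast+
  then have pos: "card (part j (b j)) \<noteq> 0" "card (part j (neg (b j))) \<noteq> 0"
    using finite_part by simp_all
  have cl': "fst (neg (b j)) \<noteq> fst (u j)" using cl by simp
  have single1: "card (part j (b j)) = 1 \<Longrightarrow> 5 \<le> card (part j (neg (b j)))"
    using single_5[OF j cl] by (metis card_1_singletonE)
  have single2: "card (part j (neg (b j))) = 1 \<Longrightarrow> 5 \<le> card (part j (b j))"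
    using single_5[OF j cl', unfolded neg_neg] by (metis card_1_singletonE)
  consider "card (part j (b j)) = 1" | "card (part j (neg (b j))) = 1"
    | "card (part j (b j)) \<noteq> 1" "card (part j (neg (b j))) \<noteq> 1" by blast
  then show ?thesis
  proof cases
    case 1
    from single1[OF this] 1 show ?thesis by simp
  next
    case 2
    from single2[OF this] 2 show ?thesis by simp
  next
    case 3
    with pos show ?thesis by linarith
  qed
qed

text \<open>Two classes at \<open>j\<close> have at least four words each. With one class, the
  modified words for the two halves would be twins, so one half does not contain its own and needs
  five words; by \<open>part_sizes\<close> the total is at least six.\<close>

lemma size_6:
  assumes na: "\<And>a. a \<in> B \<Longrightarrow> \<not> agree I a u" and j: "j \<in> I" and nj: "\<And>a. a \<in> B \<Longrightarrow> a j \<noteq> u j"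
  shows "6 \<le> card B"
proof -
  have "hit I (meet_point u u) u" by (simp add: hit_def meet_point_def)
  then obtain b where b: "b \<in> B" using covers unfolding covers_def by blast
  let ?y = "b j"
  let ?P = "part j ?y" and ?N = "part j (neg ?y)"
  note cl = ex_letter(1)[OF j b nj[OF b]]
  have dj: "?P \<inter> ?N = {}" unfolding part_def using neg_neq by auto
  have sub: "?P \<union> ?N \<subseteq> B" by (auto simp: part_def)
  have un: "card (?P \<union> ?N) = card ?P + card ?N"
    using card_Un_disjoint[OF finite_part finite_part dj] .
  have le: "card ?P + card ?N \<le> card B" using card_mono[OF fin sub] un by simp
  show ?thesis
  proof (cases "\<exists>b2\<in>B. fst (b2 j) \<noteq> fst ?y")
    case True
    then obtain b2 where b2: "b2 \<in> B" "fst (b2 j) \<noteq> fst ?y" by blast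
    let ?Q = "part j (b2 j)" and ?M = "part j (neg (b2 j))"
    have dj2: "?Q \<inter> ?M = {}" unfolding part_def using neg_neq by auto
    have un2: "card (?Q \<union> ?M) = card ?Q + card ?M"
      using card_Un_disjoint[OF finite_part finite_part dj2] .
    have "(?P \<union> ?N) \<inter> (?Q \<union> ?M) = {}" unfolding part_def using b2(2) by (auto dest: arg_cong[of _ _ fst])
    then have "card ((?P \<union> ?N) \<union> (?Q \<union> ?M)) = card ?P + card ?N + (card ?Q + card ?M)"
      using card_Un_disjoint[of "?P \<union> ?N" "?Q \<union> ?M"] finite_part un un2 by simp
    moreover have "card ((?P \<union> ?N) \<union> (?Q \<union> ?M)) \<le> card B"
      by (rule card_mono[OF fin]) (auto simp: part_def)
    ultimately show ?thesis
      using part_sizes[OF j b nj[OF b]] part_sizes[OF j b2(1) nj[OF b2(1)]] by linarith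
  next
    case False
    then have all: "\<forall>a\<in>B. a j = ?y \<or> a j = neg ?y" using class_eqD by metis
    then have all': "\<forall>a\<in>B. a j = neg ?y \<or> a j = neg (neg ?y)" by auto
    have cl': "fst (neg ?y) \<noteq> fst (u j)" using cl by simp
    have c1: "5 \<le> card ?P" if "\<And>a. a \<in> ?P \<Longrightarrow> \<not> agree I a (u(j := ?y))"
      using cover_5[OF finite_part part_code _ that] half_covers[of j ?y, OF j cl all]
      unfolding part_def by simp
    have c2: "5 \<le> card ?N" if "\<And>a. a \<in> ?N \<Longrightarrow> \<not> agree I a (u(j := neg ?y))"
      using cover_5[OF finite_part part_code _ that] half_covers[of j "neg ?y", OF j cl' all']
      unfolding part_def by simp
    have "\<not> ((\<exists>x\<in>?P. agree I x (u(j := ?y))) \<and> (\<exists>x\<in>?N. agree I x (u(j := neg ?y))))"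
    proof
      assume "(\<exists>x\<in>?P. agree I x (u(j := ?y))) \<and> (\<exists>x\<in>?N. agree I x (u(j := neg ?y)))"
      then obtain x x' where x: "x \<in> ?P" "x' \<in> ?N" "agree I x (u(j := ?y))" "agree I x' (u(j := neg ?y))"
        by blast
      then have "agree (I - {j}) x x'" by (simp add: agree_def)
      with no_twin[of x x' j] x j show False by (simp add: part_def)
    qed
    then have "5 \<le> card ?P \<or> 5 \<le> card ?N" using c1 c2 by blast
    with part_sizes[OF j b nj[OF b]] le show ?thesis by linarith
  qed
qed

end

lemma cover_meeting_5:
  assumes "finite A" "code I A" "covers I A u" "\<And>a. a \<in> A \<Longrightarrow> \<not> agree I a u"
  shows "5 \<le> card {a \<in> A. \<not> dich I a u}"
proof -
  interpret cover I "{a \<in> A. \<not> dich I a u}" u using coverI assms by blast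
  show ?thesis using cover_5[OF fin code covers] assms(4) by blast
qed

lemma cover_6:
  assumes "finite A" "code I A" "covers I A u" "\<And>a. a \<in> A \<Longrightarrow> \<not> agree I a u"
    and "j \<in> I" "\<And>a. a \<in> A \<Longrightarrow> \<not> dich I a u \<Longrightarrow> a j \<noteq> u j"
  shows "6 \<le> card A"
proof -
  interpret cover I "{a \<in> A. \<not> dich I a u}" u using coverI assms by blast
  have "6 \<le> card {a \<in> A. \<not> dich I a u}" using size_6 assms(4-6) by blast
  also have "\<dots> \<le> card A" using assms(1) by (auto intro: card_mono)
  finally show ?thesis .
qed

section \<open>Two codes covering the same points\<close>

lemma size_pos_ne: "0 < size F \<Longrightarrow> F \<noteq> {#}"
  by auto

lemma adj_sym: "adj J u v \<Longrightarrow> adj J v u"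
  unfolding adj_def by (metis agree_sym)

lemma at_mset_set: "finite A \<Longrightarrow> at i s (mset_set A) = mset_set {a \<in> A. a i = s}"
  by (simp add: at_def)

lemma at_commute: "at i s (at k m F) = at k m (at i s F)"
  by (simp add: at_def filter_filter_mset conj_commute)

lemma at_idem: "at i s (at i s F) = at i s F"
  and at_neg_empty: "at i s (at i (neg s) F) = {#}" "at i (neg s) (at i s F) = {#}"
  by (auto intro!: at_empty simp: at_def filter_filter_mset)

section \<open>Class weights and the identities of two codes\<close>

definition weight where
  "weight i s F = size (at i s F) + size (at i (neg s) F)"

lemma weight_class: "weight i s F = size (filter_mset (\<lambda>w. fst (w i) = fst s) F)"
  by (induction F) (auto simp: weight_def dest: class_eqD)

lemma weight_2:
  assumes "fst s \<noteq> fst t"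
  shows "weight i s F + weight i t F \<le> size F"
  using assms unfolding weight_class by (induction F) auto

lemma weight_3:
  assumes "fst s \<noteq> fst t" "fst s \<noteq> fst r" "fst t \<noteq> fst r"
  shows "weight i s F + weight i t F + weight i r F \<le> size F"
  using assms unfolding weight_class by (induction F) auto

locale rival =
  fixes I :: "'i set" and V W :: "('i \<Rightarrow> 'k \<times> bool) set"
  assumes finI: "finite I" and finV: "finite V" and finW: "finite W"
    and codeV: "code I V" and codeW: "code I W"
    and same: "\<And>om. (\<exists>v\<in>V. hit I om v) \<longleftrightarrow> (\<exists>w\<in>W. hit I om w)"
    and apartVW: "\<And>v w. v \<in> V \<Longrightarrow> w \<in> W \<Longrightarrow> \<not> agree I v w"
begin

lemma swapped: "rival I W V"
  by unfold_locales (use finI finV finW codeV codeW same apartVW agree_sym in blast)+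

abbreviation "MV \<equiv> mset_set V"
abbreviation "MW \<equiv> mset_set W"

lemma ev_code:
  assumes "finite A" "code I A"
  shows "ev I om (mset_set A) = of_bool (\<exists>a\<in>A. hit I om a)"
proof -
  have e: "ev I om (mset_set A) = card {a \<in> A. hit I om a}" using assms(1) by (simp add: ev_def)
  show ?thesis
  proof (cases "\<exists>a\<in>A. hit I om a")
    case True
    then obtain a where a: "a \<in> A" "hit I om a" by blast
    then have "{a \<in> A. hit I om a} = {a}" using code_hit_eq[OF assms(2) _ a(1) _ a(2)] by blast
    with e True show ?thesis by simp
  next
    case False
    then have "{a \<in> A. hit I om a} = {}" by blast
    with e False show ?thesis by simp
  qed
qed

lemma trade_VW: "trade I MV MW"
  unfolding trade_def ev_code[OF finV codeV] ev_code[OF finW codeW] same by simp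

lemma card_VW: "card V = card W"
  using trade_size[OF finI trade_VW] by simp

lemma memV: "w \<in># MV \<longleftrightarrow> w \<in> V" and memW: "w \<in># MW \<longleftrightarrow> w \<in> W"
  using finV finW by simp_all

text \<open>One side of the identity for the class of \<open>s\<close> at \<open>i\<close>.
  Exchanging the codes gives the other side, \<open>rival.quad W V i s\<close>.\<close>

definition quad where
  "quad i s = at i s MV + at i (neg s) MW"

lemma mem_quad: "f \<in># quad i s \<longleftrightarrow> f \<in> V \<and> f i = s \<or> f \<in> W \<and> f i = neg s"
  unfolding quad_def using memV memW by auto

lemma no_twinV: "u \<in> V \<Longrightarrow> v \<in> V \<Longrightarrow> l \<in> I \<Longrightarrow> v l = neg (u l) \<Longrightarrow> \<not> agree (I - {l}) u v"
  using codeV unfolding code_def compl_def by blast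

lemma dichV: "u \<in> V \<Longrightarrow> v \<in> V \<Longrightarrow> u \<noteq> v \<Longrightarrow> dich I u v"
  using codeV unfolding code_def by blast

end

lemma (in rival) quad_trade:
  assumes "i \<in> I"
  shows "trade (I - {i}) (quad i s) (rival.quad W V i s)"
proof -
  interpret s: rival I W V by (rule swapped)
  show ?thesis unfolding quad_def s.quad_def using trade_at[OF trade_VW assms] .
qed

lemma (in rival) quad_weight:
  assumes "i \<in> I"
  shows "weight i s MV + weight i s MW = 2 * size (quad i s)"
proof -
  interpret s: rival I W V by (rule swapped)
  have "size (quad i s) = size (s.quad i s)"
    using trade_size[OF _ quad_trade[OF assms]] finI by simp
  moreover have "weight i s MV + weight i s MW = size (quad i s) + size (s.quad i s)"
    by (simp add: weight_def quad_def s.quad_def)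
  ultimately show ?thesis by simp
qed

text \<open>A point of \<open>v\<close> with its letter at \<open>i\<close> complemented can be
  moved into \<open>w\<close>, hence is covered by \<open>V\<close>, and dichotomy with
  \<open>v\<close> forces the covering word to have the letter \<open>neg (v i)\<close>. This gives
  five such words by \<open>cover_5\<close>; the work lies in the sixth. The weight is twice the
  size of \<open>quad\<close>.\<close>

lemma (in rival) adjacent_half:
  assumes v: "v \<in> V" and w: "w \<in> W" and i: "i \<in> I" and ag: "agree (I - {i}) v w" and cl: "fst (v i) \<noteq> fst (w i)"
  shows "12 \<le> weight i (v i) MV + weight i (v i) MW"
proof -
  interpret s: rival I W V by (rule swapped)
  let ?b = "v i"
  define A where "A = {x \<in> V. x i = neg ?b}"
  have finA: "finite A" using finV by (simp add: A_def)
  have codeA: "code I A" using codeV by (rule code_mono) (auto simp: A_def)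
  have cov: "covers I A (v(i := neg ?b))"
    unfolding covers_def
  proof (intro allI impI)
    fix om assume h: "hit I om (v(i := neg ?b))"
    let ?om = "om(i := (om i)(fst (w i) := snd (w i)))"
    have hv: "hit (I - {i}) om v" "om i (fst ?b) = (\<not> snd ?b)"
      using h by (simp_all add: hit_split[OF i] hit_word_upd)
    have "hit (I - {i}) om w" using hv(1) hit_agree[OF ag, of om] by simp
    then have "hit I ?om w" by (simp add: hit_split[OF i] hit_point_upd)
    then have "\<exists>x\<in>V. hit I ?om x" using w same[of ?om] by blast
    then obtain x where x: "x \<in> V" "hit I ?om x" by blast
    have "\<not> hit I ?om v" using hv(2) cl by (simp add: hit_split[OF i])
    then have "x \<noteq> v" using x(2) by blast
    then obtain k where k: "k \<in> I" "x k = neg (v k)" using dichV[OF v x(1)] unfolding dich_def by blast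
    have "k = i"
    proof (rule ccontr)
      assume "k \<noteq> i"
      then have "om k (fst (v k)) = snd (v k)" using hv(1) k(1) unfolding hit_def by blast
      moreover have "?om k (fst (x k)) = snd (x k)" using x(2) k(1) unfolding hit_def by blast
      ultimately show False using k(2) \<open>k \<noteq> i\<close> by simp
    qed
    moreover have "hit (I - {i}) om x" using x(2) by (simp add: hit_split[OF i] hit_point_upd)
    ultimately have "x \<in> A" "hit I om x" using x(1) k(2) hv(2) by (simp_all add: A_def hit_split[OF i])
    then show "\<exists>a\<in>A. hit I om a" by blast
  qed
  have na: "\<not> agree I a (v(i := neg ?b))" if "a \<in> A" for a
  proof
    assume "agree I a (v(i := neg ?b))"
    then have "agree (I - {i}) v a" by (simp add: agree_def)
    with no_twinV[OF v _ i] that show False by (simp add: A_def)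
  qed
  have A5: "5 \<le> card A" using cover_5[OF finA codeA cov na] .
  have szA: "size (at i (neg ?b) MV) = card A" using finV by (simp add: at_mset_set A_def)
  have eq: "size (quad i ?b) = size (s.quad i ?b)"
    using trade_size[OF _ quad_trade[OF i]] finI by simp
  have sq: "size (s.quad i ?b) = size (at i ?b MW) + card A" using szA by (simp add: s.quad_def)
  have "6 \<le> size (quad i ?b)"
  proof (rule ccontr)
    assume "\<not> 6 \<le> size (quad i ?b)"
    then have "card A = 5 \<and> size (at i ?b MW) = 0 \<and> size (quad i ?b) = 5" using A5 eq sq by linarith
    then have c: "card A = 5" "at i ?b MW = {#}" "size (quad i ?b) = 5" by simp_all
    let ?Q = "quad i ?b"
    have t: "trade (I - {i}) ?Q (mset_set A)"
      using quad_trade[OF i, of ?b] c(2) finV by (simp add: s.quad_def at_mset_set A_def)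
    have ev1: "ev (I - {i}) om (mset_set A) \<le> 1" for om
    proof -
      let ?om = "om(i := (\<lambda>_. \<not> snd ?b))"
      have "hit I ?om a = hit (I - {i}) om a" if "a \<in> A" for a
        using that by (simp add: hit_split[OF i] hit_point_upd A_def)
      then have "filter_mset (hit (I - {i}) om) (mset_set A) = filter_mset (hit I ?om) (mset_set A)"
        by (intro filter_mset_cong refl) (use finA in simp)
      then have "ev (I - {i}) om (mset_set A) = ev I ?om (mset_set A)"
        unfolding ev_def by simp
      then show ?thesis using ev_code[OF finA codeA] by simp
    qed
    have covx: "covers I A (x(i := neg ?b))" if x: "x \<in># ?Q" for x
      unfolding covers_def
    proof (intro allI impI)
      fix om assume h: "hit I om (x(i := neg ?b))"
      have hx: "hit (I - {i}) om x" "om i (fst ?b) = (\<not> snd ?b)"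
        using h by (simp_all add: hit_split[OF i] hit_word_upd)
      have "x \<in># filter_mset (hit (I - {i}) om) ?Q" using x hx by simp
      then have "0 < ev (I - {i}) om ?Q" unfolding ev_def by (rule in_size_pos)
      then have "0 < ev (I - {i}) om (mset_set A)" using t by (simp add: trade_def)
      then have "filter_mset (hit (I - {i}) om) (mset_set A) \<noteq> {#}" unfolding ev_def by (rule size_pos_ne)
      then obtain a where "a \<in># filter_mset (hit (I - {i}) om) (mset_set A)" by blast
      then have a: "a \<in> A" "hit (I - {i}) om a" using finA by simp_all
      then have "hit I om a" using hx(2) by (simp add: hit_split[OF i] A_def)
      with a(1) show "\<exists>a\<in>A. hit I om a" by blast
    qed
    have nax: "\<not> agree I a (x(i := neg ?b))" if x: "x \<in># ?Q" and a: "a \<in> A" for x a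
    proof
      assume h: "agree I a (x(i := neg ?b))"
      then have h': "agree (I - {i}) x a" "a i = neg ?b" using i by (auto simp: agree_def)
      from x mem_quad consider "x \<in> V" "x i = ?b" | "x \<in> W" "x i = neg ?b" by blast
      then show False
      proof cases
        case 1
        with no_twinV[of x a i] h' a i show False by (simp add: A_def)
      next
        case 2
        then have "agree I a x" using h' by (metis agree_insertI agree_sym)
        with apartVW[of a x] a 2 show False by (simp add: A_def)
      qed
    qed
    have meet: "\<not> dich I a (x(i := neg ?b))" if x: "x \<in># ?Q" and a: "a \<in> A" for x a
    proof -
      have "card A \<le> card {a \<in> A. \<not> dich I a (x(i := neg ?b))}"
        using cover_meeting_5[OF finA codeA covx[OF x] nax[OF x]] c(1) by simp
      then have "{a \<in> A. \<not> dich I a (x(i := neg ?b))} = A"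
        using finA by (intro card_seteq) auto
      with a show ?thesis by blast
    qed
    have vQ: "v \<in># ?Q" using v mem_quad by blast
    then obtain Q' where Q': "?Q = add_mset v Q'" by (metis multi_member_split)
    with c(3) have "size Q' = 4" by simp
    then obtain x where x: "x \<in># Q'" by (metis multiset_nonemptyE size_empty zero_neq_numeral)
    then obtain Q'' where Q'': "Q' = add_mset x Q''" by (metis multi_member_split)
    have xQ: "x \<in># ?Q" using x Q' by simp
    \<comment> \<open>Words of \<open>A\<close> share their letter at \<open>i\<close>, so off
      \<open>i\<close> every point is hit at most once by \<open>A\<close>, and by the trade at most
      once by \<open>?Q\<close>.\<close>
    have "dich (I - {i}) v x"
    proof (rule ccontr)
      assume "\<not> dich (I - {i}) v x"
      from meet_point[OF this] obtain om where "hit (I - {i}) om v" "hit (I - {i}) om x" by blast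
      then have "2 \<le> ev (I - {i}) om ?Q" unfolding Q' Q'' by simp
      with t ev1[of om] show False by (simp add: trade_def)
    qed
    then obtain k where k: "k \<in> I - {i}" "x k = neg (v k)" unfolding dich_def by blast
    \<comment> \<open>Covering \<open>x\<close> already takes five words, so all words of
      \<open>A\<close> meet \<open>x\<close>. A letter shared with \<open>v\<close> at
      \<open>k\<close> would make such a word dichotomous to \<open>x\<close>.\<close>
    have "a k \<noteq> (v(i := neg ?b)) k" if a: "a \<in> A" for a
    proof
      assume "a k = (v(i := neg ?b)) k"
      then have "(x(i := neg ?b)) k = neg (a k)" using k by simp
      then have "dich I a (x(i := neg ?b))" using k(1) unfolding dich_def by blast
      with meet[OF xQ a] show False by simp
    qed
    then have "6 \<le> card A" using cover_6[OF finA codeA covx[OF vQ] nax[OF vQ]] k(1) by blast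
    with c(1) show False by simp
  qed
  then show ?thesis using quad_weight[OF i, of ?b] by simp
qed

lemma (in rival) adjacent_12:
  assumes "v \<in> V" "w \<in> W" "adj I v w"
  shows "12 \<le> card V"
proof -
  interpret s: rival I W V by (rule swapped)
  obtain i where i: "i \<in> I" "agree (I - {i}) v w" "fst (v i) \<noteq> fst (w i)" using assms(3) unfolding adj_def by blast
  have "12 \<le> weight i (v i) MV + weight i (v i) MW" using adjacent_half[OF assms(1,2) i] .
  moreover have "12 \<le> weight i (w i) MW + weight i (w i) MV"
    using s.adjacent_half[OF assms(2,1) i(1) agree_sym[OF i(2)]] i(3) by simp
  moreover have "weight i (v i) MV + weight i (w i) MV \<le> card V" "weight i (v i) MW + weight i (w i) MW \<le> card W"
    using weight_2[OF i(3), of i MV] weight_2[OF i(3), of i MW] by simp_all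
  ultimately show ?thesis using card_VW by linarith
qed

text \<open>Twins within one side cannot come from the same code, so one is in \<open>V\<close> and
  one in \<open>W\<close>, with opposite letters at \<open>i\<close>. A word of the other side on
  their line shares its letter at \<open>i\<close> with one of them, which is in the other code: it
  is adjacent to this word, equal to it, or else a twin at \<open>i\<close> of the remaining
  one.\<close>

lemma (in rival) quad_lines:
  assumes i: "i \<in> I" and na: "\<And>v w. v \<in> V \<Longrightarrow> w \<in> W \<Longrightarrow> \<not> adj I v w"
  shows "lines (I - {i}) (quad i s) (rival.quad W V i s)"
proof -
  interpret s: rival I W V by (rule swapped)
  have full: "agree (I - {l}) u u'" if "agree (I - {i} - {l}) u u'" "u i = u' i" for u u' :: "'i \<Rightarrow> 'k \<times> bool" and l
    using that unfolding agree_def by blast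
  have flip: "agree (I - {i}) u u'" if "agree (I - {i} - {l}) u u'" "u l = u' l" for u u' :: "'i \<Rightarrow> 'k \<times> bool" and l
    using that unfolding agree_def by blast
  have key: False
    if x: "x \<in> V" "x i = s" and y: "y \<in> W" "y i = neg s" and l: "l \<in> I - {i}" "y l = neg (x l)"
      and xy: "agree (I - {i} - {l}) x y" and g: "g \<in># s.quad i s" "agree (I - {i} - {l}) x g" for x y g l
  proof -
    have yg: "agree (I - {i} - {l}) y g" using xy g(2) agree_sym agree_trans by metis
    have lI: "l \<in> I" using l(1) by simp
    from g(1) s.mem_quad consider "g \<in> W" "g i = s" | "g \<in> V" "g i = neg s" by blast
    then show False
    proof cases
      case 1
      have xg: "agree (I - {l}) x g" using full[OF g(2)] x(2) 1(2) by simp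
      consider "fst (x l) \<noteq> fst (g l)" | "x l = g l" | "x l = neg (g l)" using class_eqD by blast
      then show False
      proof cases
        case a: 1
        with xg lI have "adj I x g" unfolding adj_def by blast
        with na x 1 show False by blast
      next
        case 2
        with xg have "agree I x g" by (rule agree_insertI)
        with apartVW x 1 show False by blast
      next
        case 3
        then have "y l = g l" using l(2) by simp
        with flip[OF yg] have "agree (I - {i}) y g" by simp
        then have "agree (I - {i}) g y" by (rule agree_sym)
        with s.no_twinV[of g y i] 1 y i show False by simp
      qed
    next
      case 2
      have yg': "agree (I - {l}) y g" using full[OF yg] y(2) 2(2) by simp
      consider "fst (y l) \<noteq> fst (g l)" | "y l = g l" | "y l = neg (g l)" using class_eqD by blast
      then show False
      proof cases
        case 1
        with yg' lI have "adj I y g" unfolding adj_def by blast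
        then have "adj I g y" by (rule adj_sym)
        with na y 2 show False by blast
      next
        case a: 2
        with yg' have "agree I y g" by (rule agree_insertI)
        then have "agree I g y" by (rule agree_sym)
        with apartVW y 2 show False by blast
      next
        case 3
        then have "x l = g l" using l(2) by simp
        with flip[OF g(2)] have "agree (I - {i}) x g" by simp
        with no_twinV[of x g i] 2 x i show False by simp
      qed
    qed
  qed
  show ?thesis unfolding lines_def
  proof (intro ballI impI notI)
    fix f f' g l
    assume f: "f \<in># quad i s" and f': "f' \<in># quad i s" and g: "g \<in># s.quad i s" and l: "l \<in> I - {i}"
      and fl: "f' l = neg (f l)" and ff: "agree (I - {i} - {l}) f f'" and fg: "agree (I - {i} - {l}) f g"
    have f'g: "agree (I - {i} - {l}) f' g" using ff fg agree_sym agree_trans by metis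
    have lI: "l \<in> I" using l by simp
    from f mem_quad consider "f \<in> V" "f i = s" | "f \<in> W" "f i = neg s" by blast
    then show False
    proof cases
      case 1
      from f' mem_quad consider "f' \<in> V" "f' i = s" | "f' \<in> W" "f' i = neg s" by blast
      then show False
      proof cases
        case a: 1
        have "agree (I - {l}) f f'" using full[OF ff] 1(2) a(2) by simp
        with no_twinV[OF 1(1) a(1) lI fl] show False by blast
      next
        case 2
        from key[OF 1 2 l fl ff g fg] show False .
      qed
    next
      case 2
      from f' mem_quad consider "f' \<in> V" "f' i = s" | "f' \<in> W" "f' i = neg s" by blast
      then show False
      proof cases
        case 1
        have "f l = neg (f' l)" using fl by simp
        from key[OF 1 2 l this agree_sym[OF ff] g f'g] show False .
      next
        case a: 2
        have "agree (I - {l}) f f'" using full[OF ff] 2(2) a(2) by simp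
        with s.no_twinV[OF 2(1) a(1) lI fl] show False by blast
      qed
    qed
  qed
qed

text \<open>A neighbour of \<open>g\<close> from the other code would share its letter at
  \<open>i\<close> and so be adjacent to \<open>g\<close> in \<open>I\<close>. Hence both neighbours
  belong to the code of \<open>g\<close>, have the same letter at \<open>i\<close>, and are
  dichotomous elsewhere unless equal.\<close>

lemma (in rival) quad_nbr:
  assumes i: "i \<in> I" and na: "\<And>v w. v \<in> V \<Longrightarrow> w \<in> W \<Longrightarrow> \<not> adj I v w"
  shows "nbr (I - {i}) (quad i s) (rival.quad W V i s)"
proof -
  interpret s: rival I W V by (rule swapped)
  have lift: "adj I u u'" if a: "adj (I - {i}) u u'" and e: "u i = u' i" for u u' :: "'i \<Rightarrow> 'k \<times> bool"
  proof -
    from a obtain l where l: "l \<in> I - {i}" "agree (I - {i} - {l}) u u'" "fst (u l) \<noteq> fst (u' l)"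
      unfolding adj_def by blast
    then have "agree (I - {l}) u u'" using e unfolding agree_def by blast
    with l show ?thesis unfolding adj_def by blast
  qed
  have drop: "dich (I - {i}) u u'" if d: "dich I u u'" and e: "u i = u' i" for u u' :: "'i \<Rightarrow> 'k \<times> bool"
  proof -
    from d obtain k where k: "k \<in> I" "u' k = neg (u k)" unfolding dich_def by blast
    with e have "k \<noteq> i" by auto
    with k show ?thesis unfolding dich_def by blast
  qed
  show ?thesis unfolding nbr_def
  proof (intro ballI impI)
    fix f f' g
    assume f: "f \<in># quad i s" and f': "f' \<in># quad i s" and g: "g \<in># s.quad i s"
      and a: "adj (I - {i}) f g" "adj (I - {i}) f' g"
    from g s.mem_quad consider "g \<in> W" "g i = s" | "g \<in> V" "g i = neg s" by blast
    then show "agree (I - {i}) f f' \<or> dich (I - {i}) f f'"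
    proof cases
      case 1
      have "h \<in> W \<and> h i = neg s" if h: "h \<in># quad i s" "adj (I - {i}) h g" for h
        using h(1)[unfolded mem_quad] lift[OF h(2)] 1 na by auto
      from this[OF f a(1)] this[OF f' a(2)] have "f \<in> W" "f' \<in> W" "f i = f' i" by simp_all
      then show ?thesis using s.dichV[of f f'] drop[of f f'] by (cases "f = f'") auto
    next
      case 2
      have "h \<in> V \<and> h i = s" if h: "h \<in># quad i s" "adj (I - {i}) h g" for h
        using h(1)[unfolded mem_quad] lift[OF h(2)] 2 na adj_sym[of I h g] by auto
      from this[OF f a(1)] this[OF f' a(2)] have "f \<in> V" "f' \<in> V" "f i = f' i" by simp_all
      then show ?thesis using dichV[of f f'] drop[of f f'] by (cases "f = f'") auto
    qed
  qed
qed

lemma (in rival) quad_good: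
  assumes i: "i \<in> I" and na: "\<And>v w. v \<in> V \<Longrightarrow> w \<in> W \<Longrightarrow> \<not> adj I v w"
  shows "good (I - {i}) (quad i s) (rival.quad W V i s)"
proof -
  interpret s: rival I W V by (rule swapped)
  have na': "\<not> adj I w v" if "w \<in> W" "v \<in> V" for v w using na that adj_sym by blast
  have "apart (I - {i}) (quad i s) (s.quad i s)" unfolding apart_def
  proof (intro ballI notI)
    fix x y assume x: "x \<in># quad i s" and y: "y \<in># s.quad i s" and a: "agree (I - {i}) x y"
    from x mem_quad consider "x \<in> V" "x i = s" | "x \<in> W" "x i = neg s" by blast
    then show False
    proof cases
      case 1
      from y s.mem_quad consider "y \<in> W" "y i = s" | "y \<in> V" "y i = neg s" by blast
      then show False
      proof cases
        case b: 1
        have "agree I x y" using a 1(2) b(2) by (intro agree_insertI[OF a]) simp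
        with apartVW 1 b show False by blast
      next
        case 2
        with no_twinV[of x y i] 1 i a show False by simp
      qed
    next
      case 2
      from y s.mem_quad consider "y \<in> W" "y i = s" | "y \<in> V" "y i = neg s" by blast
      then show False
      proof cases
        case 1
        with s.no_twinV[of x y i] 2 i a show False by simp
      next
        case b: 2
        have "agree I x y" using a 2(2) b(2) by (intro agree_insertI[OF a]) simp
        then have "agree I y x" by (rule agree_sym)
        with apartVW 2 b show False by blast
      qed
    qed
  qed
  then show ?thesis
    unfolding good_def
    using finI quad_trade[OF i] quad_lines[OF i na] quad_nbr[OF i na] s.quad_lines[OF i na'] s.quad_nbr[OF i na']
    by blast
qed

text \<open>Twins of a block from the same code would have the same letter at \<open>i\<close> and
  so be twins in that code. One of them therefore comes from \<open>W\<close> and one from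
  \<open>V\<close>, and as twins they have equal classes.\<close>

lemma (in rival) block_split:
  assumes i: "i \<in> I" and k: "k \<in> I - {i}"
    and u: "at k n (rival.quad W V i s) = {#u1, u2#}" and c: "compl (I - {i} - {k}) u1 u2"
  shows "\<exists>x y. at k n (at i s MW) = {#x#} \<and> at k n (at i (neg s) MV) = {#y#} \<and>
    (\<forall>t\<in>I - {i} - {k}. fst (x t) = fst (y t))"
proof -
  interpret s: rival I W V by (rule swapped)
  have m: "u1 \<in># s.quad i s" "u1 k = n" "u2 \<in># s.quad i s" "u2 k = n" using at_memD[OF u] by auto
  from c obtain l where l: "l \<in> I - {i} - {k}" "u2 l = neg (u1 l)" "agree (I - {i} - {k} - {l}) u1 u2"
    unfolding compl_def by blast
  have cl: "fst (u1 t) = fst (u2 t)" if "t \<in> I - {i} - {k}" for t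
    using l that unfolding agree_def by (cases "t = l") auto
  have ne: "u1 i \<noteq> u2 i"
  proof
    assume e: "u1 i = u2 i"
    have "u1 t = u2 t" if "t \<in> I - {l}" for t
    proof -
      consider "t = i" | "t = k" | "t \<in> I - {i} - {k} - {l}" using \<open>t \<in> I - {l}\<close> by blast
      then show ?thesis
      proof cases
        case 3
        with l(3) show ?thesis unfolding agree_def by blast
      qed (use e m(2,4) in simp_all)
    qed
    then have al: "agree (I - {l}) u1 u2" unfolding agree_def by blast
    have "(u1 \<in> W \<and> u1 i = s \<or> u1 \<in> V \<and> u1 i = neg s) \<and> (u2 \<in> W \<and> u2 i = s \<or> u2 \<in> V \<and> u2 i = neg s)"
      using m(1,3) s.mem_quad[of u1 i s] s.mem_quad[of u2 i s] by simp
    then have "u1 \<in> V \<and> u2 \<in> V \<or> u1 \<in> W \<and> u2 \<in> W" using e neg_neq(1)[of s] by metis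
    moreover have "l \<in> I" using l(1) by simp
    ultimately show False using no_twinV[of u1 u2 l] s.no_twinV[of u1 u2 l] l(2) al by blast
  qed
  have W: "at k n (at i s MW) = at i s {#u1, u2#}" and V: "at k n (at i (neg s) MV) = at i (neg s) {#u1, u2#}"
    unfolding u[symmetric] s.quad_def at_simps(3) at_commute[of i _ k] at_idem at_neg_empty
    by simp_all
  have "u1 i = s \<or> u1 i = neg s" "u2 i = s \<or> u2 i = neg s"
    using m(1,3) s.mem_quad[of u1 i s] s.mem_quad[of u2 i s] by blast+
  with ne consider "u1 i = s" "u2 i = neg s" | "u1 i = neg s" "u2 i = s" by metis
  then show ?thesis
  proof cases
    case 1
    then show ?thesis unfolding W V using cl by (intro exI[of _ u1] exI[of _ u2]) simp
  next
    case 2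
    then show ?thesis unfolding W V using cl by (intro exI[of _ u2] exI[of _ u1]) simp
  qed
qed

text \<open>The four words of the block reappear in the identity for the class of \<open>m\<close>
  at \<open>k\<close>, where they are the only words with letter \<open>s\<close> or
  \<open>neg s\<close> at \<open>i\<close>, one for each letter on each side. If a side had at most
  five words, \<open>one_each\<close> would give \<open>x\<close> and \<open>y\<close> different
  classes somewhere, but they were twins.\<close>

lemma (in rival) block_12:
  assumes i: "i \<in> I" and na: "\<And>v w. v \<in> V \<Longrightarrow> w \<in> W \<Longrightarrow> \<not> adj I v w"
    and k: "k \<in> I - {i}" and b: "block (I - {i}) k m (rival.quad W V i s)"
    and none: "\<forall>f\<in>#quad i s. fst (f k) \<noteq> fst m"
  shows "12 \<le> weight k m MV + weight k m MW"
proof -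
  interpret s: rival I W V by (rule swapped)
  have kI: "k \<in> I" using k by simp
  from b obtain u1 u2 w1 w2 where u: "at k m (s.quad i s) = {#u1, u2#}" "compl (I - {i} - {k}) u1 u2"
    and w: "at k (neg m) (s.quad i s) = {#w1, w2#}" "compl (I - {i} - {k}) w1 w2"
    unfolding block_def by blast
  obtain x y where xy: "at k m (at i s MW) = {#x#}" "at k m (at i (neg s) MV) = {#y#}"
    "\<forall>t\<in>I - {i} - {k}. fst (x t) = fst (y t)" using block_split[OF i k u] by blast
  obtain x' y' where xy': "at k (neg m) (at i s MW) = {#x'#}" "at k (neg m) (at i (neg s) MV) = {#y'#}"
    using block_split[OF i k w] by blast
  have e: "at k n (at i s MV) = {#}" "at k n (at i (neg s) MW) = {#}" if "fst n = fst m" for n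
  proof -
    have nn: "f k \<noteq> n" if "f \<in> V \<and> f i = s \<or> f \<in> W \<and> f i = neg s" for f
      using none that mem_quad \<open>fst n = fst m\<close> by metis
    show "at k n (at i s MV) = {#}" using finV by (intro at_empty nn) simp
    show "at k n (at i (neg s) MW) = {#}" using finW by (intro at_empty nn) simp
  qed
  have 1: "at i s (quad k m) = {#x'#}" "at i (neg s) (quad k m) = {#y#}"
    "at i s (s.quad k m) = {#x#}" "at i (neg s) (s.quad k m) = {#y'#}"
    unfolding quad_def s.quad_def using xy xy' e by (simp_all add: at_commute[of i _ k])
  have "6 \<le> size (quad k m)"
  proof (rule ccontr)
    assume "\<not> 6 \<le> size (quad k m)"
    then have 5: "size (quad k m) \<le> 5" by linarith
    have mem: "x' \<in># quad k m" "x' i = s" "y' \<in># s.quad k m" "y' i = neg s"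
      using at_memD[OF 1(1)] at_memD[OF 1(4)] by auto
    then have ne: "quad k m \<noteq> {#}" by auto
    have "four (I - {k}) (quad k m) (s.quad k m) i"
      using good_small(2)[OF quad_good[OF kI na] ne 5, of i x' y'] i k mem by auto
    from four.one_each[OF this 1]
    have a: "agree (I - {k} - {i}) x' y" and d: "adj (I - {k} - {i}) x' x" by simp_all
    from d obtain l where l: "l \<in> I - {k} - {i}" "fst (x' l) \<noteq> fst (x l)" unfolding adj_def by blast
    with a have "x' l = y l" unfolding agree_def by blast
    with xy(3) l show False by auto
  qed
  then show ?thesis using quad_weight[OF kI, of m] by simp
qed

lemma (in rival) weight_8:
  assumes k: "k \<in> I" and na: "\<And>v w. v \<in> V \<Longrightarrow> w \<in> W \<Longrightarrow> \<not> adj I v w" and f: "f \<in> V \<or> f \<in> W"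
  shows "8 \<le> weight k (f k) MV + weight k (f k) MW"
proof -
  interpret s: rival I W V by (rule swapped)
  note g = quad_good[OF k na, of "f k"]
  have "f \<in># quad k (f k) \<or> f \<in># s.quad k (f k)" using f mem_quad s.mem_quad by blast
  then have "0 < size (quad k (f k)) \<or> 0 < size (s.quad k (f k))" using in_size_pos by metis
  moreover have "size (quad k (f k)) = size (s.quad k (f k))" using goodD(8)[OF g] .
  ultimately have "0 < size (quad k (f k))" by linarith
  then have "quad k (f k) \<noteq> {#}" by (rule size_pos_ne)
  from good_size4[OF g this] quad_weight[OF k, of "f k"] show ?thesis by simp
qed

text \<open>Over both codes the classes at \<open>k\<close> have total weight at most
  \<open>2 * card V\<close>. The alternatives contribute 12 + 12 and 12 + 8 + 8, in either case at
  least 24.\<close>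

lemma (in rival) outcome_12:
  assumes i: "i \<in> I" and na: "\<And>v w. v \<in> V \<Longrightarrow> w \<in> W \<Longrightarrow> \<not> adj I v w"
    and k: "k \<in> I - {i}" and out: "outcome (I - {i}) k m (rival.quad W V i s) (quad i s)"
  shows "12 \<le> card V"
proof -
  interpret s: rival I W V by (rule swapped)
  have kI: "k \<in> I" using k by simp
  have na': "\<not> adj I w v" if "w \<in> W" "v \<in> V" for v w using na that adj_sym by blast
  have b: "block (I - {i}) k m (s.quad i s)" and none: "\<forall>f\<in>#quad i s. fst (f k) \<noteq> fst m"
    using out unfolding outcome_def by blast+
  have m12: "12 \<le> weight k m MV + weight k m MW" using block_12[OF i na k b none] .
  from out consider a where "block (I - {i}) k a (quad i s)" "\<forall>g\<in>#s.quad i s. fst (g k) \<noteq> fst a"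
    | f1 f2 where "f1 \<in># quad i s" "f2 \<in># quad i s" "fst (f1 k) \<noteq> fst (f2 k)"
    unfolding outcome_def by blast
  then show ?thesis
  proof cases
    case 1
    have a12: "12 \<le> weight k a MW + weight k a MV" using s.block_12[OF i na' k 1] .
    from 1(1) obtain v1 v2 where v: "at k a (quad i s) = {#v1, v2#}" unfolding block_def by blast
    have "v1 \<in># quad i s" "v1 k = a" using at_memD[OF v] by auto
    with none have ma: "fst m \<noteq> fst a" by auto
    have "weight k m MV + weight k a MV \<le> card V" "weight k m MW + weight k a MW \<le> card W"
      using weight_2[OF ma, of k MV] weight_2[OF ma, of k MW] by simp_all
    with m12 a12 card_VW show ?thesis by linarith
  next
    case 2
    have f: "f1 \<in> V \<or> f1 \<in> W" "f2 \<in> V \<or> f2 \<in> W" using 2 mem_quad by blast+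
    have c: "fst m \<noteq> fst (f1 k)" "fst m \<noteq> fst (f2 k)" using none 2 by auto
    have "weight k m MV + weight k (f1 k) MV + weight k (f2 k) MV \<le> card V"
      "weight k m MW + weight k (f1 k) MW + weight k (f2 k) MW \<le> card W"
      using weight_3[OF c 2(3), of k MV] weight_3[OF c 2(3), of k MW] by simp_all
    with m12 weight_8[OF kI na f(1)] weight_8[OF kI na f(2)] card_VW show ?thesis by linarith
  qed
qed

lemma (in rival) card_ge_12:
  assumes ne: "V \<noteq> {}"
  shows "12 \<le> card V"
proof (rule ccontr)
  assume n: "\<not> 12 \<le> card V"
  interpret s: rival I W V by (rule swapped)
  have na: "\<not> adj I v w" if "v \<in> V" "w \<in> W" for v w using adjacent_12[OF that] n by blast
  have na': "\<not> adj I w v" if "w \<in> W" "v \<in> V" for v w using na that adj_sym by blast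
  obtain v where v: "v \<in> V" using ne by blast
  have "hit I (meet_point v v) v" by (simp add: hit_def meet_point_def)
  then have "\<exists>w\<in>W. hit I (meet_point v v) w" using v same[of "meet_point v v"] by blast
  then obtain w where w: "w \<in> W" "hit I (meet_point v v) w" by blast
  obtain i where i: "i \<in> I" "v i \<noteq> w i" using apartVW[OF v w(1)] unfolding agree_def by blast
  \<comment> \<open>At \<open>i\<close>, the point \<open>meet_point v v\<close> selects the sign of
    \<open>v i\<close> in every class, so \<open>w\<close> has this sign too and can differ only in
    its class.\<close>
  have "snd (v i) = snd (w i)" using w(2) i(1) unfolding hit_def meet_point_def by (metis (full_types))
  then have cl: "fst (v i) \<noteq> fst (w i)" using i(2) by (auto simp: prod_eq_iff)
  have "weight i (v i) MV + weight i (w i) MV \<le> card V" "weight i (v i) MW + weight i (w i) MW \<le> card W"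
    using weight_2[OF cl, of i MV] weight_2[OF cl, of i MW] by simp_all
  \<comment> \<open>Two classes share a total of at most 22. The combined weight of a class is twice
    the size of \<open>quad\<close>, so a weight up to 11 means at most five words.\<close>
  with n card_VW have "weight i (v i) MV + weight i (v i) MW \<le> 11 \<or> weight i (w i) MV + weight i (w i) MW \<le> 11"
    by linarith
  then obtain x where x: "x \<in> V \<or> x \<in> W" "weight i (x i) MV + weight i (x i) MW \<le> 11"
    using v w(1) by blast
  let ?s = "x i"
  have 5: "size (quad i ?s) \<le> 5" using quad_weight[OF i(1), of ?s] x(2) by linarith
  have "8 \<le> weight i ?s MV + weight i ?s MW" using weight_8[OF i(1) na x(1)] .
  then have "0 < size (quad i ?s)" using quad_weight[OF i(1), of ?s] by linarith
  then have "quad i ?s \<noteq> {#}" by (rule size_pos_ne)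
  from good_small(3)[OF quad_good[OF i(1) na] this 5]
  obtain k m where k: "k \<in> I - {i}"
    and o: "outcome (I - {i}) k m (s.quad i ?s) (quad i ?s) \<or> outcome (I - {i}) k m (quad i ?s) (s.quad i ?s)"
    by blast
  from o show False
  proof
    assume "outcome (I - {i}) k m (s.quad i ?s) (quad i ?s)"
    from outcome_12[OF i(1) na k this] n show False by blast
  next
    assume "outcome (I - {i}) k m (quad i ?s) (s.quad i ?s)"
    from s.outcome_12[OF i(1) na' k this] n card_VW show False by simp
  qed
qed

section \<open>Encoding of words\<close>

text \<open>\<open>rep c s\<close> depends only on the set \<open>{s, c s}\<close> and names the class of \<open>s\<close>.\<close>

definition rep :: "('a \<Rightarrow> 'a) \<Rightarrow> 'a \<Rightarrow> 'a" where
  "rep c s = (SOME t. t \<in> {s, c s})"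

definition enc :: "('a \<Rightarrow> 'a) \<Rightarrow> 'a \<Rightarrow> 'a \<times> bool" where
  "enc c s = (rep c s, s = rep c s)"

definition encw :: "('a \<Rightarrow> 'a) \<Rightarrow> (nat \<Rightarrow> 'a) \<Rightarrow> nat \<Rightarrow> 'a \<times> bool" where
  "encw c v i = enc c (v i)"

context
  fixes S :: "'a set" and c :: "'a \<Rightarrow> 'a"
  assumes compl: "complementation S c"
begin

lemma c_in: "s \<in> S \<Longrightarrow> c s \<in> S" and c_c: "s \<in> S \<Longrightarrow> c (c s) = s" and c_neq: "s \<in> S \<Longrightarrow> c s \<noteq> s"
proof -
  assume s: "s \<in> S"
  have "bij_betw c S S" "\<forall>s\<in>S. c (c s) = s \<and> c s \<noteq> s"
    using compl unfolding complementation_def by simp_all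
  with s show "c s \<in> S" "c (c s) = s" "c s \<noteq> s" using bij_betwE[of c S S] by simp_all
qed

lemma rep_cases: "rep c s = s \<or> rep c s = c s"
proof -
  have "rep c s \<in> {s, c s}" unfolding rep_def by (rule someI[of _ s]) simp
  then show ?thesis by simp
qed

lemma rep_c:
  assumes "s \<in> S"
  shows "rep c (c s) = rep c s"
proof -
  have "{c s, c (c s)} = {s, c s}" using c_c[OF assms] by auto
  then show ?thesis unfolding rep_def by simp
qed

lemma c_eq_rep: "s \<in> S \<Longrightarrow> (c s = rep c s) \<longleftrightarrow> s \<noteq> rep c s"
  using rep_cases[of s] c_neq[of s] by metis

lemma enc_c:
  assumes s: "s \<in> S"
  shows "enc c (c s) = neg (enc c s)"
  unfolding enc_def neg_def fst_conv snd_conv rep_c[OF s] c_eq_rep[OF s] ..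

lemma enc_inj:
  assumes s: "s \<in> S" and t: "t \<in> S" and e: "enc c s = enc c t"
  shows "s = t"
proof -
  from e have "rep c s = rep c t \<and> (s = rep c s) = (t = rep c t)" unfolding enc_def prod.inject .
  then have r: "rep c s = rep c t" and r': "(s = rep c s) = (t = rep c t)" by (rule conjunct1, rule conjunct2)
  show ?thesis
  proof (cases "s = rep c s")
    case True
    show ?thesis using trans[OF trans[OF True r] sym[OF iffD1[OF r' True]]] .
  next
    case False
    then have "rep c s = c s" using rep_cases[of s] by fastforce
    moreover have "t \<noteq> rep c t" using False r' by blast
    then have "rep c t = c t" using rep_cases[of t] by fastforce
    ultimately have "c s = c t" using r by argo
    then have "c (c s) = c (c t)" by (rule arg_cong)
    then show ?thesis unfolding c_c[OF s] c_c[OF t] .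
  qed
qed

lemma words_mem: "v \<in> words S d \<Longrightarrow> i \<in> {1..d} \<Longrightarrow> v i \<in> S"
  unfolding words_def by (rule PiE_mem)

lemma agree_encw:
  assumes "v \<in> words S d" "w \<in> words S d" "J \<subseteq> {1..d}" "agree J (encw c v) (encw c w)"
  shows "\<forall>i\<in>J. v i = w i"
proof
  fix i assume i: "i \<in> J"
  then have "i \<in> {1..d}" using assms(3) by blast
  then have "v i \<in> S" "w i \<in> S" using words_mem assms(1,2) by blast+
  moreover have "enc c (v i) = enc c (w i)" using assms(4) i by (simp add: agree_def encw_def)
  ultimately show "v i = w i" by (rule enc_inj)
qed

lemma encw_inj:
  assumes "v \<in> words S d" "w \<in> words S d" "agree {1..d} (encw c v) (encw c w)"
  shows "v = w"
proof (rule PiE_ext)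
  show "v \<in> {1..d} \<rightarrow>\<^sub>E S" "w \<in> {1..d} \<rightarrow>\<^sub>E S" using assms(1,2) unfolding words_def .
  show "v i = w i" if "i \<in> {1..d}" for i
    using agree_encw[OF assms(1,2) order_refl assms(3)] that by blast
qed

lemma code_encw:
  assumes V: "polybox_code S c d V" and nt: "\<not> (\<exists>u\<in>V. \<exists>v\<in>V. twin_pair c d u v)"
  shows "code {1..d} (encw c ` V)"
proof -
  have sub: "V \<subseteq> words S d" and pw: "pairwise (dichotomous c d) V"
    using V unfolding polybox_code_def by auto
  have inS: "v i \<in> S" if "v \<in> V" "i \<in> {1..d}" for v i
    using sub that words_mem by blast
  have 1: "dich {1..d} (encw c u) (encw c v)" if uv: "u \<in> V" "v \<in> V" "u \<noteq> v" for u v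
  proof -
    from pw uv obtain j where j: "j \<in> {1..d}" "c (u j) = v j"
      unfolding pairwise_def dichotomous_def by blast
    then have "encw c v j = neg (encw c u j)" using enc_c[OF inS[OF uv(1) j(1)]] by (simp add: encw_def)
    with j(1) show ?thesis unfolding dich_def by blast
  qed
  have 2: "\<not> compl {1..d} (encw c u) (encw c v)" if uv: "u \<in> V" "v \<in> V" for u v
  proof
    assume "compl {1..d} (encw c u) (encw c v)"
    then obtain l where l: "l \<in> {1..d}" "encw c v l = neg (encw c u l)"
      "agree ({1..d} - {l}) (encw c u) (encw c v)" unfolding compl_def by blast
    have "enc c (v l) = enc c (c (u l))" using l(2) enc_c[OF inS[OF uv(1) l(1)]] by (simp add: encw_def)
    then have "c (u l) = v l" using enc_inj inS[OF uv(2) l(1)] c_in[OF inS[OF uv(1) l(1)]] by metis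
    moreover have "\<forall>i\<in>{1..d} - {l}. u i = v i"
      using agree_encw[OF _ _ _ l(3)] uv sub by blast
    ultimately have "twin_pair c d u v" using l(1) unfolding twin_pair_def by blast
    with nt uv show False by blast
  qed
  show ?thesis unfolding code_def using 1 2 by blast
qed

text \<open>The universal map that preserves dichotomies: every \<open>X i\<close> is the set of all selections of one letter from
  each pair.\<close>

definition choices :: "'a set set" where
  "choices = {A. A \<subseteq> S \<and> (\<forall>s\<in>S. c s \<in> A \<longleftrightarrow> s \<notin> A)}"

text \<open>One coordinate of a point, turned into the set of letters that it selects.\<close>

definition choice :: "('a \<Rightarrow> bool) \<Rightarrow> 'a set" where
  "choice p = {t \<in> S. p (rep c t) = (t = rep c t)}"

definition boxes :: "nat \<Rightarrow> (nat \<Rightarrow> 'a) \<Rightarrow> (nat \<Rightarrow> 'a set) set" where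
  "boxes d u = (\<Pi>\<^sub>E i\<in>{1..d}. {A \<in> choices. u i \<in> A})"

lemma choice_mem: "s \<in> S \<Longrightarrow> s \<in> choice p \<longleftrightarrow> p (fst (enc c s)) = snd (enc c s)"
  by (simp add: choice_def enc_def)

lemma choice_in: "choice p \<in> choices"
proof -
  have "c s \<in> choice p \<longleftrightarrow> s \<notin> choice p" if s: "s \<in> S" for s
    using choice_mem[OF s] choice_mem[OF c_in[OF s]] enc_c[OF s] by simp
  moreover have "choice p \<subseteq> S" unfolding choice_def by blast
  ultimately show ?thesis unfolding choices_def by blast
qed

lemma letter_choice:
  assumes s: "s \<in> S"
  shows "\<exists>A\<in>choices. s \<in> A" and "\<exists>A\<in>choices. s \<notin> A"
proof -
  have "s \<in> choice (\<lambda>_. snd (enc c s))" unfolding choice_mem[OF s] ..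
  with choice_in show "\<exists>A\<in>choices. s \<in> A" by (rule bexI[rotated])
  have "s \<notin> choice (\<lambda>_. \<not> snd (enc c s))" unfolding choice_mem[OF s] by simp
  with choice_in show "\<exists>A\<in>choices. s \<notin> A" by (rule bexI[rotated])
qed

lemma preserves_boxes:
  assumes "S \<noteq> {} \<or> d = 0"
  shows "preserves_dichotomies S c d (boxes d)"
  unfolding preserves_dichotomies_def
proof (rule exI[of _ "\<lambda>_. choices"], rule exI[of _ "\<lambda>_ s. {A \<in> choices. s \<in> A}"], intro conjI ballI)
  fix i assume i: "i \<in> {1..d}"
  then obtain s where s: "s \<in> S" using assms by auto
  from letter_choice[OF s] obtain A B where "A \<in> choices" "s \<in> A" "B \<in> choices" "s \<notin> B" by blast
  then have "A \<noteq> B" by blast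
  then have AB: "{A, B} \<subseteq> choices" "card {A, B} = 2"
    using \<open>A \<in> choices\<close> \<open>B \<in> choices\<close> by simp_all
  show "infinite choices \<or> 2 \<le> card choices" using AB card_mono[of choices "{A, B}"] by auto
next
  fix i s assume s: "s \<in> S"
  show "{A \<in> choices. s \<in> A} \<subseteq> choices" by blast
  show "{A \<in> choices. s \<in> A} \<noteq> {}" "{A \<in> choices. s \<in> A} \<noteq> choices"
    using letter_choice[OF s] by blast+
  have "c s \<in> A \<longleftrightarrow> s \<notin> A" if "A \<in> choices" for A using that s unfolding choices_def by simp
  then show "{A \<in> choices. c s \<in> A} = choices - {A \<in> choices. s \<in> A}" by blast
qed (simp add: boxes_def)

text \<open>Through this correspondence, equality of the unions of boxes says that the encoded codes
  are hit at the same points.\<close>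

lemma boxes_hit:
  assumes "v \<in> words S d"
  shows "(\<lambda>i\<in>{1..d}. choice (om i)) \<in> boxes d v \<longleftrightarrow> hit {1..d} om (encw c v)"
proof -
  have vS: "v i \<in> S" if "i \<in> {1..d}" for i using assms that by (rule words_mem)
  have e: "choice (om i) \<in> {A \<in> choices. v i \<in> A} \<longleftrightarrow> om i (fst (encw c v i)) = snd (encw c v i)"
    if "i \<in> {1..d}" for i
    using choice_in choice_mem[OF vS[OF that]] unfolding encw_def by blast
  show ?thesis unfolding boxes_def hit_def PiE_iff using e by simp
qed

end

theorem theorem2p7:
  fixes S :: "'a set" and c :: "'a \<Rightarrow> 'a" and d :: nat and V W :: "(nat \<Rightarrow> 'a) set"
  assumes "finite S"
    and "complementation S c"
    and "polybox_code S c d V" and "polybox_code S c d W"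
    and "V \<noteq> {}" and "W \<noteq> {}"
    and "equivalent_codes S c d V W"
    and "\<not> (\<exists>u\<in>V. \<exists>v\<in>V. twin_pair c d u v)"
    and "\<not> (\<exists>u\<in>W. \<exists>v\<in>W. twin_pair c d u v)"
    and "V \<inter> W = {}"
  shows "card V \<ge> 12"
proof -
  note cm = assms(2)
  have sub: "V \<subseteq> words S d" "W \<subseteq> words S d" using assms(3,4) unfolding polybox_code_def by auto
  have "finite (words S d)" unfolding words_def using assms(1) by (simp add: finite_PiE)
  then have fin: "finite V" "finite W" using sub finite_subset by blast+
  obtain v where v: "v \<in> words S d" using assms(5) sub by blast
  \<comment> \<open>For empty \<open>S\<close> the set \<open>choices\<close> has one element only,
    so as soon as there is a coordinate the universal map requires a letter.\<close>
  have "S \<noteq> {} \<or> d = 0"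
  proof (cases "d = 0")
    case False
    then have "v 1 \<in> S" using words_mem[OF cm v, of 1] by simp
    then show ?thesis by blast
  qed simp
  from preserves_boxes[OF cm this]
  have eq: "(\<Union>v\<in>V. boxes S c d v) = (\<Union>w\<in>W. boxes S c d w)"
    using assms(7) unfolding equivalent_codes_def by blast
  interpret rival "{1..d}" "encw c ` V" "encw c ` W"
  proof
    show "code {1..d} (encw c ` V)" using code_encw[OF cm assms(3,8)] .
    show "code {1..d} (encw c ` W)" using code_encw[OF cm assms(4,9)] .
    show "(\<exists>v\<in>encw c ` V. hit {1..d} om v) \<longleftrightarrow> (\<exists>w\<in>encw c ` W. hit {1..d} om w)" for om
    proof -
      let ?x = "\<lambda>i\<in>{1..d}. choice S c (om i)"
      have "(\<exists>v\<in>encw c ` U. hit {1..d} om v) \<longleftrightarrow> ?x \<in> (\<Union>u\<in>U. boxes S c d u)" if "U \<subseteq> words S d" for U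
        using boxes_hit[OF cm] that by blast
      from this[OF sub(1)] this[OF sub(2)] eq show ?thesis by simp
    qed
    show "\<not> agree {1..d} v w" if vw: "v \<in> encw c ` V" "w \<in> encw c ` W" for v w
    proof
      assume a: "agree {1..d} v w"
      from vw obtain v' w' where *: "v' \<in> V" "v = encw c v'" "w' \<in> W" "w = encw c w'" by blast
      have "v' = w'" using encw_inj[OF cm, of v' d w'] * a sub by blast
      with * assms(10) show False by blast
    qed
  qed (use fin in simp_all)
  have "inj_on (encw c) V"
    by (rule inj_onI) (use encw_inj[OF cm] sub in \<open>metis agree_refl subsetD\<close>)
  then have "card (encw c ` V) = card V" by (rule card_image)
  with card_ge_12 assms(5) show ?thesis by simp
qed

end
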